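(* Let $\mu\in\Delta_m$, $\nu\in\Delta_n$ have positive entries and let $C\in\mathbb R^{m\times n}$. There exist constants $\tau_0>0$ and $B>0$ depending only on $\mu,\nu,C$ such that the following holds for every $\tau\in(0,\tau_0]$ and every $(f^0,g^0)\in\mathbb R^m\times\mathbb R^n$. Let $(f^k,g^k)_{k\ge 0}$ be the Sinkhorn iterates with regularization $\tau$ initialized at $(f^0,g^0)$, and let $(f(t),g(t))_{t\ge 0}$ be the cold Sinkhorn dynamics initialized at $(f(0),g(0))=(f_0[g^0],\,g_0[f_0[g^0]])\in\partial\mathcal F$, with number $L\le 2^{mn}-1$ of non-final phases and final phase transition time $t_L$. Then $$\sup_{0\le t\le t_L}\Big(\big\|f^{\lfloor 2t/\tau\rfloor+2}-f(t)\big\|_\infty+\big\|g^{\lfloor 2t/\tau\rfloor+2}-g(t)\big\|_\infty\Big)\le B\,\tau\,(\log 1/\tau)^{2L+1}.$$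
   Context: $\Delta_N$ is the probability simplex in $\mathbb R^N$; $H(p|q)=\sum_I p_I\log(p_I/q_I)$ is relative entropy. **Sinkhorn algorithm.** For $\tau>0$, $f_\tau[g]_i=-\tau\log\sum_j e^{(-C_{ij}+g_j)/\tau}\nu_j$ and $g_\tau[f]_j=-\tau\log\sum_i e^{(-C_{ij}+f_i)/\tau}\mu_i$. From $(f^0,g^0)$: for $k\ge0$ even, $f^{k+1}=f_\tau[g^k]$, $g^{k+1}=g^k$; for $k$ odd, $f^{k+1}=f^k$, $g^{k+1}=g_\tau[f^k]$. **Dual OT polytope.** $\mathcal F=\{(f,g)\in\mathbb R^m\times\mathbb R^n:\ f_i+g_j\le C_{ij}\ \forall i,j\}$; $\partial\mathcal F$ is its Pareto frontier: the set of $(f,g)\in\mathcal F$ such that the only $(f',g')\in\mathcal F$ with $f'_i\ge f_i$ and $g'_j\ge g_j$ for all $i,j$ is $(f,g)$ itself. Also $f_0[g]_i=\min_j (C_{ij}-g_j)$ and $g_0[f]_j=\min_i (C_{ij}-f_i)$. **The vectors $v^*(\mathcal E),w^*(\mathcal E)$.** For $\mathcal E\subset\{1,\dots,m\}\times\{1,\dots,n\}$, $\Delta_{\mathcal E}$ is the set of probability distributions on $\mathcal E$; for $\pi\in\Delta_{\mathcal E}$, $(X_\sharp\pi)_i=\sum_{j:(i,j)\in\mathcal E}\pi_{ij}$ and $(Y_\sharp\pi)_j=\sum_{i:(i,j)\in\mathcal E}\pi_{ij}$. If the bipartite graph on $\{1,\dots,m\}\sqcup\{1,\dots,n\}$ with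 edge set $\mathcal E$ has no isolated vertex, let $\mu^*(\mathcal E)$ be the minimizer of $H(\bar\mu|\mu)$ over $\bar\mu$ such that there is $Q\in\Delta_{\mathcal E}$ with $X_\sharp Q=\bar\mu$, $Y_\sharp Q=\nu$; let $\nu^*(\mathcal E)$ be the minimizer of $H(\bar\nu|\nu)$ over $\bar\nu$ such that there is $P\in\Delta_{\mathcal E}$ with $X_\sharp P=\mu$, $Y_\sharp P=\bar\nu$; and $v^*(\mathcal E)_i=\log(\mu_i/\mu^*_i(\mathcal E))$, $w^*(\mathcal E)_j=\log(\nu_j/\nu^*_j(\mathcal E))$. **Cold Sinkhorn dynamics.** For $(\bar f^0,\bar g^0)\in\partial\mathcal F$, it is the continuous curve with $f(0)=\bar f^0$, $g(0)=\bar g^0$ and $\frac{d}{dt}f(t)=\bar v^\ell$, $\frac{d}{dt}g(t)=\bar w^\ell$ for $t\in[t_\ell,t_{\ell+1})$, $\ell\le L$, where $(t_\ell,\bar v^\ell,\bar w^\ell,\mathcal E^\ell)_{\ell\le L}$ is defined recursively: $t_0=0$, $\mathcal E^0=\{(i,j):\bar f^0_i+\bar g^0_j-C_{ij}=0\}$, $\bar v^0=v^*(\mathcal E^0)$, $\bar w^0=w^*(\mathcal E^0)$; and for $\ell\ge0$, $$t_{\ell+1}=\inf\Big\{t\ge t_\ell:\ \max_{(i,j)\notin\mathcal E^\ell} f_i(t_\ell)+g_j(t_\ell)+(t-t_\ell)(\bar v^\ell_i+\bar w^\ell_j)-C_{ij}\ge0\Big\}.$$ If $t_{\ell+1}<\infty$,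 then $\mathcal E^{\ell+1}=\{(i,j): f_i(t_\ell)+g_j(t_\ell)+(t_{\ell+1}-t_\ell)(\bar v^\ell_i+\bar w^\ell_j)-C_{ij}=0\}$, $\bar v^{\ell+1}=v^*(\mathcal E^{\ell+1})$, $\bar w^{\ell+1}=w^*(\mathcal E^{\ell+1})$. If $t_{\ell+1}=\infty$, then $L=\ell$ and the sequence stops. Set $t_{L+1}=\infty$. (All the sets $\mathcal E^\ell$ arising have no isolated vertex, and $L$ is finite with $L+1\le 2^{mn}$.) *)

theory Defs
  imports "HOL-Analysis.Analysis"
begin

text \<open>
  The index sets \<open>{1,\<dots>,m}\<close> and \<open>{1,\<dots>,n}\<close> are the finite types \<open>'m\<close> and \<open>'n\<close>; the cost matrix
  \<open>C :: real^'n^'m\<close> has entries \<open>C $ i $ j\<close>.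
\<close>

definition prob_simplex :: "(real^'k) set" where
  "prob_simplex = {p. (\<forall>k. 0 \<le> p $ k) \<and> (\<Sum>k\<in>UNIV. p $ k) = 1}"

text \<open>The convention \<open>0 log 0 = 0\<close> holds here because \<open>0 * x = 0\<close>.\<close>

definition rel_entropy :: "real^'k \<Rightarrow> real^'k \<Rightarrow> real" where
  "rel_entropy p q = (\<Sum>k\<in>UNIV. p $ k * ln (p $ k / q $ k))"


definition f_soft :: "real \<Rightarrow> real^'n \<Rightarrow> real^'n^'m \<Rightarrow> real^'n \<Rightarrow> real^'m" where
  "f_soft \<tau> \<nu> C g = (\<chi> i. - \<tau> * ln (\<Sum>j\<in>UNIV. exp ((- (C $ i $ j) + g $ j) / \<tau>) * \<nu> $ j))"

definition g_soft :: "real \<Rightarrow> real^'m \<Rightarrow> real^'n^'m \<Rightarrow> real^'m \<Rightarrow> real^'n" where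
  "g_soft \<tau> \<mu> C f = (\<chi> j. - \<tau> * ln (\<Sum>i\<in>UNIV. exp ((- (C $ i $ j) + f $ i) / \<tau>) * \<mu> $ i))"

primrec sinkhorn ::
  "real \<Rightarrow> real^'m \<Rightarrow> real^'n \<Rightarrow> real^'n^'m \<Rightarrow> real^'m \<Rightarrow> real^'n \<Rightarrow> nat \<Rightarrow> (real^'m) \<times> (real^'n)"
where
  "sinkhorn \<tau> \<mu> \<nu> C f0 g0 0 = (f0, g0)"
| "sinkhorn \<tau> \<mu> \<nu> C f0 g0 (Suc k) =
    (let (f, g) = sinkhorn \<tau> \<mu> \<nu> C f0 g0 k
     in if even k then (f_soft \<tau> \<nu> C g, g) else (f, g_soft \<tau> \<mu> C f))"


definition f_hard :: "real^'n^'m \<Rightarrow> real^'n \<Rightarrow> real^'m" where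
  "f_hard C g = (\<chi> i. MIN j. C $ i $ j - g $ j)"

definition g_hard :: "real^'n^'m \<Rightarrow> real^'m \<Rightarrow> real^'n" where
  "g_hard C f = (\<chi> j. MIN i. C $ i $ j - f $ i)"

definition dual_polytope :: "real^'n^'m \<Rightarrow> ((real^'m) \<times> (real^'n)) set" where
  "dual_polytope C = {(f, g). \<forall>i j. f $ i + g $ j \<le> C $ i $ j}"

definition pareto_frontier :: "((real^'m) \<times> (real^'n)) set \<Rightarrow> ((real^'m) \<times> (real^'n)) set" where
  "pareto_frontier F = {(f, g). (f, g) \<in> F \<and>
     (\<forall>f' g'. (f', g') \<in> F \<and> (\<forall>i. f' $ i \<ge> f $ i) \<and> (\<forall>j. g' $ j \<ge> g $ j) \<longrightarrow> (f', g') = (f, g))}"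


text \<open>A probability distribution on \<open>E\<close> is a matrix that vanishes off \<open>E\<close>.\<close>

definition distributions_on :: "('m \<times> 'n) set \<Rightarrow> (real^'n^'m) set" where
  "distributions_on E = {P. (\<forall>i j. 0 \<le> P $ i $ j) \<and> (\<forall>i j. (i, j) \<notin> E \<longrightarrow> P $ i $ j = 0) \<and>
     (\<Sum>(i, j)\<in>E. P $ i $ j) = 1}"

definition X_marginal :: "('m \<times> 'n) set \<Rightarrow> real^'n^'m \<Rightarrow> real^'m" where
  "X_marginal E P = (\<chi> i. \<Sum>j | (i, j) \<in> E. P $ i $ j)"

definition Y_marginal :: "('m \<times> 'n) set \<Rightarrow> real^'n^'m \<Rightarrow> real^'n" where
  "Y_marginal E P = (\<chi> j. \<Sum>i | (i, j) \<in> E. P $ i $ j)"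

definition no_isolated_vertex :: "('m \<times> 'n) set \<Rightarrow> bool" where
  "no_isolated_vertex E \<longleftrightarrow> (\<forall>i. \<exists>j. (i, j) \<in> E) \<and> (\<forall>j. \<exists>i. (i, j) \<in> E)"

text \<open>
  For \<open>\<mu>\<close>, \<open>\<nu>\<close> in the simplex with positive entries and \<open>no_isolated_vertex E\<close>, the minimizers
  exist, are unique (strict convexity on a nonempty compact convex set) and have positive entries.
  The definitions are only meant for that case.
\<close>

definition mu_star :: "real^'m \<Rightarrow> real^'n \<Rightarrow> ('m \<times> 'n) set \<Rightarrow> real^'m" where
  "mu_star \<mu> \<nu> E = arg_min_on (\<lambda>\<mu>'. rel_entropy \<mu>' \<mu>)
     {\<mu>'. \<exists>Q\<in>distributions_on E. X_marginal E Q = \<mu>' \<and> Y_marginal E Q = \<nu>}"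

definition nu_star :: "real^'m \<Rightarrow> real^'n \<Rightarrow> ('m \<times> 'n) set \<Rightarrow> real^'n" where
  "nu_star \<mu> \<nu> E = arg_min_on (\<lambda>\<nu>'. rel_entropy \<nu>' \<nu>)
     {\<nu>'. \<exists>P\<in>distributions_on E. X_marginal E P = \<mu> \<and> Y_marginal E P = \<nu>'}"

definition v_star :: "real^'m \<Rightarrow> real^'n \<Rightarrow> ('m \<times> 'n) set \<Rightarrow> real^'m" where
  "v_star \<mu> \<nu> E = (\<chi> i. ln (\<mu> $ i / mu_star \<mu> \<nu> E $ i))"

definition w_star :: "real^'m \<Rightarrow> real^'n \<Rightarrow> ('m \<times> 'n) set \<Rightarrow> real^'n" where
  "w_star \<mu> \<nu> E = (\<chi> j. ln (\<nu> $ j / nu_star \<mu> \<nu> E $ j))"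


definition contact_set :: "real^'n^'m \<Rightarrow> real^'m \<Rightarrow> real^'n \<Rightarrow> ('m \<times> 'n) set" where
  "contact_set C f g = {(i, j). f $ i + g $ j - C $ i $ j = 0}"

text \<open>
  The phase transition time following \<open>t0\<close>, when \<open>(f, g)\<close> is the position at time \<open>t0\<close>.
  Extended reals give the conventions for the empty set: the infimum is \<open>\<infinity>\<close>, and the maximum
  over the complement of \<open>E\<close> (written as a supremum) is \<open>-\<infinity>\<close>.
\<close>

definition transition_time ::
  "real^'n^'m \<Rightarrow> ('m \<times> 'n) set \<Rightarrow> real \<Rightarrow> real^'m \<Rightarrow> real^'n \<Rightarrow> real^'m \<Rightarrow> real^'n \<Rightarrow> ereal"
where
  "transition_time C E t0 f g v w = Inf (ereal ` {t. t0 \<le> t \<and>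
     (SUP (i, j)\<in>- E. ereal (f $ i + g $ j + (t - t0) * (v $ i + w $ j) - C $ i $ j)) \<ge> 0})"

text \<open>
  \<open>(f, g)\<close> is the cold Sinkhorn dynamics started at \<open>(f0, g0)\<close>, with phase data
  \<open>t l, v l, w l, E l\<close> for \<open>l \<le> L\<close>; values of these sequences beyond \<open>L\<close> are irrelevant.
  The time \<open>t\<^bsub>l+1\<^esub>\<close> is \<open>T l\<close>, which is finite for \<open>l < L\<close> and is \<open>\<infinity>\<close> for \<open>l = L\<close>.
  The derivative at the left end point of a phase is one-sided. The clause on isolated vertices
  is the domain condition of \<open>v_star\<close> and \<open>w_star\<close>.
\<close>

definition cold_sinkhorn_dynamics ::
  "real^'m \<Rightarrow> real^'n \<Rightarrow> real^'n^'m \<Rightarrow> real^'m \<Rightarrow> real^'n \<Rightarrow>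
   nat \<Rightarrow> (nat \<Rightarrow> real) \<Rightarrow> (nat \<Rightarrow> real^'m) \<Rightarrow> (nat \<Rightarrow> real^'n) \<Rightarrow> (nat \<Rightarrow> ('m \<times> 'n) set) \<Rightarrow>
   (real \<Rightarrow> real^'m) \<Rightarrow> (real \<Rightarrow> real^'n) \<Rightarrow> bool"
where
  "cold_sinkhorn_dynamics \<mu> \<nu> C f0 g0 L t v w E f g \<longleftrightarrow>
    (let T = (\<lambda>l. transition_time C (E l) (t l) (f (t l)) (g (t l)) (v l) (w l));
         phase = (\<lambda>l. {s. t l \<le> s \<and> ereal s < T l})
     in
      continuous_on {0..} f \<and> continuous_on {0..} g \<and> f 0 = f0 \<and> g 0 = g0 \<and>
      t 0 = 0 \<and> E 0 = contact_set C f0 g0 \<and>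
      (\<forall>l\<le>L. no_isolated_vertex (E l) \<and> v l = v_star \<mu> \<nu> (E l) \<and> w l = w_star \<mu> \<nu> (E l)) \<and>
      (\<forall>l<L. T l = ereal (t (Suc l)) \<and>
             E (Suc l) = contact_set C (f (t l) + (t (Suc l) - t l) *\<^sub>R v l)
                                       (g (t l) + (t (Suc l) - t l) *\<^sub>R w l)) \<and>
      T L = \<infinity> \<and>
      (\<forall>l\<le>L. \<forall>s\<in>phase l.
         (f has_vector_derivative v l) (at s within phase l) \<and>
         (g has_vector_derivative w l) (at s within phase l)))"

end

theory Submission
  imports Defs "HOL-Real_Asymp.Real_Asymp"
begin

text \<open>
  Let \<open>S\<close> be one full cycle \<open>f \<mapsto> f\<^sub>\<tau>[g\<^sub>\<tau>[f]]\<close> of the algorithm. It takes the time \<open>\<tau>\<close> on the clock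
  of the cold dynamics. Both \<open>S\<close> and \<open>g\<^sub>\<tau>\<close> are nonexpansive in the supremum norm, so that errors made
  along an orbit add up and are never amplified. Moreover \<open>g\<^sub>\<tau>[f(t)]\<close> is within \<open>O(\<tau>)\<close> of \<open>g(t)\<close>,
  because every column has a pair in contact; hence only \<open>f\<close> has to be followed. The theorem thus
  reduces to a statement about one phase (\<open>phase_tracking\<close>): the orbit of \<open>S\<close> that starts at the
  exact position \<open>f(t\<^sub>l)\<close> stays within \<open>O(\<tau> log(1/\<tau>))\<close> of \<open>f(t\<^sub>l) + k\<tau>v\<close> as long as the phase lasts.
  There are at most \<open>2^(mn)\<close> phases, so the total error is \<open>O(\<tau> log(1/\<tau>))\<close>, and this implies the
  asserted bound since \<open>log(1/\<tau>) \<ge> 1\<close>.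

  Within a phase with velocities \<open>v\<close>, \<open>w\<close> there is a coupling \<open>Q\<close> with marginals \<open>\<mu>e\<^sup>-\<^sup>v\<close> and \<open>\<nu>\<close> that
  lives on the contact pairs with \<open>v\<^sub>i + w\<^sub>j = 0\<close>, while \<open>v\<^sub>i + w\<^sub>j \<le> 0\<close> on all contact pairs
  (\<open>certificate\<close>; these are the optimality conditions of the problem that defines \<open>\<mu>\<^sup>*\<close>, and they
  determine \<open>\<mu>\<^sup>*\<close> and \<open>\<nu>\<^sup>*\<close>). The orbit is compared with potentials \<open>f + r\<tau>v + \<tau>a\<close>, \<open>g + r\<tau>w + \<tau>b\<close>,
  where \<open>a\<close> and \<open>b\<close> do not depend on the step \<open>r\<close>. If the matrix
  \<open>\<mu>\<^sub>i \<nu>\<^sub>j exp((f\<^sub>i + g\<^sub>j - C\<^sub>i\<^sub>j)/\<tau>)\<close> formed with them has marginals \<open>\<mu>e\<^sup>-\<^sup>v\<close> and \<open>\<nu>\<close> up to a relative error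
  \<open>\<eta>\<close>, then \<open>S\<close> maps the first potential to its successor up to \<open>4\<tau>\<eta>\<close> (\<open>ansatz_step\<close>). Entries with
  \<open>v\<^sub>i + w\<^sub>j \<noteq> 0\<close> are negligible except during \<open>O(log(1/\<tau>))\<close> steps at each end of the phase, where the
  trivial bound \<open>O(\<tau>)\<close> per step suffices. The entries with \<open>v\<^sub>i + w\<^sub>j = 0\<close> are constant in \<open>r\<close>, and \<open>a\<close>,
  \<open>b\<close> have to scale this fixed matrix to the marginals of \<open>Q\<close>. Pairs that are neutral but not in
  contact may have any slack, so the matrix is arbitrary apart from a lower bound on the support of
  \<open>Q\<close>, and an exact scaling need not exist. What exists (\<open>bounded_approximate_scaling\<close>) is a scaling
  with accuracy \<open>\<epsilon>\<close> and potentials of size \<open>O(log(1/\<epsilon>))\<close>, uniformly in the matrix. For \<open>\<epsilon>\<close> of order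
  \<open>\<tau>\<close> the errors of the \<open>O(1/\<tau>)\<close> steps of a phase sum to \<open>O(\<tau>)\<close>, and the shift by \<open>\<tau>a\<close> costs
  \<open>O(\<tau> log(1/\<tau>))\<close>.

  The quantity \<open>\<Sum>\<^sub>j \<nu>\<^sub>j w\<^sub>j = H(\<mu>\<^sup>*|\<mu>)\<close> strictly decreases at every transition, because the old \<open>Q\<close> is
  still supported on the new contact set while a pair with \<open>v\<^sub>i + w\<^sub>j > 0\<close> comes into contact. So the contact sets of different
  phases are different, which gives the existence of the dynamics and the bound on \<open>L\<close>. Phases other
  than the last have bounded length, because slacks are at most \<open>4 max|C|\<close> and the positive closing
  speeds \<open>v\<^sub>i + w\<^sub>j\<close> take finitely many values.
\<close>


section \<open>Soft transforms and the Sinkhorn cycle\<close>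

lemma infnorm_le_iff: "infnorm (x :: real^'k) \<le> b \<longleftrightarrow> (\<forall>i. \<bar>x $ i\<bar> \<le> b)"
proof
  assume "infnorm x \<le> b"
  then show "\<forall>i. \<bar>x $ i\<bar> \<le> b"
    using component_le_infnorm_cart[of x] order_trans by blast
next
  assume *: "\<forall>i. \<bar>x $ i\<bar> \<le> b"
  show "infnorm x \<le> b"
    unfolding infnorm_cart by (rule cSup_least) (use * in auto)
qed

lemma abs_diff_le_infnorm: "\<bar>x $ i - y $ i\<bar> \<le> infnorm (x - y :: real^'k)"
  using component_le_infnorm_cart[of "x - y" i] by simp

lemma infnorm_dist_triangle: "infnorm (x - z) \<le> infnorm (x - y) + infnorm (y - z :: real^'k)"
  using infnorm_triangle[of "x - y" "y - z"] by simp

lemma g_soft_eq_f_soft: "g_soft \<tau> \<mu> C f = f_soft \<tau> \<mu> (transpose C) f"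
  by (simp add: g_soft_def f_soft_def transpose_def)

text \<open>
  The free parameter \<open>x\<close> makes this a residual formula: if \<open>x\<close> is a candidate for the new value at \<open>i\<close>,
  the correction is governed by how far the sum is from \<open>1\<close>. All later estimates of the soft
  transforms are estimates of this sum.
\<close>

lemma f_soft_residual:
  fixes \<nu> :: "real^'n" and C :: "real^'n^'m"
  assumes "\<tau> > 0" "\<And>j. \<nu> $ j > 0"
  shows "f_soft \<tau> \<nu> C g $ i = x - \<tau> * ln (\<Sum>j\<in>UNIV. exp ((x + g $ j - C $ i $ j) / \<tau>) * \<nu> $ j)"
proof -
  let ?S = "\<Sum>j\<in>UNIV. exp ((- (C $ i $ j) + g $ j) / \<tau>) * \<nu> $ j"
  have S: "?S > 0" by (rule sum_pos) (use assms in auto)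
  have "(\<Sum>j\<in>UNIV. exp ((x + g $ j - C $ i $ j) / \<tau>) * \<nu> $ j) = exp (x / \<tau>) * ?S"
    unfolding sum_distrib_left
    by (rule sum.cong) (auto simp: exp_add[symmetric] add_divide_distrib diff_divide_distrib algebra_simps)
  then have "ln (\<Sum>j\<in>UNIV. exp ((x + g $ j - C $ i $ j) / \<tau>) * \<nu> $ j) = x / \<tau> + ln ?S"
    using S by (simp add: ln_mult)
  then show ?thesis using assms by (simp add: f_soft_def field_simps)
qed

text \<open>
  The transform is antitone in \<open>g\<close>, and adding a constant to \<open>g\<close> subtracts it from the result.
\<close>

lemma f_soft_nonexpansive:
  fixes \<nu> :: "real^'n" and C :: "real^'n^'m"
  assumes \<tau>: "\<tau> > 0" and \<nu>: "\<And>j. \<nu> $ j > 0"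
  shows "infnorm (f_soft \<tau> \<nu> C g - f_soft \<tau> \<nu> C g') \<le> infnorm (g - g')"
proof -
  let ?d = "infnorm (g - g')"
  have one: "f_soft \<tau> \<nu> C h' $ i \<le> f_soft \<tau> \<nu> C h $ i + d"
    if h: "\<And>j. h $ j \<le> h' $ j + d" for h h' :: "real^'n" and i :: 'm and d
  proof -
    let ?S = "\<lambda>h::real^'n. \<Sum>j\<in>UNIV. exp ((- (C $ i $ j) + h $ j) / \<tau>) * \<nu> $ j"
    have pos: "?S h > 0" for h by (rule sum_pos) (use \<nu> in auto)
    have "?S h \<le> exp (d / \<tau>) * ?S h'"
      unfolding sum_distrib_left
    proof (rule sum_mono)
      fix j
      have "exp ((- (C $ i $ j) + h $ j) / \<tau>) \<le> exp (d / \<tau> + (- (C $ i $ j) + h' $ j) / \<tau>)"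
        using h[of j] \<tau> by (simp add: field_simps)
      then show "exp ((- (C $ i $ j) + h $ j) / \<tau>) * \<nu> $ j
          \<le> exp (d / \<tau>) * (exp ((- (C $ i $ j) + h' $ j) / \<tau>) * \<nu> $ j)"
        using \<nu>[of j] by (simp add: exp_add)
    qed
    then have "ln (?S h) \<le> ln (exp (d / \<tau>) * ?S h')" using pos[of h] by simp
    also have "\<dots> = d / \<tau> + ln (?S h')" using pos[of h'] by (simp add: ln_mult)
    finally show ?thesis using \<tau> by (simp add: f_soft_def field_simps)
  qed
  have "\<bar>(f_soft \<tau> \<nu> C g - f_soft \<tau> \<nu> C g') $ i\<bar> \<le> ?d" for i
  proof -
    have "f_soft \<tau> \<nu> C g' $ i \<le> f_soft \<tau> \<nu> C g $ i + ?d"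
      by (rule one) (use abs_diff_le_infnorm[of g _ g'] in \<open>smt (verit)\<close>)
    moreover have "f_soft \<tau> \<nu> C g $ i \<le> f_soft \<tau> \<nu> C g' $ i + ?d"
      by (rule one) (use abs_diff_le_infnorm[of g _ g'] in \<open>smt (verit)\<close>)
    ultimately show ?thesis by simp
  qed
  then show ?thesis unfolding infnorm_le_iff by blast
qed

lemma g_soft_nonexpansive:
  fixes \<mu> :: "real^'m" and C :: "real^'n^'m"
  assumes "\<tau> > 0" "\<And>i. \<mu> $ i > 0"
  shows "infnorm (g_soft \<tau> \<mu> C f - g_soft \<tau> \<mu> C f') \<le> infnorm (f - f')"
  unfolding g_soft_eq_f_soft by (rule f_soft_nonexpansive[OF assms])

text \<open>
  The exponential is at most \<open>1\<close> for every pair and equals \<open>1\<close> for a pair in contact, so the residual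
  sum lies between \<open>c\<close> and \<open>1\<close>.
\<close>

lemma f_soft_near_contact:
  fixes \<nu> :: "real^'n" and C :: "real^'n^'m"
  assumes \<tau>: "\<tau> > 0" and c: "c > 0" "\<And>j. c \<le> \<nu> $ j" and sum1: "(\<Sum>j\<in>UNIV. \<nu> $ j) = 1"
    and feas: "\<And>i j. f $ i + g $ j \<le> C $ i $ j" and contact: "\<And>i. \<exists>j. f $ i + g $ j = C $ i $ j"
  shows "infnorm (f_soft \<tau> \<nu> C g - f) \<le> \<tau> * ln (1 / c)"
proof -
  have \<nu>: "\<nu> $ j > 0" for j using c(1) c(2)[of j] by linarith
  have "\<bar>(f_soft \<tau> \<nu> C g - f) $ i\<bar> \<le> \<tau> * ln (1 / c)" for i
  proof -
    let ?S = "\<Sum>j\<in>UNIV. exp ((f $ i + g $ j - C $ i $ j) / \<tau>) * \<nu> $ j"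
    obtain j where j: "f $ i + g $ j = C $ i $ j" using contact by blast
    have "exp ((f $ i + g $ j - C $ i $ j) / \<tau>) * \<nu> $ j \<le> ?S"
      by (rule member_le_sum) (auto simp: \<nu> less_imp_le)
    then have lo: "c \<le> ?S" using j c(2)[of j] by simp
    have "?S \<le> (\<Sum>j\<in>UNIV. \<nu> $ j)"
    proof (rule sum_mono)
      fix j
      have "exp ((f $ i + g $ j - C $ i $ j) / \<tau>) \<le> 1"
        using feas[of i j] \<tau> by (simp add: divide_nonpos_pos)
      then show "exp ((f $ i + g $ j - C $ i $ j) / \<tau>) * \<nu> $ j \<le> \<nu> $ j"
        using \<nu>[of j] by (simp add: mult_le_cancel_right2 not_less less_imp_le)
    qed
    then have hi: "?S \<le> 1" using sum1 by simp
    have "ln c \<le> ln ?S" "ln ?S \<le> 0" using lo hi c(1) by auto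
    moreover have "(f_soft \<tau> \<nu> C g - f) $ i = \<tau> * (- ln ?S)"
      using f_soft_residual[OF \<tau> \<nu>, of C g i "f $ i"] by simp
    moreover have "\<tau> * (- ln ?S) \<le> \<tau> * ln (1 / c)"
      using \<open>ln c \<le> ln ?S\<close> \<tau> c(1) by (intro mult_left_mono) (auto simp: ln_div)
    moreover have "0 \<le> \<tau> * (- ln ?S)" using \<open>ln ?S \<le> 0\<close> \<tau> by (simp add: mult_nonneg_nonpos)
    ultimately show ?thesis by (simp only: abs_of_nonneg)
  qed
  then show ?thesis unfolding infnorm_le_iff by blast
qed

definition sinkhorn_step :: "real \<Rightarrow> real^'m \<Rightarrow> real^'n \<Rightarrow> real^'n^'m \<Rightarrow> real^'m \<Rightarrow> real^'m" where
  "sinkhorn_step \<tau> \<mu> \<nu> C f = f_soft \<tau> \<nu> C (g_soft \<tau> \<mu> C f)"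

lemma sinkhorn_even:
  "sinkhorn \<tau> \<mu> \<nu> C f0 g0 (2 * r + 2) =
     ((sinkhorn_step \<tau> \<mu> \<nu> C ^^ r) (f_soft \<tau> \<nu> C g0),
      g_soft \<tau> \<mu> C ((sinkhorn_step \<tau> \<mu> \<nu> C ^^ r) (f_soft \<tau> \<nu> C g0)))"
proof (induction r)
  case 0
  show ?case by (simp add: numeral_2_eq_2 Let_def)
next
  case (Suc r)
  have "2 * Suc r + 2 = Suc (Suc (2 * r + 2))" by simp
  then show ?case using Suc by (simp add: sinkhorn_step_def Let_def split_beta)
qed

lemma sinkhorn_odd:
  "sinkhorn \<tau> \<mu> \<nu> C f0 g0 (2 * r + 3) =
     ((sinkhorn_step \<tau> \<mu> \<nu> C ^^ Suc r) (f_soft \<tau> \<nu> C g0),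
      g_soft \<tau> \<mu> C ((sinkhorn_step \<tau> \<mu> \<nu> C ^^ r) (f_soft \<tau> \<nu> C g0)))"
proof -
  have "2 * r + 3 = Suc (2 * r + 2)" by simp
  then show ?thesis
    by (simp only: sinkhorn.simps sinkhorn_even) (simp add: sinkhorn_step_def)
qed

lemma sinkhorn_step_nonexpansive:
  fixes \<mu> :: "real^'m" and \<nu> :: "real^'n" and C :: "real^'n^'m"
  assumes "\<tau> > 0" "\<And>i. \<mu> $ i > 0" "\<And>j. \<nu> $ j > 0"
  shows "infnorm (sinkhorn_step \<tau> \<mu> \<nu> C f - sinkhorn_step \<tau> \<mu> \<nu> C f') \<le> infnorm (f - f')"
  unfolding sinkhorn_step_def
  using f_soft_nonexpansive[OF assms(1,3), of C "g_soft \<tau> \<mu> C f" "g_soft \<tau> \<mu> C f'"]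
    g_soft_nonexpansive[OF assms(1,2), of C f f'] by (rule order_trans)

lemma funpow_nonexpansive:
  fixes S :: "real^'m \<Rightarrow> real^'m"
  assumes "\<And>x y. infnorm (S x - S y) \<le> infnorm (x - y)"
  shows "infnorm ((S ^^ k) x - (S ^^ k) y) \<le> infnorm (x - y)"
  by (induction k) (auto intro: order_trans assms)


section \<open>Approximate matrix scaling with small potentials\<close>

text \<open>
  Summed over the entries of a matrix, this bounds the dual objective of the scaling problem from
  below by a constant that depends on \<open>A\<close> only through \<open>c\<close>.
\<close>

lemma exp_tilt_lower_bound:
  fixes A Q c s :: real
  assumes "0 \<le> A" "0 \<le> Q" "Q \<le> 1" "c > 0" "Q > 0 \<Longrightarrow> c \<le> A"
  shows "- (1 / (2 * c)) \<le> A * exp s - Q * s"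
proof (cases "Q = 0 \<or> s \<le> 0")
  case True
  then have "0 \<le> A * exp s - Q * s"
    using assms by (auto simp: mult_nonneg_nonpos intro: order_trans[of _ 0])
  moreover have "- (1 / (2 * c)) \<le> 0" using assms by simp
  ultimately show ?thesis by linarith
next
  case False
  then have s: "s > 0" and A: "c \<le> A" using assms by auto
  have "1 + s + s\<^sup>2 / 2 \<le> exp s" using exp_lower_Taylor_quadratic[of s] s by simp
  then have "s\<^sup>2 / 2 \<le> exp s" using s by linarith
  then have "c * (s\<^sup>2 / 2) \<le> A * exp s" using A assms by (intro mult_mono) auto
  moreover have "Q * s \<le> s" using assms s by (simp add: mult_le_cancel_right1)
  moreover have "- (1 / (2 * c)) \<le> c * (s\<^sup>2 / 2) - s"
  proof -
    have "0 \<le> (c * s - 1)\<^sup>2 / (2 * c)" using assms by simp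
    also have "\<dots> = c * (s\<^sup>2 / 2) - s + 1 / (2 * c)"
      using assms by (simp add: field_simps power2_eq_square)
    finally show ?thesis by linarith
  qed
  ultimately show ?thesis by linarith
qed

text \<open>
  The gradient of the convex function \<open>\<Sum> A\<^sub>i\<^sub>j e^(a\<^sub>i + b\<^sub>j) - \<Sum> Q\<^sub>i\<^sub>j (a\<^sub>i + b\<^sub>j)\<close> consists of the errors in the
  marginals. Its infimum need not be attained, but after adding \<open>\<delta>/2 |z|\<^sup>2\<close> it is, and at the minimizer the
  errors are \<open>-\<delta>z\<close>. Comparison with the value at \<open>0\<close> bounds \<open>\<delta>|z|\<^sup>2\<close>, so that \<open>\<delta>|z| = O(\<surd>\<delta>)\<close>.
  For \<open>a\<close> and \<open>b\<close> this gives only a bound of order \<open>1/\<epsilon>\<close>, which the collapse of gaps improves below.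
\<close>

lemma approximate_scaling_exists:
  fixes A Q :: "'m::finite \<Rightarrow> 'n::finite \<Rightarrow> real" and c \<epsilon> :: real
  assumes A: "\<And>i j. 0 \<le> A i j" "\<And>i j. A i j \<le> 1"
    and Q: "\<And>i j. 0 \<le> Q i j" "\<And>i j. Q i j \<le> 1"
    and c: "c > 0" "\<And>i j. Q i j > 0 \<Longrightarrow> c \<le> A i j" and \<epsilon>: "\<epsilon> > 0"
  shows "\<exists>a b. (\<forall>i. \<bar>(\<Sum>j\<in>UNIV. A i j * exp (a i + b j)) - (\<Sum>j\<in>UNIV. Q i j)\<bar> \<le> \<epsilon>) \<and>
               (\<forall>j. \<bar>(\<Sum>i\<in>UNIV. A i j * exp (a i + b j)) - (\<Sum>i\<in>UNIV. Q i j)\<bar> \<le> \<epsilon>)"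
proof -
  define N where "N = real (CARD('m) * CARD('n))"
  define M where "M = N * (1 + 1 / (2 * c))"
  \<comment> \<open>\<open>\<delta> |z|\<^sup>2 \<le> 2M\<close> at the minimizer, so this choice gives \<open>\<delta> |z| \<le> \<epsilon>\<close>.\<close>
  define \<delta> where "\<delta> = \<epsilon>\<^sup>2 / (2 * M)"
  define \<Psi> where "\<Psi> = (\<lambda>z :: (real^'m) \<times> (real^'n). \<Sum>i\<in>UNIV. \<Sum>j\<in>UNIV.
      A i j * exp (fst z $ i + snd z $ j) - Q i j * (fst z $ i + snd z $ j))"
  define \<Phi> where "\<Phi> = (\<lambda>z. \<Psi> z + \<delta> / 2 * (z \<bullet> z))"
  define R where "R = sqrt (2 * M / \<delta>) + 1"
  have N: "N > 0" unfolding N_def by (simp add: zero_less_card_finite)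
  have M: "M > 0" unfolding M_def using N c by (intro mult_pos_pos) (auto intro: add_pos_pos)
  have \<delta>: "\<delta> > 0" unfolding \<delta>_def using M \<epsilon> by simp
  have lower: "- (N * (1 / (2 * c))) \<le> \<Psi> z" for z
  proof -
    have "- (N * (1 / (2 * c))) = (\<Sum>i\<in>(UNIV::'m set). \<Sum>j\<in>(UNIV::'n set). - (1 / (2 * c)))"
      by (simp add: N_def)
    also have "\<dots> \<le> \<Psi> z"
      unfolding \<Psi>_def by (intro sum_mono exp_tilt_lower_bound A Q c)
    finally show ?thesis .
  qed
  have \<Phi>0: "\<Phi> 0 \<le> N"
  proof -
    have "\<Phi> 0 = (\<Sum>i\<in>UNIV. \<Sum>j\<in>UNIV. A i j)" by (simp add: \<Phi>_def \<Psi>_def)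
    also have "\<dots> \<le> (\<Sum>i\<in>(UNIV::'m set). \<Sum>j\<in>(UNIV::'n set). 1)"
      by (intro sum_mono A)
    finally show ?thesis by (simp add: N_def)
  qed
  have cont: "continuous_on (cball 0 R) \<Phi>"
    unfolding \<Phi>_def \<Psi>_def by (intro continuous_intros)
  have R: "R > 0" using M \<delta> by (simp add: R_def add_nonneg_pos)
  obtain z where z: "\<And>y. y \<in> cball 0 R \<Longrightarrow> \<Phi> z \<le> \<Phi> y"
    using continuous_attains_inf[OF compact_cball _ cont] R by force
  have glob: "\<Phi> z \<le> \<Phi> y" for y
  proof (cases "y \<in> cball 0 R")
    case False
    then have "R < norm y" by simp
    then have "R\<^sup>2 \<le> y \<bullet> y" using R by (simp add: dot_square_norm power_mono)
    moreover have "2 * M / \<delta> \<le> R\<^sup>2"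
    proof -
      have "2 * M / \<delta> = (sqrt (2 * M / \<delta>))\<^sup>2" using M \<delta> by simp
      also have "\<dots> \<le> R\<^sup>2" unfolding R_def by (rule power_mono) (use M \<delta> in auto)
      finally show ?thesis .
    qed
    ultimately have "2 * M / \<delta> \<le> y \<bullet> y" by linarith
    then have "M \<le> \<delta> / 2 * (y \<bullet> y)" using \<delta> by (simp add: field_simps)
    then have "N \<le> \<Phi> y" using lower[of y] unfolding \<Phi>_def M_def by (simp add: algebra_simps)
    then show ?thesis using z[of 0] R \<Phi>0 by simp
  qed (rule z)
  have "\<delta> / 2 * (z \<bullet> z) \<le> M"
    using glob[of 0] \<Phi>0 lower[of z] unfolding \<Phi>_def[of] M_def by (simp add: algebra_simps)
  then have "\<delta> * (\<delta> * (z \<bullet> z)) \<le> \<delta> * (2 * M)" using \<delta> by (intro mult_left_mono) auto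
  also have "\<dots> = \<epsilon>\<^sup>2" using M by (simp add: \<delta>_def)
  also have "\<delta> * (\<delta> * (z \<bullet> z)) = (\<delta> * norm z)\<^sup>2"
    by (simp add: power_mult_distrib dot_square_norm) (simp add: power2_eq_square)
  finally have "(\<delta> * norm z)\<^sup>2 \<le> \<epsilon>\<^sup>2" .
  then have small: "\<delta> * norm z \<le> \<epsilon>" using \<epsilon> by (intro power2_le_imp_le[of "\<delta> * norm z"]) auto
  define a where "a = (\<lambda>i. fst z $ i)"
  define b where "b = (\<lambda>j. snd z $ j)"
  have crit: "(\<Sum>i\<in>UNIV. \<Sum>j\<in>UNIV. (A i j * exp (a i + b j) - Q i j) * (fst u $ i + snd u $ j)) + \<delta> * (z \<bullet> u) = 0"
    for u :: "(real^'m) \<times> (real^'n)"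
  proof -
    define h where "h = (\<lambda>t. \<Phi> (z + t *\<^sub>R u))"
    have h: "h = (\<lambda>t. (\<Sum>i\<in>UNIV. \<Sum>j\<in>UNIV.
        A i j * exp ((a i + b j) + t * (fst u $ i + snd u $ j)) - Q i j * ((a i + b j) + t * (fst u $ i + snd u $ j)))
        + \<delta> / 2 * (z \<bullet> z + 2 * t * (z \<bullet> u) + t * t * (u \<bullet> u)))"
      unfolding h_def \<Phi>_def \<Psi>_def a_def b_def
      by (rule ext) (simp add: inner_add_left inner_add_right inner_commute algebra_simps)
    have d: "(h has_real_derivative (\<Sum>i\<in>UNIV. \<Sum>j\<in>UNIV. A i j * (exp ((a i + b j) + 0 * (fst u $ i + snd u $ j)) * (fst u $ i + snd u $ j))
         - Q i j * (fst u $ i + snd u $ j)) + \<delta> / 2 * (2 * (z \<bullet> u) + (0 + 0) * (u \<bullet> u))) (at 0)"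
      unfolding h by (auto intro!: derivative_eq_intros) (intro sum.cong refl, simp add: mult_ac)
    have "\<forall>y. \<bar>0 - y\<bar> < 1 \<longrightarrow> h 0 \<le> h y" unfolding h_def using glob by simp
    then have "(\<Sum>i\<in>UNIV. \<Sum>j\<in>UNIV. A i j * (exp ((a i + b j) + 0 * (fst u $ i + snd u $ j)) * (fst u $ i + snd u $ j))
         - Q i j * (fst u $ i + snd u $ j)) + \<delta> / 2 * (2 * (z \<bullet> u) + (0 + 0) * (u \<bullet> u)) = 0"
      using DERIV_local_min[OF d, of 1] by simp
    then show ?thesis by (simp add: left_diff_distrib mult.assoc)
  qed
  have zu: "\<bar>\<delta> * (z \<bullet> u)\<bar> \<le> \<epsilon>" if "norm u = 1" for u
  proof -
    have "\<bar>\<delta> * (z \<bullet> u)\<bar> = \<delta> * \<bar>z \<bullet> u\<bar>" using \<delta> by (simp add: abs_mult)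
    also have "\<dots> \<le> \<delta> * norm z"
      using Cauchy_Schwarz_ineq2[of z u] that \<delta> by (intro mult_left_mono) auto
    finally show ?thesis using small by simp
  qed
  have "\<bar>(\<Sum>j\<in>UNIV. A i j * exp (a i + b j)) - (\<Sum>j\<in>UNIV. Q i j)\<bar> \<le> \<epsilon>" for i
  proof -
    have "(\<Sum>k\<in>UNIV. \<Sum>j\<in>UNIV. (A k j * exp (a k + b j) - Q k j) * axis i 1 $ k)
        = (\<Sum>k\<in>UNIV. if k = i then \<Sum>j\<in>UNIV. A k j * exp (a k + b j) - Q k j else 0)"
      by (rule sum.cong) (auto simp: axis_def)
    then have "(\<Sum>j\<in>UNIV. A i j * exp (a i + b j)) - (\<Sum>j\<in>UNIV. Q i j) = - (\<delta> * (z \<bullet> (axis i 1, 0)))"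
      using crit[of "(axis i 1, 0)"] by (simp add: sum_subtractf)
    then show ?thesis using zu[of "(axis i 1, 0)"] by (simp add: norm_Pair)
  qed
  moreover have "\<bar>(\<Sum>i\<in>UNIV. A i j * exp (a i + b j)) - (\<Sum>i\<in>UNIV. Q i j)\<bar> \<le> \<epsilon>" for j
  proof -
    have "(\<Sum>i\<in>UNIV. \<Sum>k\<in>UNIV. (A i k * exp (a i + b k) - Q i k) * axis j 1 $ k)
        = (\<Sum>i\<in>UNIV. \<Sum>k\<in>UNIV. if k = j then (A i k * exp (a i + b k) - Q i k) else 0)"
      by (intro sum.cong) (auto simp: axis_def)
    then have "(\<Sum>i\<in>UNIV. A i j * exp (a i + b j)) - (\<Sum>i\<in>UNIV. Q i j) = - (\<delta> * (z \<bullet> (0, axis j 1)))"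
      using crit[of "(0, axis j 1)"] by (simp add: sum_subtractf)
    then show ?thesis using zu[of "(0, axis j 1)"] by (simp add: norm_Pair)
  qed
  ultimately show ?thesis by blast
qed

text \<open>
  The map \<open>\<kappa>\<close> shortens every gap between neighbours in \<open>Z\<close> that is longer than \<open>G\<close> to the length \<open>G\<close>.
  Differences that contain no long gap are preserved; the others stay at least \<open>G\<close>, and \<open>\<theta>\<close> is then
  the left end of a long gap.
\<close>

lemma gap_collapse:
  fixes Z :: "real set" and G :: real
  assumes "finite Z" and G: "G \<ge> 0"
  shows "\<exists>\<kappa> :: real \<Rightarrow> real. (\<forall>z\<in>Z. 0 \<le> \<kappa> z \<and> \<kappa> z \<le> card Z * G) \<and>
    (\<forall>z\<in>Z. \<forall>z'\<in>Z. z \<le> z' \<longrightarrow> 0 \<le> \<kappa> z' - \<kappa> z \<and> \<kappa> z' - \<kappa> z \<le> z' - z \<and>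
      (\<kappa> z' - \<kappa> z = z' - z \<or>
       (G \<le> \<kappa> z' - \<kappa> z \<and> (\<exists>\<theta>. z \<le> \<theta> \<and> \<theta> + G < z' \<and> (\<forall>u\<in>Z. u \<le> \<theta> \<or> \<theta> + G < u)))))"
  using assms(1)
proof (induction rule: finite_linorder_max_induct)
  case empty
  show ?case by simp
next
  case (insert x Z)
  obtain \<kappa> :: "real \<Rightarrow> real" where
    range: "\<And>z. z \<in> Z \<Longrightarrow> 0 \<le> \<kappa> z \<and> \<kappa> z \<le> card Z * G" and
    mono: "\<And>z z'. z \<in> Z \<Longrightarrow> z' \<in> Z \<Longrightarrow> z \<le> z' \<Longrightarrow> 0 \<le> \<kappa> z' - \<kappa> z \<and> \<kappa> z' - \<kappa> z \<le> z' - z" and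
    gap: "\<And>z z'. z \<in> Z \<Longrightarrow> z' \<in> Z \<Longrightarrow> z \<le> z' \<Longrightarrow> \<kappa> z' - \<kappa> z = z' - z \<or>
       (G \<le> \<kappa> z' - \<kappa> z \<and> (\<exists>\<theta>. z \<le> \<theta> \<and> \<theta> + G < z' \<and> (\<forall>u\<in>Z. u \<le> \<theta> \<or> \<theta> + G < u)))"
    using insert.IH by blast
  show ?case
  proof (cases "Z = {}")
    case True
    then show ?thesis using G by (intro exI[of _ "\<lambda>_. 0"]) auto
  next
    case False
    define y where "y = Max Z"
    have y: "y \<in> Z" "\<And>u. u \<in> Z \<Longrightarrow> u \<le> y" using False insert.hyps(1) by (auto simp: y_def)
    have yx: "y < x" using insert.hyps(2) y(1) by simp
    have xZ: "x \<notin> Z" using insert.hyps(2) by blast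
    define \<kappa>' where "\<kappa>' = \<kappa>(x := \<kappa> y + min G (x - y))"
    have old: "\<kappa>' z = \<kappa> z" if "z \<in> Z" for z using that xZ by (auto simp: \<kappa>'_def)
    have new: "\<kappa>' x = \<kappa> y + min G (x - y)" by (simp add: \<kappa>'_def)
    have card: "real (card (insert x Z)) * G = card Z * G + G"
      using insert.hyps(1) xZ by (simp add: algebra_simps)
    have "0 \<le> \<kappa>' z \<and> \<kappa>' z \<le> card (insert x Z) * G" if "z \<in> insert x Z" for z
    proof (cases "z = x")
      case True
      then show ?thesis using range[OF y(1)] new yx G card by (auto simp: min_def)
    next
      case False
      then show ?thesis using range[of z] old[of z] that card G by simp
    qed
    moreover have "0 \<le> \<kappa>' z' - \<kappa>' z \<and> \<kappa>' z' - \<kappa>' z \<le> z' - z \<and> (\<kappa>' z' - \<kappa>' z = z' - z \<or>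
       (G \<le> \<kappa>' z' - \<kappa>' z \<and> (\<exists>\<theta>. z \<le> \<theta> \<and> \<theta> + G < z' \<and> (\<forall>u\<in>insert x Z. u \<le> \<theta> \<or> \<theta> + G < u))))"
      if z: "z \<in> insert x Z" "z' \<in> insert x Z" and le: "z \<le> z'" for z z'
    proof -
      consider "z = x" "z' = x" | "z \<in> Z" "z' \<in> Z" | "z \<in> Z" "z' = x"
        using z le insert.hyps(2) by fastforce
      then show ?thesis
      proof cases
        case 1
        then show ?thesis by simp
      next
        case 2
        have "\<theta> + G < x" if "\<theta> + G < z'" for \<theta> using that insert.hyps(2) 2(2) by fastforce
        then show ?thesis using mono[OF 2 le] gap[OF 2 le] old[OF 2(1)] old[OF 2(2)] by auto
      next
        case 3
        have zy: "z \<le> y" using y(2) 3 by blast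
        note m = mono[OF 3(1) y(1) zy] and g = gap[OF 3(1) y(1) zy]
        have k: "\<kappa>' z' - \<kappa>' z = (\<kappa> y - \<kappa> z) + min G (x - y)" using old[OF 3(1)] new 3(2) by simp
        have "\<kappa>' z' - \<kappa>' z = z' - z \<or>
          (G \<le> \<kappa>' z' - \<kappa>' z \<and> (\<exists>\<theta>. z \<le> \<theta> \<and> \<theta> + G < z' \<and> (\<forall>u\<in>insert x Z. u \<le> \<theta> \<or> \<theta> + G < u)))"
        proof (cases "x - y \<le> G")
          case False
          have "z \<le> y \<and> y + G < z' \<and> (\<forall>u\<in>insert x Z. u \<le> y \<or> y + G < u)"
            using zy False 3(2) y(2) by auto
          moreover have "G \<le> \<kappa>' z' - \<kappa>' z" using k m False by auto
          ultimately show ?thesis by blast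
        next
          case True
          show ?thesis
          proof (cases "\<kappa> y - \<kappa> z = y - z")
            case True
            then show ?thesis using k \<open>x - y \<le> G\<close> 3(2) by simp
          next
            case False
            then obtain \<theta> where \<theta>: "G \<le> \<kappa> y - \<kappa> z" "z \<le> \<theta>" "\<theta> + G < y" "\<forall>u\<in>Z. u \<le> \<theta> \<or> \<theta> + G < u"
              using g by blast
            have "z \<le> \<theta> \<and> \<theta> + G < z' \<and> (\<forall>u\<in>insert x Z. u \<le> \<theta> \<or> \<theta> + G < u)"
              using \<theta> yx 3(2) by auto
            moreover have "G \<le> \<kappa>' z' - \<kappa>' z" using k \<theta>(1) G yx by auto
            ultimately show ?thesis by blast
          qed
        qed
        moreover have "0 \<le> \<kappa>' z' - \<kappa>' z \<and> \<kappa>' z' - \<kappa>' z \<le> z' - z" using k m 3(2) yx G by auto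
        ultimately show ?thesis by blast
      qed
    qed
    ultimately show ?thesis by (intro exI[of _ \<kappa>']) blast
  qed
qed

text \<open>
  Suppose that no value \<open>a\<^sub>i\<close> or \<open>-b\<^sub>j\<close> falls between \<open>\<theta>\<close> and \<open>\<theta> + G\<close>. Then \<open>Q\<close> carries no mass from
  the rows above the gap to the columns below it, since there \<open>W\<close> would exceed \<open>2\<close>. Hence the rows
  above have at most the mass of the columns above, with respect to \<open>Q\<close> and up to \<open>\<epsilon>\<close> also with
  respect to \<open>W\<close>. As \<open>W\<close> is tiny from rows below to columns above, balance forces it to be small
  from rows above to columns below as well.
\<close>

lemma weight_across_gap:
  fixes A Q :: "'m::finite \<Rightarrow> 'n::finite \<Rightarrow> real" and a :: "'m \<Rightarrow> real" and b :: "'n \<Rightarrow> real"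
    and c \<epsilon> G \<theta> :: real
  defines "W \<equiv> \<lambda>i j. A i j * exp (a i + b j)"
  assumes A: "\<And>i j. 0 \<le> A i j" "\<And>i j. A i j \<le> 1"
    and Q: "\<And>i j. 0 \<le> Q i j" "\<And>i. (\<Sum>j\<in>UNIV. Q i j) \<le> 1"
    and c: "\<And>i j. Q i j > 0 \<Longrightarrow> c \<le> A i j" and \<epsilon>: "\<epsilon> \<le> 1" and G: "0 \<le> G" "2 \<le> c * exp G"
    and X: "\<And>i. \<bar>(\<Sum>j\<in>UNIV. W i j) - (\<Sum>j\<in>UNIV. Q i j)\<bar> \<le> \<epsilon>"
    and Y: "\<And>j. \<bar>(\<Sum>i\<in>UNIV. W i j) - (\<Sum>i\<in>UNIV. Q i j)\<bar> \<le> \<epsilon>"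
    and gapX: "\<And>i. a i \<le> \<theta> \<or> \<theta> + G < a i" and gapY: "\<And>j. - b j \<le> \<theta> \<or> \<theta> + G < - b j"
    and ij: "\<theta> + G < a k" "- b l \<le> \<theta>"
  shows "W k l \<le> (CARD('m) + CARD('n)) * \<epsilon> + CARD('m) * CARD('n) * exp (- G)"
proof -
  define U where "U = {i. \<theta> + G < a i}"
  define J where "J = {j. \<theta> + G < - b j}"
  have W: "0 \<le> W i j" for i j using A by (simp add: W_def)
  have e: "\<epsilon> \<ge> 0" using X[of k] by linarith
  have WX: "W i j \<le> 2" for i j
  proof -
    have "W i j \<le> (\<Sum>j\<in>UNIV. W i j)" by (rule member_le_sum) (auto simp: W)
    then show ?thesis using X[of i] Q(2)[of i] \<epsilon> by linarith
  qed
  have Q0: "Q i j = 0" if "i \<in> U" "j \<notin> J" for i j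
  proof (rule ccontr)
    assume "Q i j \<noteq> 0"
    then have "Q i j > 0" using Q(1)[of i j] by simp
    then have cA: "c \<le> A i j" by (rule c)
    have s: "G < a i + b j" using that gapY[of j] by (auto simp: U_def J_def)
    have c0: "c > 0" using G(2) by (smt (verit) exp_gt_zero mult_nonpos_nonneg less_imp_le)
    have "c * exp G < c * exp (a i + b j)" using s c0 by simp
    also have "\<dots> \<le> W i j" unfolding W_def using cA by (intro mult_right_mono) auto
    finally show False using G(2) WX[of i j] by linarith
  qed
  have low: "W i j \<le> exp (- G)" if "i \<notin> U" "j \<in> J" for i j
  proof -
    have "a i + b j \<le> - G" using that gapX[of i] by (auto simp: U_def J_def)
    then have "A i j * exp (a i + b j) \<le> 1 * exp (- G)" using A by (intro mult_mono) auto
    then show ?thesis by (simp add: W_def)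
  qed
  have "(\<Sum>i\<in>U. \<Sum>j\<in>UNIV. W i j) \<le> (\<Sum>i\<in>U. (\<Sum>j\<in>UNIV. Q i j) + \<epsilon>)"
    using X by (intro sum_mono) (smt (verit))
  also have "\<dots> = (\<Sum>i\<in>U. \<Sum>j\<in>UNIV. Q i j) + card U * \<epsilon>" by (simp add: sum.distrib)
  also have "(\<Sum>i\<in>U. \<Sum>j\<in>UNIV. Q i j) = (\<Sum>i\<in>U. \<Sum>j\<in>J. Q i j)"
    by (intro sum.cong refl sum.mono_neutral_right) (auto simp: Q0)
  also have "\<dots> = (\<Sum>j\<in>J. \<Sum>i\<in>U. Q i j)" by (rule sum.swap)
  also have "\<dots> \<le> (\<Sum>j\<in>J. \<Sum>i\<in>UNIV. Q i j)" by (intro sum_mono sum_mono2) (auto simp: Q)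
  also have "\<dots> \<le> (\<Sum>j\<in>J. (\<Sum>i\<in>UNIV. W i j) + \<epsilon>)"
    using Y by (intro sum_mono) (smt (verit))
  also have "\<dots> = (\<Sum>j\<in>J. \<Sum>i\<in>UNIV. W i j) + card J * \<epsilon>" by (simp add: sum.distrib)
  also have "(\<Sum>j\<in>J. \<Sum>i\<in>UNIV. W i j) = (\<Sum>j\<in>J. (\<Sum>i\<in>U. W i j) + (\<Sum>i\<in>-U. W i j))"
    by (intro sum.cong refl) (metis Compl_eq_Diff_UNIV add.commute finite sum.subset_diff top_greatest)
  also have "\<dots> = (\<Sum>i\<in>U. \<Sum>j\<in>J. W i j) + (\<Sum>j\<in>J. \<Sum>i\<in>-U. W i j)"
    by (simp add: sum.distrib sum.swap[of _ J U])
  also have "(\<Sum>j\<in>J. \<Sum>i\<in>-U. W i j) \<le> (\<Sum>j\<in>J. \<Sum>i\<in>-U. exp (- G))"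
    by (intro sum_mono low) auto
  also have "\<dots> = real (card J * card (-U)) * exp (- G)" by simp
  also have "\<dots> \<le> CARD('m) * CARD('n) * exp (- G)"
    by (intro mult_right_mono of_nat_mono) (auto simp: mult.commute[of "CARD('m)"] intro!: mult_le_mono card_mono)
  finally have 1: "(\<Sum>i\<in>U. \<Sum>j\<in>UNIV. W i j) - (\<Sum>i\<in>U. \<Sum>j\<in>J. W i j)
      \<le> card U * \<epsilon> + card J * \<epsilon> + CARD('m) * CARD('n) * exp (- G)" by simp
  have kl: "k \<in> U" "l \<notin> J" using ij G gapY[of l] by (auto simp: U_def J_def)
  have "W k l \<le> (\<Sum>i\<in>U. \<Sum>j\<in>-J. W i j)"
  proof -
    have "W k l \<le> (\<Sum>j\<in>-J. W k j)" using kl by (intro member_le_sum) (auto simp: W)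
    also have "\<dots> \<le> (\<Sum>i\<in>U. \<Sum>j\<in>-J. W i j)"
      using kl by (intro member_le_sum[of k U "\<lambda>i. \<Sum>j\<in>-J. W i j"]) (auto simp: W intro: sum_nonneg)
    finally show ?thesis .
  qed
  also have "\<dots> = (\<Sum>i\<in>U. (\<Sum>j\<in>UNIV. W i j) - (\<Sum>j\<in>J. W i j))"
    by (intro sum.cong refl) (simp add: Compl_eq_Diff_UNIV sum_diff)
  also have "\<dots> \<le> card U * \<epsilon> + card J * \<epsilon> + CARD('m) * CARD('n) * exp (- G)"
    using 1 by (simp add: sum_subtractf)
  also have "\<dots> \<le> CARD('m) * \<epsilon> + CARD('n) * \<epsilon> + CARD('m) * CARD('n) * exp (- G)"
    using e by (intro add_mono mult_right_mono of_nat_mono card_mono) auto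
  finally show ?thesis by (simp add: algebra_simps)
qed

text \<open>
  Start from any approximate scaling and collapse the long gaps among the values \<open>a\<^sub>i\<close> and \<open>-b\<^sub>j\<close>. Only
  entries across a long gap change. Those with \<open>a\<^sub>i \<le> -b\<^sub>j\<close> are at most \<open>e\<^sup>-\<^sup>G\<close> before and after, and those
  with \<open>a\<^sub>i > -b\<^sub>j\<close> decrease from a value that is small by \<open>weight_across_gap\<close>. Afterwards all values lie
  in an interval of length \<open>O(G)\<close> with \<open>G = O(log(1/\<epsilon>))\<close>.
\<close>

lemma bounded_approximate_scaling:
  fixes c :: real
  assumes c: "0 < c" "c \<le> 1"
  shows "\<exists>K>0. \<forall>(A :: 'm::finite \<Rightarrow> 'n::finite \<Rightarrow> real) Q (\<epsilon> :: real).
    (\<forall>i j. 0 \<le> A i j \<and> A i j \<le> 1 \<and> 0 \<le> Q i j \<and> (Q i j > 0 \<longrightarrow> c \<le> A i j)) \<and>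
    (\<forall>i. (\<Sum>j\<in>UNIV. Q i j) \<le> 1) \<and> 0 < \<epsilon> \<and> \<epsilon> \<le> 1 \<longrightarrow>
    (\<exists>a b. (\<forall>i. \<bar>a i\<bar> \<le> K * (1 + ln (1 / \<epsilon>))) \<and> (\<forall>j. \<bar>b j\<bar> \<le> K * (1 + ln (1 / \<epsilon>))) \<and>
       (\<forall>i. \<bar>(\<Sum>j\<in>UNIV. A i j * exp (a i + b j)) - (\<Sum>j\<in>UNIV. Q i j)\<bar> \<le> \<epsilon>) \<and>
       (\<forall>j. \<bar>(\<Sum>i\<in>UNIV. A i j * exp (a i + b j)) - (\<Sum>i\<in>UNIV. Q i j)\<bar> \<le> \<epsilon>))"
proof -
  define N where "N = real (CARD('m) + CARD('n))"
  define D where "D = N + real (CARD('m) * CARD('n))"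
  define H where "H = 1 + N * D"
  define K where "K = N * (1 + ln (2 * H / c))"
  have "1 \<le> real CARD('m)"
    by (metis One_nat_def Suc_leI of_nat_1 of_nat_le_iff zero_less_card_finite)
  moreover have "0 \<le> real CARD('n)" "0 \<le> real CARD('m)" by simp_all
  moreover have "N = real CARD('m) + real CARD('n)" by (simp add: N_def)
  ultimately have N: "N \<ge> 1" "real CARD('m) \<le> N" "real CARD('n) \<le> N" by linarith+
  have D: "D \<ge> 1" using N(1) unfolding D_def by (smt (verit) of_nat_0_le_iff)
  have H: "H \<ge> 1" using N D by (simp add: H_def)
  have "2 * H / c \<ge> 1" using c H by (simp add: field_simps)
  then have lnH: "0 \<le> ln (2 * H / c)" by simp
  have K: "K > 0" unfolding K_def using N lnH by (intro mult_pos_pos) auto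
  have main: "\<exists>a b. (\<forall>i. \<bar>a i\<bar> \<le> K * (1 + ln (1 / \<epsilon>))) \<and> (\<forall>j. \<bar>b j\<bar> \<le> K * (1 + ln (1 / \<epsilon>))) \<and>
       (\<forall>i. \<bar>(\<Sum>j\<in>UNIV. A i j * exp (a i + b j)) - (\<Sum>j\<in>UNIV. Q i j)\<bar> \<le> \<epsilon>) \<and>
       (\<forall>j. \<bar>(\<Sum>i\<in>UNIV. A i j * exp (a i + b j)) - (\<Sum>i\<in>UNIV. Q i j)\<bar> \<le> \<epsilon>)"
    if A: "\<And>i j. 0 \<le> A i j" "\<And>i j. A i j \<le> 1"
      and Q: "\<And>i j. 0 \<le> Q i j" "\<And>i. (\<Sum>j\<in>UNIV. Q i j) \<le> 1"
      and cA: "\<And>i j. Q i j > 0 \<Longrightarrow> c \<le> A i j" and \<epsilon>: "0 < \<epsilon>" "\<epsilon> \<le> 1"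
    for A Q :: "'m \<Rightarrow> 'n \<Rightarrow> real" and \<epsilon>
  proof -
    define e where "e = \<epsilon> / H"
    \<comment> \<open>Chosen such that \<open>c * exp G = 2 / e \<ge> 2\<close> and \<open>exp (- G) \<le> e\<close>.\<close>
    define G where "G = ln (2 / (c * e))"
    have e: "0 < e" "e \<le> 1" "e \<le> \<epsilon>" unfolding e_def using \<epsilon> H by (auto simp: field_simps intro: order_trans)
    have eG: "exp G = 2 / (c * e)" using c e by (simp add: G_def)
    have "c * e \<le> 1" using c e by (simp add: mult_le_one)
    then have ce: "2 / (c * e) \<ge> 1" using c e by (simp add: field_simps)
    then have G: "G \<ge> 0" unfolding G_def by simp
    have "c * exp G = 2 / e" using eG c by simp
    moreover have "2 \<le> 2 / e" using e by (simp add: field_simps)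
    ultimately have G2: "2 \<le> c * exp G" by linarith
    have "exp (- G) = c * e / 2" using eG by (simp add: exp_minus)
    moreover have "c * e \<le> e" using c e by (simp add: mult_le_cancel_right1)
    ultimately have eG': "exp (- G) \<le> e" using e by linarith
    have G_bound: "N * G \<le> K * (1 + ln (1 / \<epsilon>))"
    proof -
      have "2 / (c * e) = (2 * H / c) * (1 / \<epsilon>)" using H \<epsilon> c by (simp add: e_def field_simps)
      moreover have "ln (2 * H / c * (1 / \<epsilon>)) = ln (2 * H / c) + ln (1 / \<epsilon>)"
        by (rule ln_mult_pos) (use H \<epsilon> c in auto)
      ultimately have "G = ln (2 * H / c) + ln (1 / \<epsilon>)" by (simp only: G_def)
      moreover have "0 \<le> ln (1 / \<epsilon>)" using \<epsilon> by simp
      ultimately have "G \<le> (1 + ln (2 * H / c)) * (1 + ln (1 / \<epsilon>))"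
        using lnH by (simp add: algebra_simps)
      then show ?thesis unfolding K_def using N by (simp add: mult.assoc)
    qed
    have Q1: "Q i j \<le> 1" for i j
    proof -
      have "Q i j \<le> (\<Sum>j\<in>UNIV. Q i j)" by (rule member_le_sum) (auto simp: Q)
      then show ?thesis using Q(2)[of i] by linarith
    qed
    obtain a b where X: "\<And>i. \<bar>(\<Sum>j\<in>UNIV. A i j * exp (a i + b j)) - (\<Sum>j\<in>UNIV. Q i j)\<bar> \<le> e"
      and Y: "\<And>j. \<bar>(\<Sum>i\<in>UNIV. A i j * exp (a i + b j)) - (\<Sum>i\<in>UNIV. Q i j)\<bar> \<le> e"
      using approximate_scaling_exists[of A Q c e] A Q Q1 c cA e by blast
    define Z where "Z = range a \<union> range (\<lambda>j. - b j)"
    have Z: "finite Z" "real (card Z) \<le> N"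
    proof -
      show "finite Z" by (simp add: Z_def)
      have "card Z \<le> card (range a) + card (range (\<lambda>j. - b j))" unfolding Z_def by (rule card_Un_le)
      also have "\<dots> \<le> CARD('m) + CARD('n)" by (intro add_mono card_image_le) auto
      finally show "real (card Z) \<le> N" unfolding N_def by simp
    qed
    obtain \<kappa> :: "real \<Rightarrow> real" where
      range: "\<And>z. z \<in> Z \<Longrightarrow> 0 \<le> \<kappa> z \<and> \<kappa> z \<le> card Z * G" and
      mono: "\<And>z z'. z \<in> Z \<Longrightarrow> z' \<in> Z \<Longrightarrow> z \<le> z' \<Longrightarrow> 0 \<le> \<kappa> z' - \<kappa> z \<and> \<kappa> z' - \<kappa> z \<le> z' - z" and
      gap: "\<And>z z'. z \<in> Z \<Longrightarrow> z' \<in> Z \<Longrightarrow> z \<le> z' \<Longrightarrow> \<kappa> z' - \<kappa> z = z' - z \<or>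
         (G \<le> \<kappa> z' - \<kappa> z \<and> (\<exists>\<theta>. z \<le> \<theta> \<and> \<theta> + G < z' \<and> (\<forall>u\<in>Z. u \<le> \<theta> \<or> \<theta> + G < u)))"
      using gap_collapse[OF Z(1) G] by blast
    have aZ: "a i \<in> Z" and bZ: "- b j \<in> Z" for i j by (auto simp: Z_def)
    define a' where "a' = (\<lambda>i. \<kappa> (a i))"
    define b' where "b' = (\<lambda>j. - \<kappa> (- b j))"
    have "card Z * G \<le> N * G" using Z G by (intro mult_right_mono) auto
    then have \<kappa>K: "\<bar>\<kappa> z\<bar> \<le> K * (1 + ln (1 / \<epsilon>))" if "z \<in> Z" for z using range[OF that] G_bound by linarith
    have diff: "\<bar>A i j * exp (a' i + b' j) - A i j * exp (a i + b j)\<bar> \<le> D * e" for i j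
    proof -
      have De: "N * e + CARD('m) * CARD('n) * exp (- G) \<le> D * e"
        using eG' by (simp add: D_def algebra_simps mult_left_mono)
      have smallD: "x \<le> D * e" if "x \<le> exp (- G)" for x
        using that eG' e D by (smt (verit) mult_le_cancel_right1)
      show ?thesis
      proof (cases "a i \<le> - b j")
        case True
        show ?thesis
        proof (cases "a' i + b' j = a i + b j")
          case False
          then have "G \<le> \<kappa> (- b j) - \<kappa> (a i)" using gap[OF aZ bZ True] unfolding a'_def b'_def by auto
          then have 1: "a' i + b' j \<le> - G" "a i + b j \<le> - G"
            using mono[OF aZ bZ True] by (auto simp: a'_def b'_def)
          have 2: "0 \<le> A i j * exp x \<and> A i j * exp x \<le> exp (- G)" if "x \<le> - G" for x
          proof -
            have "A i j * exp x \<le> 1 * exp (- G)" using A that by (intro mult_mono) auto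
            then show ?thesis using A by simp
          qed
          have "\<bar>A i j * exp (a' i + b' j) - A i j * exp (a i + b j)\<bar> \<le> exp (- G)"
            using 2[OF 1(1)] 2[OF 1(2)] by linarith
          then show ?thesis by (rule smallD)
        qed (use D e in simp)
      next
        case False
        then have le: "- b j \<le> a i" by simp
        show ?thesis
        proof (cases "a' i + b' j = a i + b j")
          case False
          then obtain \<theta> where \<theta>: "- b j \<le> \<theta>" "\<theta> + G < a i" "\<forall>u\<in>Z. u \<le> \<theta> \<or> \<theta> + G < u"
            using gap[OF bZ aZ le] unfolding a'_def b'_def by auto
          have W: "A i j * exp (a i + b j) \<le> (CARD('m) + CARD('n)) * e + CARD('m) * CARD('n) * exp (- G)"
            by (rule weight_across_gap[of A Q c e G a b \<theta>]) (use A Q cA e G G2 X Y \<theta> aZ bZ in auto)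
          have "a' i + b' j \<le> a i + b j" using mono[OF bZ aZ le] by (simp add: a'_def b'_def)
          then have "A i j * exp (a' i + b' j) \<le> A i j * exp (a i + b j)" using A by (intro mult_left_mono) auto
          moreover have "0 \<le> A i j * exp (a' i + b' j)" using A by simp
          ultimately show ?thesis using W De unfolding N_def by simp
        qed (use D e in simp)
      qed
    qed
    have "N * (D * e) + e = H * e" by (simp add: H_def algebra_simps)
    then have tot: "N * (D * e) + e = \<epsilon>" using H by (simp add: e_def)
    have "\<bar>(\<Sum>j\<in>UNIV. A i j * exp (a' i + b' j)) - (\<Sum>j\<in>UNIV. Q i j)\<bar> \<le> \<epsilon>" for i
    proof -
      have "\<bar>(\<Sum>j\<in>UNIV. A i j * exp (a' i + b' j)) - (\<Sum>j\<in>UNIV. A i j * exp (a i + b j))\<bar>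
          \<le> (\<Sum>j\<in>(UNIV::'n set). D * e)"
        unfolding sum_subtractf[symmetric] by (rule order_trans[OF sum_abs sum_mono]) (rule diff)
      also have "\<dots> \<le> N * (D * e)" using N D e by (simp add: mult_right_mono)
      finally show ?thesis using X[of i] tot by linarith
    qed
    moreover have "\<bar>(\<Sum>i\<in>UNIV. A i j * exp (a' i + b' j)) - (\<Sum>i\<in>UNIV. Q i j)\<bar> \<le> \<epsilon>" for j
    proof -
      have "\<bar>(\<Sum>i\<in>UNIV. A i j * exp (a' i + b' j)) - (\<Sum>i\<in>UNIV. A i j * exp (a i + b j))\<bar>
          \<le> (\<Sum>i\<in>(UNIV::'m set). D * e)"
        unfolding sum_subtractf[symmetric] by (rule order_trans[OF sum_abs sum_mono]) (rule diff)
      also have "\<dots> \<le> N * (D * e)" using N D e by (simp add: mult_right_mono)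
      finally show ?thesis using Y[of j] tot by linarith
    qed
    moreover have "\<bar>a' i\<bar> \<le> K * (1 + ln (1 / \<epsilon>))" "\<bar>b' j\<bar> \<le> K * (1 + ln (1 / \<epsilon>))" for i j
      using \<kappa>K[OF aZ[of i]] \<kappa>K[OF bZ[of j]] by (auto simp: a'_def b'_def)
    ultimately show ?thesis by blast
  qed
  show ?thesis
    by (rule exI[of _ K], intro conjI K allI impI, elim conjE, rule main) auto
qed


section \<open>The velocities as solutions of an entropy minimization\<close>

lemma gibbs_term:
  fixes x y :: real
  assumes "x > 0" "y \<ge> 0"
  shows "y - x \<le> y * ln (y / x)" and "y * ln (y / x) = y - x \<Longrightarrow> y = x"
proof -
  have "y - x \<le> y * ln (y / x) \<and> (y * ln (y / x) = y - x \<longrightarrow> y = x)"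
  proof (cases "y = 0")
    case False
    then have y: "y > 0" using assms by simp
    have eq: "y * ln (y / x) = - y * ln (x / y)" using assms y by (simp add: ln_div algebra_simps)
    have "y * ln (x / y) \<le> y * (x / y - 1)" using ln_le_minus_one[of "x / y"] assms y by simp
    moreover have "y * (x / y - 1) = x - y" using y by (simp add: field_simps)
    moreover have "y = x" if "y * ln (y / x) = y - x"
    proof -
      have "y * ln (x / y) = y * (x / y - 1)" using that eq \<open>y * (x / y - 1) = x - y\<close> by simp
      then have "ln (x / y) = x / y - 1" using y by simp
      then have "x / y = 1" using ln_eq_minus_one[of "x / y"] assms y by simp
      then show ?thesis using y by simp
    qed
    ultimately show ?thesis using eq by auto
  qed (use assms in auto)
  then show "y - x \<le> y * ln (y / x)" and "y * ln (y / x) = y - x \<Longrightarrow> y = x" by blast+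
qed

lemma entropy_chain: "y * ln (y / m) = y * ln (y / x) + y * ln (x / m)"
  if "x > 0" "m > 0" "y \<ge> 0" for x y m :: real
  using that by (cases "y = 0") (simp_all add: ln_div algebra_simps)

lemma entropy_tangent:
  fixes x y m :: real
  assumes "x > 0" "m > 0" "y \<ge> 0"
  shows "x * ln (x / m) + (1 + ln (x / m)) * (y - x) \<le> y * ln (y / m)"
  using gibbs_term(1)[OF assms(1,3)] entropy_chain[OF assms] by (simp add: algebra_simps)

text \<open>
  By the chain rule \<open>H(y|m) = H(y|x) + \<Sum>\<^sub>k y\<^sub>k log(x\<^sub>k/m\<^sub>k)\<close>, a point \<open>x\<close> for which \<open>K\<close> lies in the half-space
  of the last assumption is the unique minimizer on \<open>K\<close>: the masses agree, so \<open>H(y|x) \<ge> 0\<close> with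
  equality only for \<open>y = x\<close>.
\<close>

lemma arg_min_rel_entropy:
  fixes x m :: "real^'k"
  assumes K: "x \<in> K" and pos: "\<And>k. x $ k > 0" "\<And>k. m $ k > 0"
    and nonneg: "\<And>y k. y \<in> K \<Longrightarrow> 0 \<le> y $ k"
    and mass: "\<And>y. y \<in> K \<Longrightarrow> (\<Sum>k\<in>UNIV. y $ k) = (\<Sum>k\<in>UNIV. x $ k)"
    and halfspace: "\<And>y. y \<in> K \<Longrightarrow>
      (\<Sum>k\<in>UNIV. x $ k * ln (x $ k / m $ k)) \<le> (\<Sum>k\<in>UNIV. y $ k * ln (x $ k / m $ k))"
  shows "arg_min_on (\<lambda>y. rel_entropy y m) K = x"
proof -
  have chain: "rel_entropy y m = (\<Sum>k\<in>UNIV. y $ k * ln (y $ k / x $ k)) + (\<Sum>k\<in>UNIV. y $ k * ln (x $ k / m $ k))"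
    if "y \<in> K" for y
    unfolding rel_entropy_def sum.distrib[symmetric]
    by (intro sum.cong refl entropy_chain pos nonneg[OF that])
  have Hx: "rel_entropy x m = (\<Sum>k\<in>UNIV. x $ k * ln (x $ k / m $ k))" by (simp add: rel_entropy_def)
  have term0: "0 \<le> y $ k * ln (y $ k / x $ k) - (y $ k - x $ k)" if "y \<in> K" for y k
    using gibbs_term(1)[OF pos(1)[of k] nonneg[OF that, of k]] by simp
  have total: "(\<Sum>k\<in>UNIV. y $ k * ln (y $ k / x $ k) - (y $ k - x $ k)) = (\<Sum>k\<in>UNIV. y $ k * ln (y $ k / x $ k))"
    if "y \<in> K" for y
    using mass[OF that] by (simp add: sum_subtractf)
  have le: "rel_entropy x m \<le> rel_entropy y m" if "y \<in> K" for y
    using chain[OF that] Hx halfspace[OF that] total[OF that]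
      sum_nonneg[of UNIV "\<lambda>k. y $ k * ln (y $ k / x $ k) - (y $ k - x $ k)"] term0[OF that] by force
  show ?thesis
    unfolding arg_min_on_def arg_min_def
  proof (rule some_equality)
    show "is_arg_min (\<lambda>y. rel_entropy y m) (\<lambda>y. y \<in> K) x"
      using K le by (force simp: is_arg_min_def not_less)
  next
    fix y assume "is_arg_min (\<lambda>y. rel_entropy y m) (\<lambda>y. y \<in> K) y"
    then have y: "y \<in> K" "rel_entropy y m \<le> rel_entropy x m"
      using K by (auto simp: is_arg_min_def not_less)
    then have "(\<Sum>k\<in>UNIV. y $ k * ln (y $ k / x $ k) - (y $ k - x $ k)) \<le> 0"
      using chain[of y] Hx halfspace[of y] total[of y] by linarith
    then have "(\<Sum>k\<in>UNIV. y $ k * ln (y $ k / x $ k) - (y $ k - x $ k)) = 0"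
      using term0[OF y(1)] by (intro order_antisym sum_nonneg) auto
    then have "y $ k * ln (y $ k / x $ k) - (y $ k - x $ k) = 0" for k
      using term0[OF y(1)] by (subst (asm) sum_nonneg_eq_0_iff) auto
    then have "y $ k = x $ k" for k
      using gibbs_term(2)[OF pos(1)[of k] nonneg[OF y(1), of k]] by simp
    then show "y = x" by (simp add: vec_eq_iff)
  qed
qed

lemma X_marginal_eq: "Q \<in> distributions_on E \<Longrightarrow> X_marginal E Q $ i = (\<Sum>j\<in>UNIV. Q $ i $ j)"
  unfolding X_marginal_def distributions_on_def
  by (simp, intro sum.mono_neutral_left) auto

lemma Y_marginal_eq: "Q \<in> distributions_on E \<Longrightarrow> Y_marginal E Q $ j = (\<Sum>i\<in>UNIV. Q $ i $ j)"
  unfolding Y_marginal_def distributions_on_def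
  by (simp, intro sum.mono_neutral_left) auto

lemma distributions_on_iff:
  "Q \<in> distributions_on E \<longleftrightarrow> (\<forall>i j. 0 \<le> Q $ i $ j) \<and> (\<forall>i j. (i, j) \<notin> E \<longrightarrow> Q $ i $ j = 0) \<and>
     (\<Sum>i\<in>UNIV. \<Sum>j\<in>UNIV. Q $ i $ j) = 1"
proof -
  have "(\<Sum>(i, j)\<in>E. Q $ i $ j) = (\<Sum>i\<in>UNIV. \<Sum>j\<in>UNIV. Q $ i $ j)"
    if "\<forall>i j. (i, j) \<notin> E \<longrightarrow> Q $ i $ j = 0"
  proof -
    have "(\<Sum>(i, j)\<in>E. Q $ i $ j) = (\<Sum>(i, j)\<in>UNIV \<times> UNIV. Q $ i $ j)"
      by (rule sum.mono_neutral_left) (use that in auto)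
    then show ?thesis by (simp add: sum.cartesian_product)
  qed
  then show ?thesis unfolding distributions_on_def by auto
qed

lemma sum_against_marginals:
  fixes Q :: "real^'n^'m"
  shows "(\<Sum>i\<in>UNIV. \<Sum>j\<in>UNIV. Q $ i $ j * (\<alpha> i + \<beta> j)) =
    (\<Sum>i\<in>UNIV. (\<Sum>j\<in>UNIV. Q $ i $ j) * \<alpha> i) + (\<Sum>j\<in>UNIV. (\<Sum>i\<in>UNIV. Q $ i $ j) * \<beta> j)"
  by (simp add: distrib_left sum.distrib sum_distrib_right)
     (rule sum.swap)

text \<open>
  Optimality conditions for the problem that defines \<open>\<mu>\<^sup>*(E)\<close>: \<open>Q\<close> is an optimal coupling, \<open>\<mu>e\<^sup>-\<^sup>v\<close> its
  first marginal, and \<open>w\<close> is the multiplier of the constraint on the second marginal. They are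
  symmetric under exchange of the two factors when \<open>Q\<^sub>i\<^sub>j\<close> is replaced by \<open>Q\<^sub>i\<^sub>j e^(v\<^sub>i)\<close>, and so they describe
  \<open>\<nu>\<^sup>*(E)\<close> too.
\<close>

definition certificate ::
  "real^'m \<Rightarrow> real^'n \<Rightarrow> ('m \<times> 'n) set \<Rightarrow> real^'n^'m \<Rightarrow> real^'m \<Rightarrow> real^'n \<Rightarrow> bool" where
  "certificate \<mu> \<nu> E Q v w \<longleftrightarrow> Q \<in> distributions_on E \<and>
     (\<forall>i. (\<Sum>j\<in>UNIV. Q $ i $ j) = \<mu> $ i * exp (- v $ i)) \<and> (\<forall>j. (\<Sum>i\<in>UNIV. Q $ i $ j) = \<nu> $ j) \<and>
     (\<forall>i j. (i, j) \<in> E \<longrightarrow> v $ i + w $ j \<le> 0) \<and> (\<forall>i j. Q $ i $ j > 0 \<longrightarrow> v $ i + w $ j = 0)"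

lemma certificate_complementary:
  assumes "certificate \<mu> \<nu> E Q v w"
  shows "(\<Sum>i\<in>UNIV. \<Sum>j\<in>UNIV. Q $ i $ j * (v $ i + w $ j)) = 0"
proof -
  have "Q $ i $ j * (v $ i + w $ j) = 0" for i j
    using assms unfolding certificate_def distributions_on_iff by (cases "Q $ i $ j > 0") (auto simp: not_less intro: order_antisym)
  then show ?thesis by (simp only: sum.neutral_const)
qed

lemma certificate_nonpos:
  assumes "certificate \<mu> \<nu> E Q v w" "P \<in> distributions_on E"
  shows "P $ i $ j * (v $ i + w $ j) \<le> 0"
  using assms unfolding certificate_def distributions_on_iff
  by (cases "(i, j) \<in> E") (auto intro: mult_nonneg_nonpos)

lemma certificate_mu_star:
  fixes \<mu> :: "real^'m" and \<nu> :: "real^'n"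
  assumes cert: "certificate \<mu> \<nu> E Q v w" and \<mu>: "\<And>i. \<mu> $ i > 0"
  shows "mu_star \<mu> \<nu> E = (\<chi> i. \<mu> $ i * exp (- v $ i))"
proof -
  let ?x = "(\<chi> i. \<mu> $ i * exp (- v $ i)) :: real^'m"
  let ?K = "{\<mu>'. \<exists>Q\<in>distributions_on E. X_marginal E Q = \<mu>' \<and> Y_marginal E Q = \<nu>}"
  have Q: "Q \<in> distributions_on E" "X_marginal E Q = ?x" "Y_marginal E Q = \<nu>"
    using cert by (auto simp: certificate_def vec_eq_iff X_marginal_eq Y_marginal_eq)
  have ln: "ln (?x $ k / \<mu> $ k) = - v $ k" for k
    using \<mu>[of k] by simp
  have K: "(\<forall>k. 0 \<le> y $ k) \<and> (\<Sum>k\<in>UNIV. y $ k) = 1 \<and>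
      (\<Sum>j\<in>UNIV. \<nu> $ j * w $ j) \<le> (\<Sum>k\<in>UNIV. y $ k * ln (?x $ k / \<mu> $ k))" if "y \<in> ?K" for y
  proof -
    obtain P where P: "P \<in> distributions_on E" "y = X_marginal E P" "Y_marginal E P = \<nu>" using \<open>y \<in> ?K\<close> by auto
    have y: "y $ k = (\<Sum>j\<in>UNIV. P $ k $ j)" for k using P X_marginal_eq by auto
    have nu: "(\<Sum>i\<in>UNIV. P $ i $ j) = \<nu> $ j" for j using P Y_marginal_eq by metis
    have "(\<Sum>i\<in>UNIV. \<Sum>j\<in>UNIV. P $ i $ j * (v $ i + w $ j)) \<le> 0"
      by (intro sum_nonpos certificate_nonpos[OF cert P(1)])
    then have "(\<Sum>k\<in>UNIV. y $ k * v $ k) + (\<Sum>j\<in>UNIV. \<nu> $ j * w $ j) \<le> 0"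
      unfolding sum_against_marginals[of P "\<lambda>i. v $ i" "\<lambda>j. w $ j"] y nu .
    then show ?thesis using P(1) unfolding ln y distributions_on_iff by (auto simp: sum_nonneg sum_negf)
  qed
  have x: "(\<Sum>j\<in>UNIV. \<nu> $ j * w $ j) = (\<Sum>k\<in>UNIV. ?x $ k * ln (?x $ k / \<mu> $ k))"
    using certificate_complementary[OF cert] cert
    unfolding sum_against_marginals[of Q "\<lambda>i. v $ i" "\<lambda>j. w $ j"] ln certificate_def by (simp add: sum_negf)
  have xK: "?x \<in> ?K" using Q by (intro CollectI bexI[of _ Q] conjI)
  show ?thesis unfolding mu_star_def
  proof (rule arg_min_rel_entropy[OF xK])
    show "?x $ k > 0" for k using \<mu> by simp
    show "\<mu> $ k > 0" for k by (rule \<mu>)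
  next
    fix y assume y: "y \<in> ?K"
    show "0 \<le> y $ k" for k using K[OF y] by blast
    show "sum (($) y) UNIV = sum (($) ?x) UNIV" using K[OF y] K[OF xK] by simp
    show "(\<Sum>k\<in>UNIV. ?x $ k * ln (?x $ k / \<mu> $ k)) \<le> (\<Sum>k\<in>UNIV. y $ k * ln (?x $ k / \<mu> $ k))"
      using K[OF y] unfolding x by blast
  qed
qed

text \<open>
  The competitor that attains the minimum is \<open>P\<^sub>i\<^sub>j = Q\<^sub>i\<^sub>j e^(v\<^sub>i)\<close>. Since \<open>v\<^sub>i = -w\<^sub>j\<close> on the support of \<open>Q\<close>, it
  equals \<open>Q\<^sub>i\<^sub>j e^(-w\<^sub>j)\<close>, so its marginals are \<open>\<mu>\<close> and \<open>\<nu>e\<^sup>-\<^sup>w\<close>.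
\<close>

lemma certificate_nu_star:
  fixes \<mu> :: "real^'m" and \<nu> :: "real^'n"
  assumes cert: "certificate \<mu> \<nu> E Q v w" and \<mu>: "(\<Sum>i\<in>UNIV. \<mu> $ i) = 1" and \<nu>: "\<And>j. \<nu> $ j > 0"
  shows "nu_star \<mu> \<nu> E = (\<chi> j. \<nu> $ j * exp (- w $ j))"
proof -
  let ?x = "(\<chi> j. \<nu> $ j * exp (- w $ j)) :: real^'n"
  let ?K = "{\<nu>'. \<exists>P\<in>distributions_on E. X_marginal E P = \<mu> \<and> Y_marginal E P = \<nu>'}"
  define P :: "real^'n^'m" where "P = (\<chi> i j. Q $ i $ j * exp (v $ i))"
  have Pv: "P $ i $ j = Q $ i $ j * exp (v $ i)" for i j by (simp add: P_def)
  have Pw: "P $ i $ j = Q $ i $ j * exp (- w $ j)" for i j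
  proof (cases "Q $ i $ j > 0")
    case True
    then have "v $ i + w $ j = 0" using cert by (simp add: certificate_def)
    then have "v $ i = - w $ j" by linarith
    then show ?thesis by (simp add: Pv)
  next
    case False
    then have "Q $ i $ j = 0" using cert by (auto simp: certificate_def distributions_on_iff not_less intro: order_antisym)
    then show ?thesis by (simp add: Pv)
  qed
  have PX: "(\<Sum>j\<in>UNIV. P $ i $ j) = \<mu> $ i" for i
    using cert by (simp add: Pv sum_distrib_right[symmetric] certificate_def exp_minus)
  have PY: "(\<Sum>i\<in>UNIV. P $ i $ j) = \<nu> $ j * exp (- w $ j)" for j
    using cert unfolding Pw by (simp add: sum_distrib_right[symmetric] certificate_def)
  have P: "P \<in> distributions_on E"
    unfolding distributions_on_iff using cert PX \<mu> by (auto simp: Pv certificate_def distributions_on_iff)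
  have ln: "ln (?x $ k / \<nu> $ k) = - w $ k" for k
    using \<nu>[of k] by simp
  have K: "(\<forall>k. 0 \<le> y $ k) \<and> (\<Sum>k\<in>UNIV. y $ k) = 1 \<and>
      (\<Sum>i\<in>UNIV. \<mu> $ i * v $ i) \<le> (\<Sum>k\<in>UNIV. y $ k * ln (?x $ k / \<nu> $ k))" if "y \<in> ?K" for y
  proof -
    obtain R where R: "R \<in> distributions_on E" "X_marginal E R = \<mu>" "y = Y_marginal E R" using \<open>y \<in> ?K\<close> by auto
    have y: "y $ k = (\<Sum>i\<in>UNIV. R $ i $ k)" for k using R Y_marginal_eq by auto
    have mu: "(\<Sum>j\<in>UNIV. R $ i $ j) = \<mu> $ i" for i using R X_marginal_eq by metis
    have "(\<Sum>i\<in>UNIV. \<Sum>j\<in>UNIV. R $ i $ j * (v $ i + w $ j)) \<le> 0"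
      by (intro sum_nonpos certificate_nonpos[OF cert R(1)])
    then have "(\<Sum>i\<in>UNIV. \<mu> $ i * v $ i) + (\<Sum>j\<in>UNIV. y $ j * w $ j) \<le> 0"
      unfolding sum_against_marginals[of R "\<lambda>i. v $ i" "\<lambda>j. w $ j"] y mu .
    moreover have "(\<Sum>k\<in>UNIV. y $ k) = 1"
      unfolding y using R(1) by (subst sum.swap) (simp add: distributions_on_iff)
    ultimately show ?thesis using R(1) unfolding ln distributions_on_iff by (auto simp: y sum_nonneg sum_negf)
  qed
  have x: "(\<Sum>i\<in>UNIV. \<mu> $ i * v $ i) = (\<Sum>k\<in>UNIV. ?x $ k * ln (?x $ k / \<nu> $ k))"
  proof -
    have "P $ i $ j * (v $ i + w $ j) = 0" for i j
      using cert by (cases "Q $ i $ j > 0")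
        (auto simp: Pv certificate_def distributions_on_iff not_less intro: order_antisym)
    then have "(\<Sum>i\<in>UNIV. \<Sum>j\<in>UNIV. P $ i $ j * (v $ i + w $ j)) = 0" by (simp only: sum.neutral_const)
    then show ?thesis
      unfolding sum_against_marginals[of P "\<lambda>i. v $ i" "\<lambda>j. w $ j"] ln PX PY by (simp add: sum_negf)
  qed
  have "X_marginal E P = \<mu>" "Y_marginal E P = ?x"
    using PX PY by (simp_all add: vec_eq_iff X_marginal_eq[OF P] Y_marginal_eq[OF P])
  then have xK: "?x \<in> ?K" using P by (intro CollectI bexI[of _ P] conjI)
  show ?thesis unfolding nu_star_def
  proof (rule arg_min_rel_entropy[OF xK])
    show "?x $ k > 0" for k using \<nu> by simp
    show "\<nu> $ k > 0" for k by (rule \<nu>)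
  next
    fix y assume y: "y \<in> ?K"
    show "0 \<le> y $ k" for k using K[OF y] by blast
    show "sum (($) y) UNIV = sum (($) ?x) UNIV" using K[OF y] K[OF xK] by simp
    show "(\<Sum>k\<in>UNIV. ?x $ k * ln (?x $ k / \<nu> $ k)) \<le> (\<Sum>k\<in>UNIV. y $ k * ln (?x $ k / \<nu> $ k))"
      using K[OF y] unfolding x by blast
  qed
qed

lemma continuous_on_entropy:
  fixes m :: real
  assumes m: "m > 0"
  shows "continuous_on {0..} (\<lambda>x. x * ln (x / m))"
proof -
  have *: "continuous_on {0..} (\<lambda>u :: real. u * ln u)"
    unfolding continuous_on_def
  proof
    fix u :: real assume "u \<in> {0..}"
    then consider "u = 0" | "u > 0" by force
    then show "((\<lambda>u. u * ln u) \<longlongrightarrow> u * ln u) (at u within {0..})"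
    proof cases
      case 1
      have "((\<lambda>u :: real. u * ln u) \<longlongrightarrow> 0) (at_right 0)" by real_asymp
      then show ?thesis using 1 by (simp add: at_within_Ici_at_right)
    next
      case 2
      then show ?thesis by (intro tendsto_intros) auto
    qed
  qed
  have "continuous_on {0..} (\<lambda>x. m * ((x / m) * ln (x / m)))"
    by (intro continuous_on_mult continuous_on_const continuous_on_compose2[OF *])
      (use m in \<open>auto intro!: continuous_intros\<close>)
  then show ?thesis using m by simp
qed

lemma entropy_minimizer_exists:
  fixes \<mu> :: "real^'m" and \<nu> :: "real^'n"
  assumes \<mu>: "\<And>i. \<mu> $ i > 0" and \<nu>: "\<And>j. \<nu> $ j > 0" "(\<Sum>j\<in>UNIV. \<nu> $ j) = 1" and E: "no_isolated_vertex E"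
  obtains Q where "Q \<in> distributions_on E" "\<And>j. (\<Sum>i\<in>UNIV. Q $ i $ j) = \<nu> $ j"
    and "\<And>P. P \<in> distributions_on E \<Longrightarrow> (\<And>j. (\<Sum>i\<in>UNIV. P $ i $ j) = \<nu> $ j) \<Longrightarrow>
      (\<Sum>i\<in>UNIV. (\<Sum>j\<in>UNIV. Q $ i $ j) * ln ((\<Sum>j\<in>UNIV. Q $ i $ j) / \<mu> $ i))
      \<le> (\<Sum>i\<in>UNIV. (\<Sum>j\<in>UNIV. P $ i $ j) * ln ((\<Sum>j\<in>UNIV. P $ i $ j) / \<mu> $ i))"
proof -
  define K where "K = {Q :: real^'n^'m. (\<forall>i j. 0 \<le> Q $ i $ j) \<and> (\<forall>i j. (i, j) \<notin> E \<longrightarrow> Q $ i $ j = 0) \<and>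
      (\<forall>j. (\<Sum>i\<in>UNIV. Q $ i $ j) = \<nu> $ j)}"
  have tot: "(\<Sum>i\<in>UNIV. \<Sum>j\<in>UNIV. Q $ i $ j) = 1" if "\<And>j. (\<Sum>i\<in>UNIV. Q $ i $ j) = \<nu> $ j" for Q :: "real^'n^'m"
    using that \<nu>(2) by (subst sum.swap) simp
  have K_iff: "Q \<in> K \<longleftrightarrow> Q \<in> distributions_on E \<and> (\<forall>j. (\<Sum>i\<in>UNIV. Q $ i $ j) = \<nu> $ j)" for Q
    unfolding K_def distributions_on_iff using tot by auto
  have "closed K"
    unfolding K_def
    by (intro closed_Collect_conj closed_Collect_all closed_Collect_imp closed_Collect_le closed_Collect_eq
        continuous_intros open_Collect_const)
  moreover have "bounded K"
  proof (rule boundedI)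
    fix Q assume Q: "Q \<in> K"
    have "norm Q \<le> (\<Sum>i\<in>UNIV. norm (Q $ i))" unfolding norm_vec_def by (rule L2_set_le_sum) auto
    also have "\<dots> \<le> (\<Sum>i\<in>UNIV. \<Sum>j\<in>UNIV. \<bar>Q $ i $ j\<bar>)" by (intro sum_mono norm_le_l1_cart)
    also have "\<dots> = (\<Sum>i\<in>UNIV. \<Sum>j\<in>UNIV. Q $ i $ j)" using Q by (simp add: K_def)
    also have "\<dots> = 1" using Q tot by (simp add: K_def)
    finally show "norm Q \<le> 1" .
  qed
  ultimately have "compact K" by (simp add: compact_eq_bounded_closed)
  moreover have "K \<noteq> {}"
  proof -
    obtain s where s: "\<And>j. (s j, j) \<in> E" using E unfolding no_isolated_vertex_def by metis
    have "(\<chi> i j. if i = s j then \<nu> $ j else 0) \<in> K"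
      unfolding K_def using s \<nu>(1) by (auto simp: less_imp_le)
    then show ?thesis by blast
  qed
  moreover have "continuous_on K (\<lambda>Q. \<Sum>i\<in>UNIV. (\<Sum>j\<in>UNIV. Q $ i $ j) * ln ((\<Sum>j\<in>UNIV. Q $ i $ j) / \<mu> $ i))"
    by (intro continuous_on_sum continuous_on_compose2[OF continuous_on_entropy[OF \<mu>]])
      (auto intro!: continuous_intros sum_nonneg simp: K_def)
  ultimately obtain Q where Q: "Q \<in> K" "\<And>P. P \<in> K \<Longrightarrow>
      (\<Sum>i\<in>UNIV. (\<Sum>j\<in>UNIV. Q $ i $ j) * ln ((\<Sum>j\<in>UNIV. Q $ i $ j) / \<mu> $ i))
      \<le> (\<Sum>i\<in>UNIV. (\<Sum>j\<in>UNIV. P $ i $ j) * ln ((\<Sum>j\<in>UNIV. P $ i $ j) / \<mu> $ i))"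
    using continuous_attains_inf[of K] by meson
  show thesis by (rule that[of Q]) (use Q K_iff in auto)
qed

text \<open>
  First-order condition for moving a mass \<open>\<theta>\<close> within column \<open>j\<close> from row \<open>i\<close> to row \<open>k\<close>. The tangent
  inequality for \<open>x log(x/m)\<close> at the perturbed points avoids a derivative at a row whose mass may still
  be zero; that such rows do not occur is a consequence.
\<close>

lemma minimizer_ratio_le:
  fixes \<mu> :: "real^'m" and \<nu> :: "real^'n" and Q :: "real^'n^'m"
  assumes \<mu>: "\<And>i. \<mu> $ i > 0"
    and Q: "Q \<in> distributions_on E" "\<And>j. (\<Sum>i\<in>UNIV. Q $ i $ j) = \<nu> $ j"
    and min: "\<And>P. P \<in> distributions_on E \<Longrightarrow> (\<And>j. (\<Sum>i\<in>UNIV. P $ i $ j) = \<nu> $ j) \<Longrightarrow>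
      (\<Sum>i\<in>UNIV. (\<Sum>j\<in>UNIV. Q $ i $ j) * ln ((\<Sum>j\<in>UNIV. Q $ i $ j) / \<mu> $ i))
      \<le> (\<Sum>i\<in>UNIV. (\<Sum>j\<in>UNIV. P $ i $ j) * ln ((\<Sum>j\<in>UNIV. P $ i $ j) / \<mu> $ i))"
    and ij: "Q $ i $ j > 0" and kj: "(k, j) \<in> E"
  shows "(\<Sum>l\<in>UNIV. Q $ i $ l) / \<mu> $ i \<le> (\<Sum>l\<in>UNIV. Q $ k $ l) / \<mu> $ k"
proof (cases "k = i")
  case False
  define p where "p = (\<lambda>i. \<Sum>l\<in>UNIV. Q $ i $ l)"
  have Q0: "0 \<le> Q $ i $ j" for i j using Q(1) by (simp add: distributions_on_iff)
  have p0: "0 \<le> p i" for i by (simp add: p_def sum_nonneg Q0)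
  have pi: "Q $ i $ j \<le> p i" unfolding p_def by (rule member_le_sum) (auto simp: Q0)
  have step: "(p i - \<theta>) / \<mu> $ i \<le> (p k + \<theta>) / \<mu> $ k" if \<theta>: "0 < \<theta>" "\<theta> < Q $ i $ j" for \<theta>
  proof -
    define d where "d = (\<lambda>r. if r = k then \<theta> else if r = i then - \<theta> else 0)"
    define P :: "real^'n^'m" where "P = (\<chi> r l. Q $ r $ l + (if l = j then d r else 0))"
    have d0: "(\<Sum>r\<in>UNIV. d r) = 0"
    proof -
      have "(\<Sum>r\<in>UNIV. d r) = (\<Sum>r\<in>{i, k}. d r)" by (rule sum.mono_neutral_right) (auto simp: d_def)
      then show ?thesis using False by (simp add: d_def)
    qed
    have PX: "(\<Sum>l\<in>UNIV. P $ r $ l) = p r + d r" for r by (simp add: P_def p_def sum.distrib)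
    have PY: "(\<Sum>r\<in>UNIV. P $ r $ l) = \<nu> $ l" for l using Q(2) d0 by (cases "l = j") (simp_all add: P_def sum.distrib)
    have ijE: "(i, j) \<in> E" using Q(1) ij unfolding distributions_on_iff by (metis less_irrefl)
    have "P \<in> distributions_on E"
      unfolding distributions_on_iff
    proof (intro conjI allI impI)
      show "0 \<le> P $ r $ l" for r l using Q0[of r l] \<theta> by (auto simp: P_def d_def)
      show "P $ r $ l = 0" if "(r, l) \<notin> E" for r l
        using that kj ijE Q(1) by (auto simp: P_def d_def distributions_on_iff)
      show "(\<Sum>r\<in>UNIV. \<Sum>l\<in>UNIV. P $ r $ l) = 1"
        using Q(1) d0 unfolding PX by (simp add: sum.distrib p_def distributions_on_iff)
    qed
    from min[OF this PY] have "0 \<le> (\<Sum>r\<in>UNIV. (p r + d r) * ln ((p r + d r) / \<mu> $ r) - p r * ln (p r / \<mu> $ r))"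
      unfolding PX by (simp add: p_def sum_subtractf)
    also have "\<dots> = (\<Sum>r\<in>{i, k}. (p r + d r) * ln ((p r + d r) / \<mu> $ r) - p r * ln (p r / \<mu> $ r))"
      by (rule sum.mono_neutral_right) (auto simp: d_def)
    also have "\<dots> = ((p i - \<theta>) * ln ((p i - \<theta>) / \<mu> $ i) - p i * ln (p i / \<mu> $ i))
        + ((p k + \<theta>) * ln ((p k + \<theta>) / \<mu> $ k) - p k * ln (p k / \<mu> $ k))"
      using False by (simp add: d_def)
    finally have "0 \<le> ((p i - \<theta>) * ln ((p i - \<theta>) / \<mu> $ i) - p i * ln (p i / \<mu> $ i))
        + ((p k + \<theta>) * ln ((p k + \<theta>) / \<mu> $ k) - p k * ln (p k / \<mu> $ k))" .
    moreover have "(p i - \<theta>) * ln ((p i - \<theta>) / \<mu> $ i) + (1 + ln ((p i - \<theta>) / \<mu> $ i)) * (p i - (p i - \<theta>))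
        \<le> p i * ln (p i / \<mu> $ i)"
      by (rule entropy_tangent) (use \<theta> pi p0 \<mu> in auto)
    moreover have "(p k + \<theta>) * ln ((p k + \<theta>) / \<mu> $ k) + (1 + ln ((p k + \<theta>) / \<mu> $ k)) * (p k - (p k + \<theta>))
        \<le> p k * ln (p k / \<mu> $ k)"
      by (rule entropy_tangent) (use \<theta> p0[of k] p0 \<mu> in \<open>auto intro: add_nonneg_pos\<close>)
    ultimately have "\<theta> * ln ((p i - \<theta>) / \<mu> $ i) \<le> \<theta> * ln ((p k + \<theta>) / \<mu> $ k)"
      by (simp add: algebra_simps)
    then have "ln ((p i - \<theta>) / \<mu> $ i) \<le> ln ((p k + \<theta>) / \<mu> $ k)" using \<theta> by simp
    moreover have "(p i - \<theta>) / \<mu> $ i > 0" "(p k + \<theta>) / \<mu> $ k > 0"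
      using \<theta> pi \<mu>[of i] \<mu>[of k] p0[of k] by simp_all
    ultimately show ?thesis by simp
  qed
  have "((\<lambda>\<theta>. (p i - \<theta>) / \<mu> $ i) \<longlongrightarrow> (p i - 0) / \<mu> $ i) (at_right 0)"
       "((\<lambda>\<theta>. (p k + \<theta>) / \<mu> $ k) \<longlongrightarrow> (p k + 0) / \<mu> $ k) (at_right 0)"
    by (intro tendsto_divide tendsto_diff tendsto_add tendsto_const tendsto_ident_at;
        use \<mu>[of i] \<mu>[of k] in auto)+
  moreover have "\<forall>\<^sub>F \<theta> in at_right 0. (p i - \<theta>) / \<mu> $ i \<le> (p k + \<theta>) / \<mu> $ k"
    unfolding eventually_at_right_field using step ij by blast
  ultimately have "(p i - 0) / \<mu> $ i \<le> (p k + 0) / \<mu> $ k"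
    by (intro tendsto_le[of "at_right (0::real)"]) auto
  then show ?thesis by (simp add: p_def)
qed simp

text \<open>
  Take \<open>v = -log(p/\<mu>)\<close> for the first marginal \<open>p\<close> of a minimizer \<open>Q\<close>. In each column all rows that carry
  mass have the smallest ratio \<open>p\<^sub>i/\<mu>\<^sub>i\<close> among the neighbours of the column, and \<open>w\<^sub>j\<close> is the logarithm
  of that ratio.
\<close>

lemma certificate_exists:
  fixes \<mu> :: "real^'m" and \<nu> :: "real^'n"
  assumes \<mu>: "\<And>i. \<mu> $ i > 0" and \<nu>: "\<And>j. \<nu> $ j > 0" "(\<Sum>j\<in>UNIV. \<nu> $ j) = 1" and E: "no_isolated_vertex E"
  shows "\<exists>Q v w. certificate \<mu> \<nu> E Q v w"
proof -
  obtain Q where Q: "Q \<in> distributions_on E" "\<And>j. (\<Sum>i\<in>UNIV. Q $ i $ j) = \<nu> $ j"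
    and min: "\<And>P. P \<in> distributions_on E \<Longrightarrow> (\<And>j. (\<Sum>i\<in>UNIV. P $ i $ j) = \<nu> $ j) \<Longrightarrow>
      (\<Sum>i\<in>UNIV. (\<Sum>j\<in>UNIV. Q $ i $ j) * ln ((\<Sum>j\<in>UNIV. Q $ i $ j) / \<mu> $ i))
      \<le> (\<Sum>i\<in>UNIV. (\<Sum>j\<in>UNIV. P $ i $ j) * ln ((\<Sum>j\<in>UNIV. P $ i $ j) / \<mu> $ i))"
    by (rule entropy_minimizer_exists[OF \<mu> \<nu> E]) blast+
  define p where "p = (\<lambda>i. \<Sum>l\<in>UNIV. Q $ i $ l)"
  have ratio: "p i / \<mu> $ i \<le> p k / \<mu> $ k" if "Q $ i $ j > 0" "(k, j) \<in> E" for i j k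
    unfolding p_def by (rule minimizer_ratio_le[OF \<mu> Q min that])
  have Q0: "0 \<le> Q $ i $ j" for i j using Q(1) by (simp add: distributions_on_iff)
  have "\<exists>i. Q $ i $ j > 0" for j
  proof (rule ccontr)
    assume "\<nexists>i. Q $ i $ j > 0"
    then have "(\<Sum>i\<in>UNIV. Q $ i $ j) \<le> 0" by (intro sum_nonpos) (simp add: not_less)
    then show False using Q(2)[of j] \<nu>(1)[of j] by simp
  qed
  then obtain s where s: "\<And>j. Q $ s j $ j > 0" by metis
  have ppos: "p k > 0" for k
  proof -
    obtain j where j: "(k, j) \<in> E" using E unfolding no_isolated_vertex_def by blast
    have "Q $ s j $ j \<le> p (s j)" unfolding p_def by (rule member_le_sum) (auto simp: Q0)
    then have "0 < p (s j)" using s[of j] by linarith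
    then have "0 < p (s j) / \<mu> $ s j" using \<mu> by simp
    then have "0 < p k / \<mu> $ k" using ratio[OF s j] by linarith
    then show ?thesis using \<mu>[of k] by (simp add: zero_less_divide_iff not_less_iff_gr_or_eq)
  qed
  define v :: "real^'m" where "v = (\<chi> i. - ln (p i / \<mu> $ i))"
  define w :: "real^'n" where "w = (\<chi> j. ln (p (s j) / \<mu> $ s j))"
  have lnle: "ln (p i / \<mu> $ i) \<le> ln (p k / \<mu> $ k)" if "Q $ i $ j > 0" "(k, j) \<in> E" for i j k
    using ratio[OF that] ppos \<mu> by simp
  have QE: "(i, j) \<in> E" if "Q $ i $ j > 0" for i j using Q(1) that by (force simp: distributions_on_iff)
  have "certificate \<mu> \<nu> E Q v w"
    unfolding certificate_def
  proof (intro conjI allI impI Q)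
    show "(\<Sum>j\<in>UNIV. Q $ i $ j) = \<mu> $ i * exp (- v $ i)" for i
      using ppos[of i] \<mu>[of i] by (simp add: v_def p_def)
    show "v $ i + w $ j \<le> 0" if "(i, j) \<in> E" for i j
      using lnle[OF s that] by (simp add: v_def w_def)
    show "v $ i + w $ j = 0" if "Q $ i $ j > 0" for i j
      using lnle[OF s QE[OF that]] lnle[OF that QE[OF s]] by (simp add: v_def w_def)
  qed
  then show ?thesis by blast
qed

lemma star_certificate:
  fixes \<mu> :: "real^'m" and \<nu> :: "real^'n"
  assumes \<mu>: "\<And>i. \<mu> $ i > 0" "(\<Sum>i\<in>UNIV. \<mu> $ i) = 1" and \<nu>: "\<And>j. \<nu> $ j > 0" "(\<Sum>j\<in>UNIV. \<nu> $ j) = 1"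
    and E: "no_isolated_vertex E"
  shows "\<exists>Q. certificate \<mu> \<nu> E Q (v_star \<mu> \<nu> E) (w_star \<mu> \<nu> E)"
proof -
  obtain Q v w where c: "certificate \<mu> \<nu> E Q v w" using certificate_exists[OF \<mu>(1) \<nu> E] by blast
  have ln: "ln (x / (x * exp (- y))) = y" if "x > 0" for x y :: real
    using that by (simp add: ln_div ln_mult)
  have "v_star \<mu> \<nu> E = v"
    by (simp only: v_star_def certificate_mu_star[OF c \<mu>(1)] vec_eq_iff ln[OF \<mu>(1)] vec_lambda_beta simp_thms)
  moreover have "w_star \<mu> \<nu> E = w"
    by (simp only: w_star_def certificate_nu_star[OF c \<mu>(2) \<nu>(1)] vec_eq_iff ln[OF \<nu>(1)] vec_lambda_beta simp_thms)
  ultimately show ?thesis using c by blast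
qed

text \<open>
  Weak duality: testing the second certificate with \<open>Q\<close> gives the inequality. In the case of equality
  both certificates have the same \<open>v\<close> and \<open>w\<close>, which the pair \<open>(i0, j0)\<close> excludes.
\<close>

lemma certificate_value_decreases:
  fixes \<mu> :: "real^'m" and \<nu> :: "real^'n"
  assumes \<mu>: "\<And>i. \<mu> $ i > 0" and \<nu>: "\<And>j. \<nu> $ j > 0"
    and c: "certificate \<mu> \<nu> E Q v w" and c': "certificate \<mu> \<nu> E' Q' v' w'"
    and Q: "Q \<in> distributions_on E'" and new: "(i0, j0) \<in> E'" "v $ i0 + w $ j0 > 0"
  shows "(\<Sum>j\<in>UNIV. \<nu> $ j * w' $ j) < (\<Sum>j\<in>UNIV. \<nu> $ j * w $ j)"
proof (rule ccontr)
  define p where "p = (\<lambda>i. \<Sum>j\<in>UNIV. Q $ i $ j)"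
  assume "\<not> ?thesis"
  then have ge: "(\<Sum>j\<in>UNIV. \<nu> $ j * w $ j) \<le> (\<Sum>j\<in>UNIV. \<nu> $ j * w' $ j)" by simp
  have QY: "(\<Sum>i\<in>UNIV. Q $ i $ j) = \<nu> $ j" for j using c by (simp add: certificate_def)
  have p: "p i = \<mu> $ i * exp (- v $ i)" for i using c by (simp add: certificate_def p_def)
  have e1: "(\<Sum>i\<in>UNIV. p i * v $ i) + (\<Sum>j\<in>UNIV. \<nu> $ j * w $ j) = 0"
    using certificate_complementary[OF c]
    unfolding sum_against_marginals[of Q "\<lambda>i. v $ i" "\<lambda>j. w $ j"] QY p_def .
  have e2: "(\<Sum>i\<in>UNIV. \<Sum>j\<in>UNIV. Q $ i $ j * (v' $ i + w' $ j)) = (\<Sum>i\<in>UNIV. p i * v' $ i) + (\<Sum>j\<in>UNIV. \<nu> $ j * w' $ j)"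
    unfolding sum_against_marginals[of Q "\<lambda>i. v' $ i" "\<lambda>j. w' $ j"] QY p_def ..
  have np: "Q $ i $ j * (v' $ i + w' $ j) \<le> 0" for i j by (rule certificate_nonpos[OF c' Q])
  define q where "q = (\<lambda>i. \<mu> $ i * exp (- v' $ i))"
  have sums: "(\<Sum>i\<in>UNIV. p i) = 1" "(\<Sum>i\<in>UNIV. q i) = 1"
    using c c' by (auto simp: certificate_def distributions_on_iff p_def q_def)
  have qpos: "q i > 0" and ppos: "p i > 0" for i using \<mu> by (auto simp: q_def p)
  have ln: "ln (p i / q i) = v' $ i - v $ i" for i
    using \<mu>[of i] by (simp add: p q_def exp_diff[symmetric] ln_div ln_mult)
  have t: "0 \<le> p i * (v' $ i - v $ i) - (p i - q i)" for i
    using gibbs_term(1)[OF qpos[of i] less_imp_le[OF ppos[of i]]] unfolding ln by simp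
  have "0 \<le> (\<Sum>i\<in>UNIV. p i * (v' $ i - v $ i) - (p i - q i))" by (rule sum_nonneg) (rule t)
  also have *: "\<dots> = (\<Sum>i\<in>UNIV. p i * v' $ i) - (\<Sum>i\<in>UNIV. p i * v $ i)"
    using sums by (simp add: sum_subtractf right_diff_distrib)
  finally have pv: "0 \<le> (\<Sum>i\<in>UNIV. p i * v' $ i) - (\<Sum>i\<in>UNIV. p i * v $ i)" .
  have np': "(\<Sum>i\<in>UNIV. \<Sum>j\<in>UNIV. Q $ i $ j * (v' $ i + w' $ j)) \<le> 0" by (intro sum_nonpos np)
  have z1: "(\<Sum>i\<in>UNIV. p i * (v' $ i - v $ i) - (p i - q i)) = 0"
    unfolding * using pv np' e1 e2 ge by linarith
  have z2: "(\<Sum>i\<in>UNIV. \<Sum>j\<in>UNIV. - (Q $ i $ j * (v' $ i + w' $ j))) = 0"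
    using pv np' e1 e2 ge by (simp add: sum_negf)
  have "p i * (v' $ i - v $ i) - (p i - q i) = 0" for i
    using z1 t by (subst (asm) sum_nonneg_eq_0_iff) auto
  then have pq: "p i = q i" for i
    using gibbs_term(2)[OF qpos[of i] less_imp_le[OF ppos[of i]]] unfolding ln by simp
  have vv: "v' $ i = v $ i" for i using pq[of i] \<mu>[of i] by (simp add: p q_def)
  have "(\<Sum>j\<in>UNIV. - (Q $ i $ j * (v' $ i + w' $ j))) = 0" for i
    using z2 np by (subst (asm) sum_nonneg_eq_0_iff) (auto intro!: sum_nonneg)
  then have Qz: "Q $ i $ j * (v' $ i + w' $ j) = 0" for i j
    using np by (subst (asm) sum_nonneg_eq_0_iff) auto
  have "w' $ j = w $ j" for j
  proof -
    have "\<exists>i. Q $ i $ j > 0"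
    proof (rule ccontr)
      assume "\<nexists>i. Q $ i $ j > 0"
      then have "(\<Sum>i\<in>UNIV. Q $ i $ j) \<le> 0" by (intro sum_nonpos) (simp add: not_less)
      then show False using QY[of j] \<nu>[of j] by simp
    qed
    then obtain i where i: "Q $ i $ j > 0" by blast
    then have "v $ i + w $ j = 0" using c by (simp add: certificate_def)
    moreover have "v' $ i + w' $ j = 0" using Qz[of i j] i by simp
    ultimately show ?thesis using vv[of i] by simp
  qed
  then have "v $ i0 + w $ j0 \<le> 0" using c' new(1) vv by (auto simp: certificate_def)
  then show False using new(2) by simp
qed


section \<open>Tracking a single phase\<close>

lemma f_soft_approx:
  fixes \<nu> :: "real^'n" and C :: "real^'n^'m"
  assumes \<tau>: "\<tau> > 0" and \<nu>: "\<And>j. \<nu> $ j > 0" and \<eta>: "0 \<le> \<eta>" "\<eta> \<le> 1 / 2"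
    and near: "\<bar>(\<Sum>j\<in>UNIV. exp ((x + \<gamma> $ j - C $ i $ j) / \<tau>) * \<nu> $ j) * exp y - 1\<bar> \<le> \<eta>"
  shows "\<bar>f_soft \<tau> \<nu> C \<gamma> $ i - (x + \<tau> * y)\<bar> \<le> 2 * \<tau> * \<eta>"
proof -
  define s where "s = (\<Sum>j\<in>UNIV. exp ((x + \<gamma> $ j - C $ i $ j) / \<tau>) * \<nu> $ j) * exp y"
  have s: "1 - \<eta> \<le> s" "s \<le> 1 + \<eta>" using near unfolding s_def by linarith+
  then have s0: "s > 0" using \<eta> by linarith
  have S: "(\<Sum>j\<in>UNIV. exp ((x + \<gamma> $ j - C $ i $ j) / \<tau>) * \<nu> $ j) = s * exp (- y)"
    by (simp add: s_def exp_minus)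
  have eq: "f_soft \<tau> \<nu> C \<gamma> $ i - (x + \<tau> * y) = - \<tau> * ln s"
    unfolding f_soft_residual[OF \<tau> \<nu>, of C \<gamma> i x] S using s0 by (simp add: ln_mult algebra_simps)
  have "ln s \<le> s - 1" using s0 by (rule ln_le_minus_one)
  then have up: "ln s \<le> 2 * \<eta>" using s \<eta> by linarith
  have "- \<eta> - 2 * \<eta>\<^sup>2 \<le> ln (1 - \<eta>)" using \<eta> by (intro ln_one_minus_pos_lower_bound) auto
  moreover have "2 * \<eta>\<^sup>2 \<le> \<eta>" using \<eta> mult_left_mono[of \<eta> "1/2" \<eta>] by (simp add: power2_eq_square)
  moreover have "ln (1 - \<eta>) \<le> ln s" using s \<eta> s0 by simp
  ultimately have lo: "- (2 * \<eta>) \<le> ln s" by linarith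
  have "\<bar>ln s\<bar> \<le> 2 * \<eta>" using up lo by linarith
  then have "\<tau> * \<bar>ln s\<bar> \<le> \<tau> * (2 * \<eta>)" using \<tau> by (intro mult_left_mono) auto
  then show ?thesis using \<tau> by (simp add: eq abs_mult)
qed

lemma relative_error:
  fixes y s \<eta> :: real
  assumes "y > 0" "\<bar>y * s - y\<bar> \<le> \<eta> * y"
  shows "\<bar>s - 1\<bar> \<le> \<eta>"
proof -
  have "y * s - y = y * (s - 1)" by (simp add: right_diff_distrib)
  then have "y * \<bar>s - 1\<bar> \<le> y * \<eta>" using assms by (simp add: abs_mult mult.commute)
  then show ?thesis using assms(1) by simp
qed

text \<open>
  The marginal error of the matrix \<open>W\<close> is exactly the residual of the soft transforms at \<open>\<phi>\<close>, \<open>\<gamma>\<close>: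
  the first half step keeps \<open>\<gamma>\<close>, the second one moves \<open>\<phi>\<close> by \<open>\<tau>v\<close>.
\<close>

lemma ansatz_step:
  fixes \<mu> :: "real^'m" and \<nu> :: "real^'n" and C :: "real^'n^'m" and \<phi> v :: "real^'m" and \<gamma> :: "real^'n" and \<tau> \<eta> :: real
  defines "W \<equiv> \<lambda>i j. \<mu> $ i * \<nu> $ j * exp ((\<phi> $ i + \<gamma> $ j - C $ i $ j) / \<tau>)"
  assumes \<tau>: "\<tau> > 0" and \<mu>: "\<And>i. \<mu> $ i > 0" and \<nu>: "\<And>j. \<nu> $ j > 0" and \<eta>: "0 \<le> \<eta>" "\<eta> \<le> 1 / 2"
    and Y: "\<And>j. \<bar>(\<Sum>i\<in>UNIV. W i j) - \<nu> $ j\<bar> \<le> \<eta> * \<nu> $ j"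
    and X: "\<And>i. \<bar>(\<Sum>j\<in>UNIV. W i j) - \<mu> $ i * exp (- v $ i)\<bar> \<le> \<eta> * (\<mu> $ i * exp (- v $ i))"
  shows "infnorm (sinkhorn_step \<tau> \<mu> \<nu> C \<phi> - (\<phi> + \<tau> *\<^sub>R v)) \<le> 4 * \<tau> * \<eta>"
proof -
  have "\<bar>(g_soft \<tau> \<mu> C \<phi> - \<gamma>) $ j\<bar> \<le> 2 * \<tau> * \<eta>" for j
  proof -
    have W: "(\<Sum>i\<in>UNIV. W i j) = \<nu> $ j * (\<Sum>i\<in>UNIV. exp ((\<gamma> $ j + \<phi> $ i - transpose C $ j $ i) / \<tau>) * \<mu> $ i)"
      unfolding W_def sum_distrib_left by (intro sum.cong refl) (simp add: transpose_def algebra_simps)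
    have "\<bar>(\<Sum>i\<in>UNIV. exp ((\<gamma> $ j + \<phi> $ i - transpose C $ j $ i) / \<tau>) * \<mu> $ i) * exp 0 - 1\<bar> \<le> \<eta>"
      using relative_error[OF \<nu>[of j] Y[of j, unfolded W]] by simp
    from f_soft_approx[OF \<tau> \<mu> \<eta> this] show ?thesis by (simp add: g_soft_eq_f_soft)
  qed
  then have g: "infnorm (g_soft \<tau> \<mu> C \<phi> - \<gamma>) \<le> 2 * \<tau> * \<eta>" unfolding infnorm_le_iff by blast
  have "\<bar>(f_soft \<tau> \<nu> C \<gamma> - (\<phi> + \<tau> *\<^sub>R v)) $ i\<bar> \<le> 2 * \<tau> * \<eta>" for i
  proof -
    define p where "p = \<mu> $ i * exp (- v $ i)"
    have p: "p > 0" using \<mu> by (simp add: p_def)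
    have W: "(\<Sum>j\<in>UNIV. W i j) = p * ((\<Sum>j\<in>UNIV. exp ((\<phi> $ i + \<gamma> $ j - C $ i $ j) / \<tau>) * \<nu> $ j) * exp (v $ i))"
    proof -
      have "(\<Sum>j\<in>UNIV. W i j) = \<mu> $ i * (\<Sum>j\<in>UNIV. exp ((\<phi> $ i + \<gamma> $ j - C $ i $ j) / \<tau>) * \<nu> $ j)"
        unfolding W_def sum_distrib_left by (intro sum.cong refl) (simp add: algebra_simps)
      then show ?thesis by (simp add: p_def exp_minus)
    qed
    have "\<bar>(\<Sum>j\<in>UNIV. exp ((\<phi> $ i + \<gamma> $ j - C $ i $ j) / \<tau>) * \<nu> $ j) * exp (v $ i) - 1\<bar> \<le> \<eta>"
      using relative_error[OF p X[of i, folded p_def, unfolded W]] .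
    from f_soft_approx[OF \<tau> \<nu> \<eta> this] show ?thesis by simp
  qed
  then have f: "infnorm (f_soft \<tau> \<nu> C \<gamma> - (\<phi> + \<tau> *\<^sub>R v)) \<le> 2 * \<tau> * \<eta>" unfolding infnorm_le_iff by blast
  have "infnorm (sinkhorn_step \<tau> \<mu> \<nu> C \<phi> - f_soft \<tau> \<nu> C \<gamma>) \<le> 2 * \<tau> * \<eta>"
    unfolding sinkhorn_step_def using f_soft_nonexpansive[OF \<tau> \<nu>] g by (rule order_trans)
  then show ?thesis
    using f infnorm_dist_triangle[of "sinkhorn_step \<tau> \<mu> \<nu> C \<phi>" "\<phi> + \<tau> *\<^sub>R v" "f_soft \<tau> \<nu> C \<gamma>"] by linarith
qed

lemma sinkhorn_step_near_contact:
  fixes \<mu> :: "real^'m" and \<nu> :: "real^'n" and C :: "real^'n^'m"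
  assumes \<tau>: "\<tau> > 0" and c: "c > 0" "\<And>i. c \<le> \<mu> $ i" "\<And>j. c \<le> \<nu> $ j"
    and sums: "(\<Sum>i\<in>UNIV. \<mu> $ i) = 1" "(\<Sum>j\<in>UNIV. \<nu> $ j) = 1"
    and feas: "\<And>i j. f $ i + g $ j \<le> C $ i $ j"
    and contact: "\<And>i. \<exists>j. f $ i + g $ j = C $ i $ j" "\<And>j. \<exists>i. f $ i + g $ j = C $ i $ j"
  shows "infnorm (g_soft \<tau> \<mu> C f - g) \<le> \<tau> * ln (1 / c)"
    and "infnorm (sinkhorn_step \<tau> \<mu> \<nu> C f - f) \<le> \<tau> * (2 * ln (1 / c))"
proof -
  have \<nu>: "\<nu> $ j > 0" for j using c(1) c(3)[of j] by linarith
  have "infnorm (f_soft \<tau> \<mu> (transpose C) f - g) \<le> \<tau> * ln (1 / c)"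
    by (rule f_soft_near_contact[OF \<tau> c(1,2) sums(1)])
      (use feas contact(2) in \<open>auto simp: transpose_def add.commute\<close>)
  then show g: "infnorm (g_soft \<tau> \<mu> C f - g) \<le> \<tau> * ln (1 / c)" by (simp add: g_soft_eq_f_soft)
  have "infnorm (f_soft \<tau> \<nu> C g - f) \<le> \<tau> * ln (1 / c)"
    by (rule f_soft_near_contact[OF \<tau> c(1,3) sums(2) feas contact(1)])
  moreover have "infnorm (sinkhorn_step \<tau> \<mu> \<nu> C f - f_soft \<tau> \<nu> C g) \<le> \<tau> * ln (1 / c)"
    unfolding sinkhorn_step_def using f_soft_nonexpansive[OF \<tau> \<nu>] g by (rule order_trans)
  ultimately show "infnorm (sinkhorn_step \<tau> \<mu> \<nu> C f - f) \<le> \<tau> * (2 * ln (1 / c))"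
    using infnorm_dist_triangle[of "sinkhorn_step \<tau> \<mu> \<nu> C f" f "f_soft \<tau> \<nu> C g"] by (simp add: algebra_simps)
qed

text \<open>
  The step \<open>r\<close> is at distance \<open>h\<close> from both ends of the phase. Pairs with \<open>v\<^sub>i + w\<^sub>j < 0\<close> have been damped
  since the beginning, and pairs with \<open>v\<^sub>i + w\<^sub>j > 0\<close> are still damped because they have nonnegative
  slack at time \<open>D\<close>. Only the neutral pairs remain.
\<close>

lemma ansatz_weight_error:
  fixes \<mu> :: "real^'m" and \<nu> :: "real^'n" and C :: "real^'n^'m"
  assumes \<tau>: "\<tau> > 0" and \<mu>: "\<And>i. 0 < \<mu> $ i" "\<And>i. \<mu> $ i \<le> 1" and \<nu>: "\<And>j. 0 < \<nu> $ j" "\<And>j. \<nu> $ j \<le> 1"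
    and c1: "\<And>i j. v $ i + w $ j \<noteq> 0 \<Longrightarrow> c1 \<le> \<bar>v $ i + w $ j\<bar>" "c1 > 0"
    and feas: "\<And>i j. f $ i + g $ j \<le> C $ i $ j" "\<And>i j. f $ i + g $ j + D * (v $ i + w $ j) \<le> C $ i $ j"
    and ab: "\<And>i. \<bar>a $ i\<bar> \<le> \<Lambda>" "\<And>j. \<bar>b $ j\<bar> \<le> \<Lambda>"
    and h: "2 * \<Lambda> + ln (1 / \<epsilon>) \<le> c1 * h" "0 \<le> h" and \<epsilon>: "\<epsilon> > 0" and r: "h \<le> r" "h \<le> D / \<tau> - r"
  shows "\<bar>\<mu> $ i * \<nu> $ j * exp (((f + (r * \<tau>) *\<^sub>R v + \<tau> *\<^sub>R a) $ i + (g + (r * \<tau>) *\<^sub>R w + \<tau> *\<^sub>R b) $ j - C $ i $ j) / \<tau>)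
      - (if v $ i + w $ j = 0 then \<mu> $ i * \<nu> $ j * exp ((f $ i + g $ j - C $ i $ j) / \<tau>) else 0) * exp (a $ i + b $ j)\<bar> \<le> \<epsilon>"
proof -
  let ?s = "v $ i + w $ j" and ?d = "(f $ i + g $ j - C $ i $ j) / \<tau>"
  have exponent: "((f + (r * \<tau>) *\<^sub>R v + \<tau> *\<^sub>R a) $ i + (g + (r * \<tau>) *\<^sub>R w + \<tau> *\<^sub>R b) $ j - C $ i $ j) / \<tau>
      = ?d + r * ?s + (a $ i + b $ j)"
    using \<tau> by (simp add: field_simps)
  show ?thesis
  proof (cases "?s = 0")
    case True
    then show ?thesis using \<epsilon> unfolding exponent by (simp add: exp_add)
  next
    case False
    have "?d + r * ?s \<le> - (c1 * h)"
    proof (cases "?s > 0")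
      case True
      then have s: "c1 \<le> ?s" using c1(1)[OF False] by simp
      have "f $ i + g $ j - C $ i $ j \<le> - (D * ?s)" using feas(2)[of i j] by simp
      then have "?d \<le> - (D * ?s) / \<tau>" using \<tau> by (intro divide_right_mono) auto
      moreover have "- (D * ?s) / \<tau> + r * ?s = - ((D / \<tau> - r) * ?s)" by (simp add: left_diff_distrib)
      ultimately have "?d + r * ?s \<le> - ((D / \<tau> - r) * ?s)" by linarith
      moreover have "h * c1 \<le> (D / \<tau> - r) * ?s" using r(2) s h(2) c1(2) by (intro mult_mono) auto
      ultimately show ?thesis by (simp add: mult.commute)
    next
      case nonpos: False
      then have s: "c1 \<le> - ?s" using c1(1)[OF False] by simp
      have "?d \<le> 0" using feas(1)[of i j] \<tau> by (simp add: divide_nonpos_pos)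
      moreover have "h * c1 \<le> r * (- ?s)" using r(1) s h(2) c1(2) by (intro mult_mono) auto
      then have "r * ?s \<le> - (c1 * h)" by (simp only: mult_minus_right mult.commute[of h c1])
      ultimately show ?thesis by linarith
    qed
    moreover have "a $ i + b $ j \<le> 2 * \<Lambda>" using ab(1)[of i] ab(2)[of j] by linarith
    ultimately have "?d + r * ?s + (a $ i + b $ j) \<le> ln \<epsilon>"
      using h(1) \<epsilon> by (simp add: ln_div)
    then have "exp (?d + r * ?s + (a $ i + b $ j)) \<le> \<epsilon>" using \<epsilon> by (metis exp_le_cancel_iff exp_ln)
    moreover have "\<mu> $ i * \<nu> $ j \<le> 1" using \<mu>[of i] \<nu>[of j] by (intro mult_le_one) (auto intro: less_imp_le)
    moreover have "0 < \<mu> $ i * \<nu> $ j" using \<mu>(1)[of i] \<nu>(1)[of j] by simp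
    ultimately have "\<mu> $ i * \<nu> $ j * exp (?d + r * ?s + (a $ i + b $ j)) \<le> 1 * \<epsilon>"
      by (intro mult_mono) auto
    then show ?thesis using False \<mu>(1)[of i] \<nu>(1)[of j] unfolding exponent by simp
  qed
qed

text \<open>
  The steps fall into three groups. In the first \<open>h\<close> and the last \<open>h + 1\<close> steps, with \<open>h = O(log(1/\<tau>))\<close>, the orbit and
  the line \<open>f + k\<tau>v\<close> move apart by \<open>O(\<tau>)\<close> per step. In between, the orbit is compared with the line
  shifted by \<open>\<tau>a\<close>, which is an orbit up to \<open>2\<tau>\<^sup>2\<close> per step. One step beyond the time \<open>D\<close> is admitted
  because a phase need not start at a multiple of \<open>\<tau>\<close>.
\<close>

lemma phase_tracking:
  fixes \<mu> :: "real^'m" and \<nu> :: "real^'n" and C :: "real^'n^'m" and c c1 V T1 :: real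
  assumes c: "c > 0" "\<And>i. c \<le> \<mu> $ i" "\<And>j. c \<le> \<nu> $ j"
    and sums: "(\<Sum>i\<in>UNIV. \<mu> $ i) = 1" "(\<Sum>j\<in>UNIV. \<nu> $ j) = 1"
    and c1: "c1 > 0" and V: "V \<ge> 0" and T1: "T1 \<ge> 0"
  shows "\<exists>K>0. \<forall>(\<tau> :: real) E Q v w f g (D :: real) (k :: nat). 0 < \<tau> \<and> \<tau> \<le> exp (- 1) \<and> certificate \<mu> \<nu> E Q v w \<and>
      (\<forall>i. \<bar>v $ i\<bar> \<le> V) \<and> (\<forall>i j. v $ i + w $ j \<noteq> 0 \<longrightarrow> c1 \<le> \<bar>v $ i + w $ j\<bar>) \<and>
      no_isolated_vertex E \<and> (\<forall>i j. f $ i + g $ j \<le> C $ i $ j) \<and> (\<forall>i j. (i, j) \<in> E \<longrightarrow> f $ i + g $ j = C $ i $ j) \<and>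
      (\<forall>i j. f $ i + g $ j + D * (v $ i + w $ j) \<le> C $ i $ j) \<and> D \<le> T1 \<and> k * \<tau> \<le> D + \<tau>
      \<longrightarrow> infnorm ((sinkhorn_step \<tau> \<mu> \<nu> C ^^ k) f - (f + (k * \<tau>) *\<^sub>R v)) \<le> K * \<tau> * ln (1 / \<tau>)"
proof -
  have \<mu>: "0 < \<mu> $ i" for i using c(1) c(2)[of i] by linarith
  have \<nu>: "0 < \<nu> $ j" for j using c(1) c(3)[of j] by linarith
  have \<mu>1: "\<mu> $ i \<le> 1" for i
    using member_le_sum[of i UNIV "\<lambda>i. \<mu> $ i"] \<mu> sums by (simp add: less_imp_le)
  have \<nu>1: "\<nu> $ j \<le> 1" for j
    using member_le_sum[of j UNIV "\<lambda>j. \<nu> $ j"] \<nu> sums by (simp add: less_imp_le)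
  have cle: "c \<le> 1" using c(2) \<mu>1 order_trans by blast
  define V1 where "V1 = 2 * ln (1 / c)"
  have V1: "V1 \<ge> 0" using cle c(1) by (simp add: V1_def)
  have c2: "0 < c * c" "c * c \<le> 1" using c(1) cle by (auto simp: mult_le_one)
  obtain K0 where K0: "K0 > 0" and scaling: "\<And>(A :: 'm \<Rightarrow> 'n \<Rightarrow> real) Q (\<epsilon> :: real).
    (\<forall>i j. 0 \<le> A i j \<and> A i j \<le> 1 \<and> 0 \<le> Q i j \<and> (Q i j > 0 \<longrightarrow> c * c \<le> A i j)) \<and>
    (\<forall>i. (\<Sum>j\<in>UNIV. Q i j) \<le> 1) \<and> 0 < \<epsilon> \<and> \<epsilon> \<le> 1 \<Longrightarrow>
    (\<exists>a b. (\<forall>i. \<bar>a i\<bar> \<le> K0 * (1 + ln (1 / \<epsilon>))) \<and> (\<forall>j. \<bar>b j\<bar> \<le> K0 * (1 + ln (1 / \<epsilon>))) \<and>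
       (\<forall>i. \<bar>(\<Sum>j\<in>UNIV. A i j * exp (a i + b j)) - (\<Sum>j\<in>UNIV. Q i j)\<bar> \<le> \<epsilon>) \<and>
       (\<forall>j. \<bar>(\<Sum>i\<in>UNIV. A i j * exp (a i + b j)) - (\<Sum>i\<in>UNIV. Q i j)\<bar> \<le> \<epsilon>))"
    using bounded_approximate_scaling[OF c2] by blast
  define N where "N = 1 + real CARD('m) + real CARD('n)"
  have N: "N \<ge> 1" "1 + real CARD('m) \<le> N" "1 + real CARD('n) \<le> N" by (auto simp: N_def)
  \<comment> \<open>With \<open>\<epsilon> = \<tau> \<epsilon>0\<close> and errors of at most \<open>N \<epsilon>\<close> in the marginals, the relative error is at most \<open>\<tau>/2\<close>,
    because the marginals are bounded below by \<open>c e^(-V)\<close>.\<close>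
  define \<epsilon>0 where "\<epsilon>0 = c * exp (- V) / (2 * N)"
  have e0: "0 < \<epsilon>0" using c N by (simp add: \<epsilon>0_def)
  have "c * exp (- V) \<le> 1" using cle c V by (intro mult_le_one) auto
  then have e01: "\<epsilon>0 \<le> 1" using N by (simp add: \<epsilon>0_def)
  define M where "M = 1 + ln (1 / \<epsilon>0)"
  have M: "M \<ge> 1" using e0 e01 by (simp add: M_def)
  define \<Lambda>0 where "\<Lambda>0 = K0 * (1 + M)"
  define H where "H = (2 * \<Lambda>0 + M) / c1 + 1"
  have \<Lambda>0: "\<Lambda>0 > 0" using K0 M by (simp add: \<Lambda>0_def)
  have H: "H \<ge> 1" using \<Lambda>0 M c1 by (simp add: H_def)
  define K where "K = (2 * H + 2) * (V1 + V) + 2 * \<Lambda>0 + 2 * T1"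
  have K: "K > 0" using H \<Lambda>0 V1 V T1 unfolding K_def by (intro add_pos_nonneg add_nonneg_pos) auto
  have "infnorm ((sinkhorn_step \<tau> \<mu> \<nu> C ^^ k) f - (f + (k * \<tau>) *\<^sub>R v)) \<le> K * \<tau> * ln (1 / \<tau>)"
    if \<tau>: "0 < \<tau>" "\<tau> \<le> exp (- 1)" and cert: "certificate \<mu> \<nu> E Q v w"
      and vV: "\<forall>i. \<bar>v $ i\<bar> \<le> V" and vw: "\<forall>i j. v $ i + w $ j \<noteq> 0 \<longrightarrow> c1 \<le> \<bar>v $ i + w $ j\<bar>"
      and E: "no_isolated_vertex E" and feas: "\<forall>i j. f $ i + g $ j \<le> C $ i $ j"
      and contact: "\<forall>i j. (i, j) \<in> E \<longrightarrow> f $ i + g $ j = C $ i $ j"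
      and feasD: "\<forall>i j. f $ i + g $ j + D * (v $ i + w $ j) \<le> C $ i $ j" and D: "D \<le> T1"
      and k: "k * \<tau> \<le> D + \<tau>"
    for \<tau> D :: real and E Q v w f g and k :: nat
  proof -
    let ?S = "sinkhorn_step \<tau> \<mu> \<nu> C"
    define l where "l = ln (1 / \<tau>)"
    have "ln \<tau> \<le> -1" using \<tau> by (metis exp_gt_zero ln_exp ln_le_cancel_iff)
    then have l: "l \<ge> 1" using \<tau> by (simp add: l_def ln_div)
    have \<tau>1: "\<tau> \<le> 1" using \<tau> by (smt (verit) exp_le_one_iff)
    define \<epsilon> where "\<epsilon> = \<tau> * \<epsilon>0"
    have \<epsilon>: "0 < \<epsilon>" "\<epsilon> \<le> 1" using \<tau> \<tau>1 e0 e01 by (auto simp: \<epsilon>_def mult_le_one)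
    have ln\<epsilon>: "ln (1 / \<epsilon>) = l + ln (1 / \<epsilon>0)" using \<tau> e0 by (simp add: \<epsilon>_def l_def ln_div ln_mult)
    have ln\<epsilon>_le: "ln (1 / \<epsilon>) \<le> M * l"
    proof -
      have "ln (1 / \<epsilon>0) * 1 \<le> ln (1 / \<epsilon>0) * l" using l e0 e01 by (intro mult_left_mono) auto
      then show ?thesis unfolding ln\<epsilon> M_def by (simp add: algebra_simps)
    qed
    define \<Lambda> where "\<Lambda> = K0 * (1 + ln (1 / \<epsilon>))"
    have \<Lambda>: "\<Lambda> \<le> \<Lambda>0 * l"
    proof -
      have "1 + ln (1 / \<epsilon>) \<le> (1 + M) * l" using ln\<epsilon>_le l by (simp add: algebra_simps)
      then have "K0 * (1 + ln (1 / \<epsilon>)) \<le> K0 * ((1 + M) * l)" using K0 by (intro mult_left_mono) auto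
      then show ?thesis by (simp add: \<Lambda>_def \<Lambda>0_def mult.assoc)
    qed
    \<comment> \<open>At a distance of \<open>h\<close> steps from both ends of the phase, a pair with \<open>v\<^sub>i + w\<^sub>j \<noteq> 0\<close> is damped so much
      that the shift by \<open>a\<close> and \<open>b\<close> cannot lift its weight above \<open>\<epsilon>\<close>.\<close>
    define h where "h = nat \<lceil>(2 * \<Lambda> + ln (1 / \<epsilon>)) / c1\<rceil>"
    have pos: "0 \<le> 2 * \<Lambda> + ln (1 / \<epsilon>)" using K0 \<epsilon> by (auto simp: \<Lambda>_def intro!: add_nonneg_nonneg)
    have "(2 * \<Lambda> + ln (1 / \<epsilon>)) / c1 \<le> h" unfolding h_def by linarith
    then have hlow: "2 * \<Lambda> + ln (1 / \<epsilon>) \<le> c1 * h" using c1 by (simp add: field_simps)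
    have hup: "h \<le> H * l"
    proof -
      have "h \<le> (2 * \<Lambda> + ln (1 / \<epsilon>)) / c1 + 1"
        unfolding h_def using pos c1 by (smt (verit) divide_nonneg_nonneg of_int_ceiling_le_add_one of_nat_nat zero_le_ceiling)
      also have "\<dots> \<le> (2 * (\<Lambda>0 * l) + M * l) / c1 + l"
        using \<Lambda> ln\<epsilon>_le l c1 by (intro add_mono divide_right_mono) auto
      also have "\<dots> = H * l" using c1 by (simp add: H_def field_simps)
      finally show ?thesis .
    qed
    have nonexp: "infnorm (?S x - ?S y) \<le> infnorm (x - y)" for x y
      by (rule sinkhorn_step_nonexpansive[OF \<tau>(1) \<mu> \<nu>])
    have contactX: "\<exists>j. f $ i + g $ j = C $ i $ j" and contactY: "\<exists>i. f $ i + g $ j = C $ i $ j" for i j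
      using contact E unfolding no_isolated_vertex_def by blast+
    have speed: "infnorm (?S f - f) \<le> \<tau> * V1"
      unfolding V1_def
      by (rule sinkhorn_step_near_contact(2)[OF \<tau>(1) c sums, where g = g])
        (use feas contactX contactY in blast)+
    have v_inf: "infnorm v \<le> V" using vV by (simp add: infnorm_le_iff)
    define x where "x = (\<lambda>r :: nat. infnorm ((?S ^^ r) f - (f + (r * \<tau>) *\<^sub>R v)))"
    have x_Suc: "x (Suc r) \<le> x r + \<tau> * (V1 + V)" for r
    proof -
      have "(?S ^^ Suc r) f - (f + (Suc r * \<tau>) *\<^sub>R v)
          = ((?S ^^ r) (?S f) - (?S ^^ r) f) + (((?S ^^ r) f - (f + (r * \<tau>) *\<^sub>R v)) + (- \<tau>) *\<^sub>R v)"
        by (simp add: funpow_swap1 algebra_simps)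
      then have "x (Suc r) \<le> infnorm ((?S ^^ r) (?S f) - (?S ^^ r) f) + (x r + infnorm ((- \<tau>) *\<^sub>R v))"
        unfolding x_def by (smt (verit) infnorm_triangle)
      moreover have "infnorm ((?S ^^ r) (?S f) - (?S ^^ r) f) \<le> \<tau> * V1"
        using funpow_nonexpansive[of ?S r "?S f" f, OF nonexp] speed by linarith
      moreover have "infnorm ((- \<tau>) *\<^sub>R v) \<le> \<tau> * V"
        using v_inf \<tau>(1) by (simp add: infnorm_mul infnorm_neg)
      ultimately show ?thesis by (simp add: algebra_simps)
    qed
    have x_add: "x (r + s) \<le> x r + s * (\<tau> * (V1 + V))" for r s
    proof (induction s)
      case (Suc s)
      then show ?case using x_Suc[of "r + s"] by (simp add: algebra_simps)
    qed simp
    have \<Lambda>nn: "0 \<le> \<Lambda>" using K0 \<epsilon> by (auto simp: \<Lambda>_def)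
    have x0: "x 0 = 0" by (simp add: x_def infnorm_0)
    have tV: "0 \<le> \<tau> * (V1 + V)" using \<tau> V V1 by simp
    have "x k \<le> real (2 * h + 2) * (\<tau> * (V1 + V)) + 2 * (\<tau> * \<Lambda>) + 2 * \<tau> * T1"
    proof (cases "k \<le> 2 * h + 2")
      case True
      have "x k \<le> k * (\<tau> * (V1 + V))" using x_add[of 0 k] x0 by simp
      also have "\<dots> \<le> real (2 * h + 2) * (\<tau> * (V1 + V))" using True tV by (intro mult_right_mono of_nat_mono) auto
      finally show ?thesis using \<Lambda>nn \<tau>(1) T1 by (smt (verit) mult_nonneg_nonneg)
    next
      case False
      define A where "A = (\<lambda>i j. if v $ i + w $ j = 0 then \<mu> $ i * \<nu> $ j * exp ((f $ i + g $ j - C $ i $ j) / \<tau>) else 0)"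
      have Q0: "0 \<le> Q $ i $ j" for i j using cert by (auto simp: certificate_def distributions_on_iff)
      have Qtot: "(\<Sum>i\<in>UNIV. \<Sum>j\<in>UNIV. Q $ i $ j) = 1" using cert by (auto simp: certificate_def distributions_on_iff)
      have QX: "(\<Sum>j\<in>UNIV. Q $ i $ j) = \<mu> $ i * exp (- v $ i)" and QY: "(\<Sum>i\<in>UNIV. Q $ i $ j) = \<nu> $ j" for i j
        using cert by (auto simp: certificate_def)
      have Q1: "(\<Sum>j\<in>UNIV. Q $ i $ j) \<le> 1" for i
        using member_le_sum[of i UNIV "\<lambda>i. \<Sum>j\<in>UNIV. Q $ i $ j"] Qtot by (simp add: sum_nonneg Q0)
      have mn: "0 < \<mu> $ i * \<nu> $ j" "\<mu> $ i * \<nu> $ j \<le> 1" "c * c \<le> \<mu> $ i * \<nu> $ j" for i j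
        using mult_pos_pos[OF \<mu> \<nu>] mult_le_one[OF \<mu>1 less_imp_le[OF \<nu>] \<nu>1]
          mult_mono[OF c(2,3) less_imp_le[OF \<mu>] less_imp_le[OF c(1)]] by blast+
      have A: "0 \<le> A i j \<and> A i j \<le> 1 \<and> 0 \<le> Q $ i $ j \<and> (Q $ i $ j > 0 \<longrightarrow> c * c \<le> A i j)" for i j
      proof -
        have "(f $ i + g $ j - C $ i $ j) / \<tau> \<le> 0" using feas \<tau>(1) by (simp add: divide_nonpos_pos)
        then have "\<mu> $ i * \<nu> $ j * exp ((f $ i + g $ j - C $ i $ j) / \<tau>) \<le> 1 * 1"
          using mn[of i j] by (intro mult_mono) auto
        moreover have "v $ i + w $ j = 0" "f $ i + g $ j = C $ i $ j" if "Q $ i $ j > 0"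
        proof -
          have "(i, j) \<in> E" using cert that unfolding certificate_def distributions_on_iff by (metis less_irrefl)
          then show "f $ i + g $ j = C $ i $ j" using contact by blast
          show "v $ i + w $ j = 0" using cert that by (auto simp: certificate_def)
        qed
        ultimately show ?thesis using mn[of i j] Q0[of i j] by (auto simp: A_def)
      qed
      obtain a' b' where ab': "\<And>i. \<bar>a' i\<bar> \<le> \<Lambda>" "\<And>j. \<bar>b' j\<bar> \<le> \<Lambda>"
        and AX: "\<And>i. \<bar>(\<Sum>j\<in>UNIV. A i j * exp (a' i + b' j)) - (\<Sum>j\<in>UNIV. Q $ i $ j)\<bar> \<le> \<epsilon>"
        and AY: "\<And>j. \<bar>(\<Sum>i\<in>UNIV. A i j * exp (a' i + b' j)) - (\<Sum>i\<in>UNIV. Q $ i $ j)\<bar> \<le> \<epsilon>"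
        using scaling[of A "\<lambda>i j. Q $ i $ j" \<epsilon>] A Q1 \<epsilon> unfolding \<Lambda>_def by blast
      define a :: "real^'m" where "a = (\<chi> i. a' i)"
      define b :: "real^'n" where "b = (\<chi> j. b' j)"
      have ab: "\<bar>a $ i\<bar> \<le> \<Lambda>" "\<bar>b $ j\<bar> \<le> \<Lambda>" for i j using ab' by (auto simp: a_def b_def)
      define y where "y = (\<lambda>r :: nat. infnorm ((?S ^^ r) f - (f + (r * \<tau>) *\<^sub>R v + \<tau> *\<^sub>R a)))"
      have ta: "infnorm (\<tau> *\<^sub>R a) \<le> \<tau> * \<Lambda>"
      proof -
        have "infnorm a \<le> \<Lambda>" using ab by (simp add: infnorm_le_iff)
        then show ?thesis using \<tau>(1) by (simp add: infnorm_mul)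
      qed
      have yx: "y r \<le> x r + \<tau> * \<Lambda>" "x r \<le> y r + \<tau> * \<Lambda>" for r
        using infnorm_triangle[of "(?S ^^ r) f - (f + (r * \<tau>) *\<^sub>R v)" "- (\<tau> *\<^sub>R a)"]
          infnorm_triangle[of "(?S ^^ r) f - (f + (r * \<tau>) *\<^sub>R v + \<tau> *\<^sub>R a)" "\<tau> *\<^sub>R a"] ta
        unfolding x_def y_def by (auto simp: infnorm_neg algebra_simps)
      have y_Suc: "y (Suc r) \<le> y r + 2 * \<tau> * \<tau>" if r: "h \<le> r" "(r + h) * \<tau> \<le> D" for r
      proof -
        define \<phi> where "\<phi> = f + (r * \<tau>) *\<^sub>R v + \<tau> *\<^sub>R a"
        define \<gamma> where "\<gamma> = g + (r * \<tau>) *\<^sub>R w + \<tau> *\<^sub>R b"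
        define W where "W = (\<lambda>i j. \<mu> $ i * \<nu> $ j * exp ((\<phi> $ i + \<gamma> $ j - C $ i $ j) / \<tau>))"
        have rD: "real h \<le> D / \<tau> - real r" using r(2) \<tau>(1) by (simp add: field_simps)
        have WA: "\<bar>W i j - A i j * exp (a' i + b' j)\<bar> \<le> \<epsilon>" for i j
          using ansatz_weight_error[of \<tau> \<mu> \<nu> v w c1 f g C D a \<Lambda> b \<epsilon> "real h" "real r" i j]
            \<tau>(1) \<mu> \<mu>1 \<nu> \<nu>1 vw c1 feas feasD ab hlow \<epsilon>(1) r(1) rD
          unfolding W_def A_def \<phi>_def \<gamma>_def by (simp add: a_def b_def)
        have N\<epsilon>: "N * \<epsilon> = \<tau> / 2 * (c * exp (- V))" using N by (simp add: \<epsilon>_def \<epsilon>0_def)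
        have Y: "\<bar>(\<Sum>i\<in>UNIV. W i j) - \<nu> $ j\<bar> \<le> \<tau> / 2 * \<nu> $ j" for j
        proof -
          have "\<bar>(\<Sum>i\<in>UNIV. W i j) - (\<Sum>i\<in>UNIV. A i j * exp (a' i + b' j))\<bar> \<le> (\<Sum>i\<in>(UNIV :: 'm set). \<epsilon>)"
            unfolding sum_subtractf[symmetric] by (rule order_trans[OF sum_abs sum_mono]) (rule WA)
          then have "\<bar>(\<Sum>i\<in>UNIV. W i j) - \<nu> $ j\<bar> \<le> (1 + real CARD('m)) * \<epsilon>"
            using AY[of j] unfolding QY by (simp add: algebra_simps)
          also have "\<dots> \<le> N * \<epsilon>" using N \<epsilon> by (intro mult_right_mono) auto
          also have "\<dots> \<le> \<tau> / 2 * \<nu> $ j"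
          proof -
            have "c * exp (- V) \<le> c * 1" using c(1) V by (intro mult_left_mono) auto
            then have "c * exp (- V) \<le> \<nu> $ j" using c(3)[of j] by simp
            then show ?thesis unfolding N\<epsilon> using \<tau>(1) by (intro mult_left_mono) auto
          qed
          finally show ?thesis .
        qed
        have X: "\<bar>(\<Sum>j\<in>UNIV. W i j) - \<mu> $ i * exp (- v $ i)\<bar> \<le> \<tau> / 2 * (\<mu> $ i * exp (- v $ i))" for i
        proof -
          have "\<bar>(\<Sum>j\<in>UNIV. W i j) - (\<Sum>j\<in>UNIV. A i j * exp (a' i + b' j))\<bar> \<le> (\<Sum>j\<in>(UNIV :: 'n set). \<epsilon>)"
            unfolding sum_subtractf[symmetric] by (rule order_trans[OF sum_abs sum_mono]) (rule WA)
          then have "\<bar>(\<Sum>j\<in>UNIV. W i j) - \<mu> $ i * exp (- v $ i)\<bar> \<le> (1 + real CARD('n)) * \<epsilon>"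
            using AX[of i] unfolding QX by (simp add: algebra_simps)
          also have "\<dots> \<le> N * \<epsilon>" using N \<epsilon> by (intro mult_right_mono) auto
          also have "\<dots> \<le> \<tau> / 2 * (\<mu> $ i * exp (- v $ i))"
          proof -
            have "v $ i \<le> V" using vV abs_le_D1 by blast
            then have "c * exp (- V) \<le> \<mu> $ i * exp (- v $ i)"
              using c(1) c(2)[of i] \<mu>[of i] by (intro mult_mono) auto
            then show ?thesis unfolding N\<epsilon> using \<tau>(1) by (intro mult_left_mono) auto
          qed
          finally show ?thesis .
        qed
        have "infnorm (?S \<phi> - (\<phi> + \<tau> *\<^sub>R v)) \<le> 4 * \<tau> * (\<tau> / 2)"
          by (rule ansatz_step[where \<gamma> = \<gamma>]) (use \<tau>(1) \<tau>1 \<mu> \<nu> X Y in \<open>auto simp: W_def\<close>)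
        moreover have "infnorm (?S ((?S ^^ r) f) - ?S \<phi>) \<le> y r"
          unfolding y_def \<phi>_def[symmetric] by (rule nonexp)
        moreover have "\<phi> + \<tau> *\<^sub>R v = f + (Suc r * \<tau>) *\<^sub>R v + \<tau> *\<^sub>R a"
          by (simp add: \<phi>_def algebra_simps)
        ultimately show ?thesis
          using infnorm_dist_triangle[of "?S ((?S ^^ r) f)" "\<phi> + \<tau> *\<^sub>R v" "?S \<phi>"]
          by (simp add: y_def)
      qed
      define k' where "k' = k - h - 1"
      have k': "k = k' + (h + 1)" "h \<le> k'" using False by (auto simp: k'_def)
      have y_add: "y (h + s) \<le> y h + s * (2 * \<tau> * \<tau>)" if "h + s \<le> k'" for s
        using that
      proof (induction s)
        case (Suc s)
        have "real (h + s + h) * \<tau> \<le> (real k - 1) * \<tau>"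
          using Suc.prems k' \<tau>(1) by (intro mult_right_mono) auto
        also have "\<dots> \<le> D" using k by (simp add: algebra_simps)
        finally have "y (Suc (h + s)) \<le> y (h + s) + 2 * \<tau> * \<tau>" by (intro y_Suc) auto
        then show ?case using Suc by (simp add: algebra_simps)
      qed simp
      have "real (k' - h) * \<tau> \<le> (real k - 1) * \<tau>" using k' \<tau>(1) by (intro mult_right_mono) auto
      also have "\<dots> \<le> T1" using k D by (simp add: algebra_simps)
      finally have "2 * \<tau> * (real (k' - h) * \<tau>) \<le> 2 * \<tau> * T1" using \<tau>(1) by (intro mult_left_mono) auto
      then have "y k' \<le> y h + 2 * \<tau> * T1" using y_add[of "k' - h"] k' by (simp add: algebra_simps)
      moreover have "x h \<le> h * (\<tau> * (V1 + V))" using x_add[of 0 h] x0 by simp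
      moreover have "x k \<le> x k' + real (h + 1) * (\<tau> * (V1 + V))" using x_add[of k' "h + 1"] k' by simp
      ultimately have "x k \<le> h * (\<tau> * (V1 + V)) + real (h + 1) * (\<tau> * (V1 + V)) + 2 * (\<tau> * \<Lambda>) + 2 * \<tau> * T1"
        using yx(1)[of h] yx(2)[of k'] by linarith
      also have "\<dots> \<le> real (2 * h + 2) * (\<tau> * (V1 + V)) + 2 * (\<tau> * \<Lambda>) + 2 * \<tau> * T1"
        using tV by (simp add: algebra_simps)
      finally show ?thesis .
    qed
    also have "\<dots> \<le> K * \<tau> * l"
    proof -
      have "real (2 * h + 2) * (\<tau> * (V1 + V)) \<le> ((2 * H + 2) * l) * (\<tau> * (V1 + V))"
        using hup l tV by (intro mult_right_mono) (auto simp: algebra_simps)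
      moreover have "\<tau> * \<Lambda> \<le> \<tau> * (\<Lambda>0 * l)" using \<Lambda> \<tau>(1) by (intro mult_left_mono) auto
      moreover have "2 * \<tau> * T1 \<le> 2 * \<tau> * T1 * l"
        using l T1 \<tau>(1) mult_left_mono[of 1 l "2 * \<tau> * T1"] by simp
      ultimately show ?thesis unfolding K_def by (simp add: algebra_simps)
    qed
    finally show ?thesis by (simp add: x_def l_def)
  qed
  then show ?thesis using K by (intro exI[of _ K]) blast
qed


section \<open>Geometry of the phases\<close>

text \<open>
  These are the pairs on the Pareto frontier. The condition on the contact set is the form in which
  membership is used.
\<close>

definition admissible :: "real^'n^'m \<Rightarrow> real^'m \<Rightarrow> real^'n \<Rightarrow> bool" where
  "admissible C f g \<longleftrightarrow> (\<forall>i j. f $ i + g $ j \<le> C $ i $ j) \<and> no_isolated_vertex (contact_set C f g)"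

lemma admissible_contact:
  assumes "admissible C f g"
  shows "\<exists>j. f $ i + g $ j = C $ i $ j" "\<exists>i. f $ i + g $ j = C $ i $ j"
  using assms unfolding admissible_def no_isolated_vertex_def contact_set_def by (auto simp: algebra_simps)

lemma f_hard_contact:
  fixes C :: "real^'n^'m"
  shows "f_hard C g $ i + g $ j \<le> C $ i $ j" and "\<exists>j. f_hard C g $ i + g $ j = C $ i $ j"
proof -
  have eq: "f_hard C g $ i = Min (range (\<lambda>j. C $ i $ j - g $ j))" by (simp add: f_hard_def)
  have "f_hard C g $ i \<le> C $ i $ j - g $ j" unfolding eq by (rule Min_le) auto
  then show "f_hard C g $ i + g $ j \<le> C $ i $ j" by simp
  have "f_hard C g $ i \<in> range (\<lambda>j. C $ i $ j - g $ j)" unfolding eq by (rule Min_in) auto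
  then show "\<exists>j. f_hard C g $ i + g $ j = C $ i $ j" by (auto simp: algebra_simps)
qed

lemma g_hard_contact:
  fixes C :: "real^'n^'m"
  shows "f $ i + g_hard C f $ j \<le> C $ i $ j" and "\<exists>i. f $ i + g_hard C f $ j = C $ i $ j"
proof -
  have eq: "g_hard C f = f_hard (transpose C) f" by (simp add: g_hard_def f_hard_def transpose_def)
  show "f $ i + g_hard C f $ j \<le> C $ i $ j"
    using f_hard_contact(1)[of "transpose C" f j i] by (simp add: eq transpose_def add.commute)
  show "\<exists>i. f $ i + g_hard C f $ j = C $ i $ j"
    using f_hard_contact(2)[of "transpose C" f j] by (simp add: eq transpose_def add.commute)
qed

text \<open>
  The contact of a row with the column where the minimum in \<open>f_hard\<close> is attained survives the update of
  \<open>g\<close>, because \<open>g_hard C (f_hard C g) \<ge> g\<close>.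
\<close>

lemma f_hard_g_hard_admissible:
  "admissible C (f_hard C g) (g_hard C (f_hard C g))"
proof -
  let ?f = "f_hard C g" and ?g = "g_hard C (f_hard C g)"
  have "\<exists>j. ?f $ i + ?g $ j = C $ i $ j" for i
  proof -
    obtain j where j: "?f $ i + g $ j = C $ i $ j" using f_hard_contact(2) by blast
    obtain k where "?f $ k + ?g $ j = C $ k $ j" using g_hard_contact(2) by blast
    then have "g $ j \<le> ?g $ j" using f_hard_contact(1)[of C g k j] by simp
    then have "?f $ i + ?g $ j = C $ i $ j" using j g_hard_contact(1)[where f = ?f and C = C and i = i and j = j] by simp
    then show ?thesis by blast
  qed
  then show ?thesis
    using g_hard_contact[where f = ?f and C = C] unfolding admissible_def no_isolated_vertex_def contact_set_def by auto
qed

lemma admissible_pareto: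
  assumes "admissible C f g"
  shows "(f, g) \<in> pareto_frontier (dual_polytope C)"
proof -
  have "(f', g') = (f, g)" if 1: "\<forall>i j. f' $ i + g' $ j \<le> C $ i $ j" "\<forall>i. f' $ i \<ge> f $ i" "\<forall>j. g' $ j \<ge> g $ j" for f' g'
  proof -
    have "f' $ i = f $ i" for i
      using admissible_contact(1)[OF assms, of i] 1 by (smt (verit))
    moreover have "g' $ j = g $ j" for j
      using admissible_contact(2)[OF assms, of j] 1 by (smt (verit))
    ultimately show ?thesis by (simp add: vec_eq_iff)
  qed
  then show ?thesis
    using assms unfolding pareto_frontier_def dual_polytope_def admissible_def by auto
qed

text \<open>
  Going from \<open>(i, j)\<close> through a contact of row \<open>i\<close> and a contact of column \<open>j\<close> compares the slack with
  four entries of \<open>C\<close>.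
\<close>

lemma admissible_gap:
  fixes C :: "real^'n^'m"
  assumes adm: "admissible C f g" and B: "\<And>i j. \<bar>C $ i $ j\<bar> \<le> B"
  shows "C $ i $ j - (f $ i + g $ j) \<le> 4 * B"
proof -
  obtain l where l: "f $ i + g $ l = C $ i $ l" using admissible_contact(1)[OF adm] by blast
  obtain k where k: "f $ k + g $ j = C $ k $ j" using admissible_contact(2)[OF adm] by blast
  have "f $ k + g $ l \<le> C $ k $ l" using adm by (simp add: admissible_def)
  then show ?thesis using l k B[of i j] B[of i l] B[of k j] B[of k l] by (simp add: abs_le_iff)
qed

definition crossing_times ::
  "real^'n^'m \<Rightarrow> ('m \<times> 'n) set \<Rightarrow> real \<Rightarrow> real^'m \<Rightarrow> real^'n \<Rightarrow> real^'m \<Rightarrow> real^'n \<Rightarrow> real set" where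
  "crossing_times C E t0 f g v w = {t. t0 \<le> t \<and>
     (\<exists>i j. (i, j) \<notin> E \<and> 0 \<le> f $ i + g $ j + (t - t0) * (v $ i + w $ j) - C $ i $ j)}"

lemma crossing_times_Inf:
  assumes "crossing_times C E t0 f g v w \<noteq> {}"
  shows "Inf (crossing_times C E t0 f g v w) \<in> crossing_times C E t0 f g v w"
    and "t \<in> crossing_times C E t0 f g v w \<Longrightarrow> Inf (crossing_times C E t0 f g v w) \<le> t"
proof -
  have bdd: "bdd_below (crossing_times C E t0 f g v w)"
    by (rule bdd_belowI[of _ t0]) (simp add: crossing_times_def)
  have "crossing_times C E t0 f g v w =
    {t0..} \<inter> (\<Union>(i, j)\<in>-E. {t. 0 \<le> f $ i + g $ j + (t - t0) * (v $ i + w $ j) - C $ i $ j})"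
    by (auto simp: crossing_times_def)
  moreover have "closed \<dots>"
    by (intro closed_Int closed_UN) (auto intro!: closed_Collect_le continuous_intros)
  ultimately show "Inf (crossing_times C E t0 f g v w) \<in> crossing_times C E t0 f g v w"
    using assms bdd by (intro closed_contains_Inf) auto
  show "t \<in> crossing_times C E t0 f g v w \<Longrightarrow> Inf (crossing_times C E t0 f g v w) \<le> t"
    by (rule cInf_lower[OF _ bdd])
qed

lemma SUP_ereal_nonneg_iff:
  fixes h :: "'a \<Rightarrow> ereal"
  assumes "finite A"
  shows "0 \<le> (SUP x\<in>A. h x) \<longleftrightarrow> (\<exists>x\<in>A. 0 \<le> h x)"
proof (cases "A = {}")
  case False
  then have "Sup (h ` A) = Max (h ` A)" using assms by (simp add: Max_Sup)
  then show ?thesis using assms False by (simp add: Max_ge_iff)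
qed (simp add: bot_ereal_def)

lemma transition_time_eq:
  fixes C :: "real^'n^'m"
  shows "transition_time C E t0 f g v w =
    (if crossing_times C E t0 f g v w = {} then \<infinity> else ereal (Inf (crossing_times C E t0 f g v w)))"
proof -
  have pairs: "(\<exists>x\<in>- E. 0 \<le> (case x of (i, j) \<Rightarrow> ereal (h i j))) \<longleftrightarrow> (\<exists>i j. (i, j) \<notin> E \<and> 0 \<le> h i j)" for h :: "'m \<Rightarrow> 'n \<Rightarrow> real"
  proof
    assume "\<exists>x\<in>- E. 0 \<le> (case x of (i, j) \<Rightarrow> ereal (h i j))"
    then obtain i j where "(i, j) \<notin> E" "0 \<le> ereal (h i j)" by force
    then show "\<exists>i j. (i, j) \<notin> E \<and> 0 \<le> h i j" by (intro exI[of _ i] exI[of _ j]) simp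
  next
    assume "\<exists>i j. (i, j) \<notin> E \<and> 0 \<le> h i j"
    then obtain i j where "(i, j) \<notin> E" "0 \<le> h i j" by blast
    then show "\<exists>x\<in>- E. 0 \<le> (case x of (i, j) \<Rightarrow> ereal (h i j))" by (intro bexI[of _ "(i, j)"]) auto
  qed
  have "{t. t0 \<le> t \<and> (SUP (i, j)\<in>- E. ereal (f $ i + g $ j + (t - t0) * (v $ i + w $ j) - C $ i $ j)) \<ge> 0}
     = crossing_times C E t0 f g v w"
    unfolding crossing_times_def SUP_ereal_nonneg_iff[OF finite] pairs ..
  moreover have "bdd_below (crossing_times C E t0 f g v w)"
    by (rule bdd_belowI[of _ t0]) (simp add: crossing_times_def)
  ultimately show ?thesis
    unfolding transition_time_def by (simp add: ereal_Inf' top_ereal_def)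
qed

text \<open>
  Along a phase, pairs in contact have nonpositive velocity, and the slack of any other pair is affine
  in time, so it would have to vanish before it becomes negative.
\<close>

lemma phase_feasible:
  fixes C :: "real^'n^'m"
  defines "X \<equiv> \<lambda>f g v w t0. crossing_times C (contact_set C f g) t0 f g v w"
  assumes adm: "admissible C f g" and cert: "certificate \<mu> \<nu> (contact_set C f g) Q v w"
    and t: "t0 \<le> t" "\<And>s. t0 \<le> s \<Longrightarrow> s < t \<Longrightarrow> s \<notin> X f g v w t0"
  shows "f $ i + g $ j + (t - t0) * (v $ i + w $ j) \<le> C $ i $ j"
proof (rule ccontr)
  assume "\<not> ?thesis"
  then have gt: "C $ i $ j < f $ i + g $ j + (t - t0) * (v $ i + w $ j)" by simp
  have feas: "f $ i + g $ j \<le> C $ i $ j" using adm by (simp add: admissible_def)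
  have notE: "(i, j) \<notin> contact_set C f g"
  proof
    assume "(i, j) \<in> contact_set C f g"
    then have "v $ i + w $ j \<le> 0" "f $ i + g $ j = C $ i $ j"
      using cert by (auto simp: certificate_def contact_set_def)
    then show False using gt t(1) mult_nonneg_nonpos[of "t - t0" "v $ i + w $ j"] by linarith
  qed
  then have "f $ i + g $ j < C $ i $ j" using feas by (force simp: contact_set_def)
  then have "0 < (t - t0) * (v $ i + w $ j)" using gt by linarith
  then have pos: "0 < v $ i + w $ j" using t(1) by (simp add: zero_less_mult_iff)
  define s where "s = t0 + (C $ i $ j - f $ i - g $ j) / (v $ i + w $ j)"
  have "t0 \<le> s" using feas pos by (simp add: s_def)
  moreover have "s < t" using gt pos by (simp add: s_def field_simps)
  moreover have "s \<in> X f g v w t0"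
    unfolding X_def crossing_times_def using notE pos \<open>t0 \<le> s\<close> by (auto simp: s_def intro!: exI[of _ i] exI[of _ j])
  ultimately show False using t(2) by blast
qed

text \<open>
  The support of \<open>Q\<close> stays in contact during the phase, and it meets every row and every column because
  both marginals of \<open>Q\<close> are positive.
\<close>

lemma phase_admissible:
  fixes C :: "real^'n^'m" and \<nu> :: "real^'n"
  assumes adm: "admissible C f g" and cert: "certificate \<mu> \<nu> (contact_set C f g) Q v w"
    and \<mu>: "\<And>i. \<mu> $ i > 0" and \<nu>: "\<And>j. \<nu> $ j > 0"
    and feas: "\<And>i j. f $ i + g $ j + s * (v $ i + w $ j) \<le> C $ i $ j"
  shows "admissible C (f + s *\<^sub>R v) (g + s *\<^sub>R w)" and "Q \<in> distributions_on (contact_set C (f + s *\<^sub>R v) (g + s *\<^sub>R w))"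
proof -
  let ?E = "contact_set C (f + s *\<^sub>R v) (g + s *\<^sub>R w)"
  have Q0: "0 \<le> Q $ i $ j" for i j using cert by (simp add: certificate_def distributions_on_iff)
  have supp: "(i, j) \<in> ?E" if "Q $ i $ j \<noteq> 0" for i j
  proof -
    have Q: "Q $ i $ j > 0" using Q0[of i j] that by linarith
    have "(i, j) \<in> contact_set C f g" using cert that by (auto simp: certificate_def distributions_on_iff)
    then have "f $ i + g $ j = C $ i $ j" by (simp add: contact_set_def)
    moreover have "v $ i + w $ j = 0" using cert Q by (simp add: certificate_def)
    ultimately have "f $ i + g $ j + s * (v $ i + w $ j) = C $ i $ j" by simp
    then show ?thesis by (simp add: contact_set_def algebra_simps)
  qed
  then show "Q \<in> distributions_on ?E" using cert by (auto simp: certificate_def distributions_on_iff)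
  have "\<exists>j. (i, j) \<in> ?E" for i
  proof (rule ccontr)
    assume "\<nexists>j. (i, j) \<in> ?E"
    then have "Q $ i $ j = 0" for j using supp by blast
    then have "(\<Sum>j\<in>UNIV. Q $ i $ j) = 0" by simp
    moreover have "(\<Sum>j\<in>UNIV. Q $ i $ j) = \<mu> $ i * exp (- v $ i)" using cert by (simp add: certificate_def)
    ultimately show False using \<mu>[of i] by simp
  qed
  moreover have "\<exists>i. (i, j) \<in> ?E" for j
  proof (rule ccontr)
    assume "\<nexists>i. (i, j) \<in> ?E"
    then have "Q $ i $ j = 0" for i using supp by blast
    then have "(\<Sum>i\<in>UNIV. Q $ i $ j) = 0" by simp
    moreover have "(\<Sum>i\<in>UNIV. Q $ i $ j) = \<nu> $ j" using cert by (simp add: certificate_def)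
    ultimately show False using \<nu>[of j] by simp
  qed
  ultimately show "admissible C (f + s *\<^sub>R v) (g + s *\<^sub>R w)"
    unfolding admissible_def no_isolated_vertex_def using feas by (auto simp: algebra_simps)
qed

text \<open>
  A pair that ends the phase had positive slack at the beginning, so it closes at positive speed and
  after a positive time.
\<close>

lemma phase_transition:
  fixes C :: "real^'n^'m"
  defines "X \<equiv> \<lambda>f g v w t0. crossing_times C (contact_set C f g) t0 f g v w"
  assumes adm: "admissible C f g" and cert: "certificate \<mu> \<nu> (contact_set C f g) Q v w"
    and ne: "X f g v w t0 \<noteq> {}"
  obtains i j where "t0 < Inf (X f g v w t0)"
    and "f $ i + g $ j + (Inf (X f g v w t0) - t0) * (v $ i + w $ j) = C $ i $ j" and "v $ i + w $ j > 0"
proof -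
  let ?T = "Inf (X f g v w t0)"
  have T: "?T \<in> X f g v w t0" using crossing_times_Inf(1) ne unfolding X_def .
  obtain i j where ij: "(i, j) \<notin> contact_set C f g" "0 \<le> f $ i + g $ j + (?T - t0) * (v $ i + w $ j) - C $ i $ j" "t0 \<le> ?T"
    using T by (auto simp: X_def crossing_times_def)
  have "f $ i + g $ j + (?T - t0) * (v $ i + w $ j) \<le> C $ i $ j"
    by (rule phase_feasible[OF adm cert ij(3)])
      (use crossing_times_Inf(2)[OF ne[unfolded X_def]] in \<open>force simp: X_def\<close>)
  then have eq: "f $ i + g $ j + (?T - t0) * (v $ i + w $ j) = C $ i $ j" using ij(2) by linarith
  have "f $ i + g $ j < C $ i $ j" using ij(1) adm unfolding admissible_def contact_set_def by (force simp: less_le)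
  then have "0 < (?T - t0) * (v $ i + w $ j)" using eq by linarith
  then show thesis using that[OF _ eq] ij(3) by (auto simp: zero_less_mult_iff)
qed

locale discrete_transport =
  fixes \<mu> :: "real^'m" and \<nu> :: "real^'n" and C :: "real^'n^'m"
  assumes mu_pos: "\<mu> $ i > 0" and mu_sum: "(\<Sum>i\<in>UNIV. \<mu> $ i) = 1"
    and nu_pos: "\<nu> $ j > 0" and nu_sum: "(\<Sum>j\<in>UNIV. \<nu> $ j) = 1"
begin

text \<open>
  Equals \<open>H(\<mu>\<^sup>*(E)|\<mu>)\<close> if \<open>E\<close> has no isolated vertex; it serves as the strictly decreasing quantity along the phases.
\<close>

definition speed_value :: "('m \<times> 'n) set \<Rightarrow> real" where
  "speed_value E = (\<Sum>j\<in>UNIV. \<nu> $ j * w_star \<mu> \<nu> E $ j)"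

definition crossings :: "real \<Rightarrow> real^'m \<Rightarrow> real^'n \<Rightarrow> real set" where
  "crossings t0 f g = crossing_times C (contact_set C f g) t0 f g
     (v_star \<mu> \<nu> (contact_set C f g)) (w_star \<mu> \<nu> (contact_set C f g))"

lemma admissible_certificate:
  assumes "admissible C f g"
  shows "\<exists>Q. certificate \<mu> \<nu> (contact_set C f g) Q
     (v_star \<mu> \<nu> (contact_set C f g)) (w_star \<mu> \<nu> (contact_set C f g))"
  using star_certificate[OF mu_pos mu_sum nu_pos nu_sum] assms by (simp add: admissible_def)

lemma phase_end:
  fixes f :: "real^'m" and g :: "real^'n" and t0 :: real
  defines "E \<equiv> contact_set C f g" and "T \<equiv> Inf (crossings t0 f g)"
  defines "v \<equiv> v_star \<mu> \<nu> E" and "w \<equiv> w_star \<mu> \<nu> E"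
  assumes adm: "admissible C f g" and ne: "crossings t0 f g \<noteq> {}"
  shows "t0 < T"
    and "\<And>s i j. t0 \<le> s \<Longrightarrow> s \<le> T \<Longrightarrow> f $ i + g $ j + (s - t0) * (v $ i + w $ j) \<le> C $ i $ j"
    and "\<And>s. t0 \<le> s \<Longrightarrow> s \<le> T \<Longrightarrow> admissible C (f + (s - t0) *\<^sub>R v) (g + (s - t0) *\<^sub>R w)"
    and "speed_value (contact_set C (f + (T - t0) *\<^sub>R v) (g + (T - t0) *\<^sub>R w)) < speed_value E"
    and "\<exists>i j. f $ i + g $ j + (T - t0) * (v $ i + w $ j) = C $ i $ j \<and> v $ i + w $ j > 0"
proof -
  obtain Q where cert: "certificate \<mu> \<nu> E Q v w"
    using admissible_certificate[OF adm] unfolding E_def v_def w_def by blast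
  note defs = E_def[symmetric] v_def[symmetric] w_def[symmetric]
  have X: "crossings t0 f g = crossing_times C E t0 f g v w" by (simp add: crossings_def defs)
  obtain i j where T: "t0 < T" and ij: "f $ i + g $ j + (T - t0) * (v $ i + w $ j) = C $ i $ j" "v $ i + w $ j > 0"
    using phase_transition[OF adm cert[unfolded E_def], of t0] ne unfolding T_def X defs by metis
  show "t0 < T" by (rule T)
  show "\<exists>i j. f $ i + g $ j + (T - t0) * (v $ i + w $ j) = C $ i $ j \<and> v $ i + w $ j > 0" using ij by blast
  show feas: "f $ i + g $ j + (s - t0) * (v $ i + w $ j) \<le> C $ i $ j" if "t0 \<le> s" "s \<le> T" for s i j
  proof (rule phase_feasible[OF adm cert[unfolded E_def] that(1)])
    fix r assume "t0 \<le> r" "r < s"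
    show "r \<notin> crossing_times C (contact_set C f g) t0 f g v w"
    proof
      assume "r \<in> crossing_times C (contact_set C f g) t0 f g v w"
      then have "T \<le> r" using crossing_times_Inf(2)[of C E t0 f g v w r] unfolding T_def X defs by blast
      then show False using \<open>r < s\<close> that(2) by simp
    qed
  qed
  show "admissible C (f + (s - t0) *\<^sub>R v) (g + (s - t0) *\<^sub>R w)" if "t0 \<le> s" "s \<le> T" for s
    by (rule phase_admissible(1)[OF adm cert[unfolded E_def] mu_pos nu_pos feas[OF that]])
  let ?E' = "contact_set C (f + (T - t0) *\<^sub>R v) (g + (T - t0) *\<^sub>R w)"
  have adm': "admissible C (f + (T - t0) *\<^sub>R v) (g + (T - t0) *\<^sub>R w)"
    and Q': "Q \<in> distributions_on ?E'"
    by (rule phase_admissible[OF adm cert[unfolded E_def] mu_pos nu_pos]; use feas T in auto)+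
  obtain Q'' where cert': "certificate \<mu> \<nu> ?E' Q'' (v_star \<mu> \<nu> ?E') (w_star \<mu> \<nu> ?E')"
    using admissible_certificate[OF adm'] by blast
  have "(i, j) \<in> ?E'" using ij(1) by (simp add: contact_set_def algebra_simps)
  from certificate_value_decreases[OF mu_pos nu_pos cert cert' Q' this ij(2)]
  show "speed_value ?E' < speed_value E" by (simp add: speed_value_def w_def)
qed

end


section \<open>Existence of the cold dynamics\<close>

lemma piecewise_linear_curve:
  fixes t :: "nat \<Rightarrow> real" and v :: "nat \<Rightarrow> 'a::real_normed_vector"
  assumes "\<And>l. l < L \<Longrightarrow> t l \<le> t (Suc l)"
  shows "\<exists>F. continuous_on UNIV F \<and> F (t 0) = a \<and>
    (\<forall>l\<le>L. \<forall>s. t l \<le> s \<and> (l < L \<longrightarrow> s \<le> t (Suc l)) \<longrightarrow> F s = F (t l) + (s - t l) *\<^sub>R v l)"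
  using assms
proof (induction L)
  case 0
  show ?case
    by (rule exI[of _ "\<lambda>s. a + (s - t 0) *\<^sub>R v 0"]) (auto intro!: continuous_intros)
next
  case (Suc L)
  obtain F where F: "continuous_on UNIV F" "F (t 0) = a"
    and lin: "\<And>l s. l \<le> L \<Longrightarrow> t l \<le> s \<Longrightarrow> (l < L \<longrightarrow> s \<le> t (Suc l)) \<Longrightarrow> F s = F (t l) + (s - t l) *\<^sub>R v l"
    using Suc.IH Suc.prems by (metis less_SucI)
  define T where "T = t (Suc L)"
  have mono: "t l \<le> T" if "l \<le> Suc L" for l
    unfolding T_def using that
  proof (induction rule: inc_induct)
    case (step n)
    then show ?case using Suc.prems[of n] by linarith
  qed simp
  define F' where "F' = (\<lambda>s. F (min s T) + max 0 (s - T) *\<^sub>R v (Suc L))"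
  have F'_low: "F' s = F s" if "s \<le> T" for s using that by (simp add: F'_def)
  have "continuous_on UNIV F'"
    unfolding F'_def by (intro continuous_intros continuous_on_compose2[OF F(1)]) auto
  moreover have "F' (t 0) = a" using F'_low mono[of 0] F(2) by simp
  moreover have "F' s = F' (t l) + (s - t l) *\<^sub>R v l"
    if l: "l \<le> Suc L" and s: "t l \<le> s" "l < Suc L \<longrightarrow> s \<le> t (Suc l)" for l s
  proof (cases "l = Suc L")
    case True
    then show ?thesis using s by (simp add: F'_def T_def)
  next
    case False
    then have "l \<le> L" "s \<le> t (Suc l)" using l s by auto
    moreover have "t (Suc l) \<le> T" using mono[of "Suc l"] \<open>l \<le> L\<close> by simp
    ultimately show ?thesis using lin[of l s] s F'_low[of s] F'_low[of "t l"] mono[of l] by simp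
  qed
  ultimately show ?case by blast
qed

lemma strict_decrease_injective:
  fixes h :: "'a \<Rightarrow> real" and E :: "nat \<Rightarrow> 'a"
  assumes "\<And>l. l < L \<Longrightarrow> h (E (Suc l)) < h (E l)"
  shows "inj_on E {..L}"
proof (rule inj_onI)
  have less: "h (E b) < h (E a)" if "a < b" "b \<le> L" for a b
    using that
  proof (induction b)
    case (Suc b)
    then show ?case using assms[of b] by (cases "a = b") (auto intro: order.strict_trans)
  qed simp
  fix a b assume "a \<in> {..L}" "b \<in> {..L}" "E a = E b"
  then show "a = b" using less[of a b] less[of b a] by (cases a b rule: linorder_cases) auto
qed

context discrete_transport
begin

text \<open>
  The phase data are iterated formally, also past the last phase. Since the value of the contact sets
  decreases strictly and there are finitely many of them, the set of crossing times becomes empty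
  at some index, and \<open>L\<close> is the first such index.
\<close>

lemma cold_sinkhorn_dynamics_exists:
  assumes adm: "admissible C f0 g0"
  shows "\<exists>L t v w E f g. cold_sinkhorn_dynamics \<mu> \<nu> C f0 g0 L t v w E f g"
proof -
  define nxt where "nxt = (\<lambda>(t, f, g). let T = Inf (crossings t f g); E = contact_set C f g in
     (T, f + (T - t) *\<^sub>R v_star \<mu> \<nu> E, g + (T - t) *\<^sub>R w_star \<mu> \<nu> E))"
  define state where "state = (\<lambda>l. (nxt ^^ l) (0 :: real, f0, g0))"
  define t where "t = (\<lambda>l. fst (state l))"
  define x where "x = (\<lambda>l. fst (snd (state l)))"
  define y where "y = (\<lambda>l. snd (snd (state l)))"
  define E where "E = (\<lambda>l. contact_set C (x l) (y l))"
  define v where "v = (\<lambda>l. v_star \<mu> \<nu> (E l))"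
  define w where "w = (\<lambda>l. w_star \<mu> \<nu> (E l))"
  define X where "X = (\<lambda>l. crossings (t l) (x l) (y l))"
  have state0: "t 0 = 0" "x 0 = f0" "y 0 = g0" by (simp_all add: t_def x_def y_def state_def)
  have stateS: "t (Suc l) = Inf (X l)" "x (Suc l) = x l + (t (Suc l) - t l) *\<^sub>R v l"
     "y (Suc l) = y l + (t (Suc l) - t l) *\<^sub>R w l" for l
    by (simp_all add: t_def x_def y_def state_def nxt_def X_def v_def w_def E_def Let_def split_beta)
  have eqs: "contact_set C (x l) (y l) = E l" "v_star \<mu> \<nu> (E l) = v l" "w_star \<mu> \<nu> (E l) = w l"
     "crossings (t l) (x l) (y l) = X l" "Inf (X l) = t (Suc l)" for l
    by (simp_all add: E_def v_def w_def X_def stateS(1))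
  have adm_l: "admissible C (x l) (y l)" if "\<And>k. k < l \<Longrightarrow> X k \<noteq> {}" for l
    using that
  proof (induction l)
    case 0
    show ?case using adm state0 by simp
  next
    case (Suc l)
    then have a: "admissible C (x l) (y l)" and ne: "X l \<noteq> {}" by auto
    note pe = phase_end[OF a ne[folded eqs(4)], unfolded eqs]
    show ?case using pe(3)[of "t (Suc l)"] pe(1) unfolding stateS(2,3) by simp
  qed
  have decr: "speed_value (E (Suc l)) < speed_value (E l)" "t l < t (Suc l)"
    if "\<And>k. k \<le> l \<Longrightarrow> X k \<noteq> {}" for l
  proof -
    have a: "admissible C (x l) (y l)" and ne: "X l \<noteq> {}" using adm_l that by auto
    note pe = phase_end[OF a ne[folded eqs(4)], unfolded eqs]
    show "t l < t (Suc l)" by (rule pe(1))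
    show "speed_value (E (Suc l)) < speed_value (E l)" using pe(4) unfolding E_def stateS(2,3) .
  qed
  have "\<exists>l. X l = {}"
  proof (rule ccontr)
    assume no: "\<nexists>l. X l = {}"
    have "inj_on E {..l}" for l
      by (rule strict_decrease_injective[of l speed_value]) (use decr(1) no in blast)
    then have "inj E" unfolding inj_def inj_on_def by (metis atMost_iff le_cases)
    then show False using finite_imageD[of E UNIV] by (auto intro: finite_subset[OF subset_UNIV])
  qed
  define L where "L = (LEAST l. X l = {})"
  have XL: "X L = {}" unfolding L_def by (rule LeastI_ex) fact
  have Xl: "X l \<noteq> {}" if "l < L" for l using that not_less_Least unfolding L_def by blast
  have mono: "t l \<le> t (Suc l)" if "l < L" for l using decr(2)[of l] Xl that by fastforce
  obtain f where f: "continuous_on UNIV f" "f (t 0) = f0"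
    and f_lin: "\<And>l s. l \<le> L \<Longrightarrow> t l \<le> s \<Longrightarrow> (l < L \<longrightarrow> s \<le> t (Suc l)) \<Longrightarrow> f s = f (t l) + (s - t l) *\<^sub>R v l"
    using piecewise_linear_curve[where t = t and v = v and a = f0 and L = L] mono by metis
  obtain g where g: "continuous_on UNIV g" "g (t 0) = g0"
    and g_lin: "\<And>l s. l \<le> L \<Longrightarrow> t l \<le> s \<Longrightarrow> (l < L \<longrightarrow> s \<le> t (Suc l)) \<Longrightarrow> g s = g (t l) + (s - t l) *\<^sub>R w l"
    using piecewise_linear_curve[where t = t and v = w and a = g0 and L = L] mono by metis
  have fx: "f (t l) = x l" and gy: "g (t l) = y l" if "l \<le> L" for l
    using that
  proof (induction l)
    case 0
    { case 1 show ?case using f state0 by simp }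
    { case 2 show ?case using g state0 by simp }
  next
    case (Suc l)
    have s: "l \<le> L" "t l \<le> t (Suc l)" if "Suc l \<le> L" using that mono[of l] by auto
    { case 1 show ?case using f_lin[of l "t (Suc l)"] Suc.IH(1) s 1 by (simp add: stateS(2)) }
    { case 2 show ?case using g_lin[of l "t (Suc l)"] Suc.IH(2) s 2 by (simp add: stateS(3)) }
  qed
  define T where "T = (\<lambda>l. transition_time C (E l) (t l) (f (t l)) (g (t l)) (v l) (w l))"
  have T: "T l = (if X l = {} then \<infinity> else ereal (t (Suc l)))" if "l \<le> L" for l
    unfolding T_def transition_time_eq fx[OF that] gy[OF that] stateS(1)
    by (simp add: X_def crossings_def E_def v_def w_def)
  define phase where "phase = (\<lambda>l. {s. t l \<le> s \<and> ereal s < T l})"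
  have in_phase: "t l \<le> s \<and> (l < L \<longrightarrow> s \<le> t (Suc l))" if "l \<le> L" "s \<in> phase l" for l s
    using that T[of l] Xl[of l] by (auto simp: phase_def)
  have deriv: "(f has_vector_derivative v l) (at s within phase l) \<and> (g has_vector_derivative w l) (at s within phase l)"
    if l: "l \<le> L" and s: "s \<in> phase l" for l s
  proof
    show "(f has_vector_derivative v l) (at s within phase l)"
      by (rule has_vector_derivative_transform[OF s, of _ "\<lambda>s. f (t l) + (s - t l) *\<^sub>R v l"])
        (use f_lin[OF l] in_phase[OF l] in \<open>auto intro!: derivative_eq_intros\<close>)
    show "(g has_vector_derivative w l) (at s within phase l)"
      by (rule has_vector_derivative_transform[OF s, of _ "\<lambda>s. g (t l) + (s - t l) *\<^sub>R w l"])
        (use g_lin[OF l] in_phase[OF l] in \<open>auto intro!: derivative_eq_intros\<close>)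
  qed
  have "cold_sinkhorn_dynamics \<mu> \<nu> C f0 g0 L t v w E f g"
    unfolding cold_sinkhorn_dynamics_def Let_def T_def[symmetric]
  proof (intro conjI allI impI)
    show "continuous_on {0..} f" "continuous_on {0..} g" using f g continuous_on_subset by blast+
    show "f 0 = f0" "g 0 = g0" using f g state0 by simp_all
    show "t 0 = 0" "E 0 = contact_set C f0 g0" using state0 by (simp_all add: E_def)
    show "no_isolated_vertex (E l)" if "l \<le> L" for l
    proof -
      have "admissible C (x l) (y l)" using adm_l Xl that by (meson less_le_trans)
      then show ?thesis by (simp add: E_def admissible_def)
    qed
    show "v l = v_star \<mu> \<nu> (E l)" "w l = w_star \<mu> \<nu> (E l)" for l by (simp_all add: v_def w_def)
    show "T l = ereal (t (Suc l))" if "l < L" for l using T[of l] Xl[of l] that by simp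
    show "E (Suc l) = contact_set C (f (t l) + (t (Suc l) - t l) *\<^sub>R v l) (g (t l) + (t (Suc l) - t l) *\<^sub>R w l)"
      if "l < L" for l
      using fx[of l] gy[of l] that by (simp add: E_def stateS(2,3))
    show "T L = \<infinity>" using T[of L] XL by simp
    show "\<forall>s\<in>{s. t l \<le> s \<and> ereal s < T l}.
         (f has_vector_derivative v l) (at s within {s. t l \<le> s \<and> ereal s < T l}) \<and>
         (g has_vector_derivative w l) (at s within {s. t l \<le> s \<and> ereal s < T l})" if "l \<le> L" for l
      using deriv[OF that] unfolding phase_def by blast
  qed
  then show ?thesis by blast
qed

end


section \<open>Structure of an arbitrary cold dynamics\<close>

lemma linear_on_closed_interval:
  fixes h :: "real \<Rightarrow> 'a::real_normed_vector"
  assumes cont: "continuous_on {a..b} h"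
    and deriv: "\<And>s. a \<le> s \<Longrightarrow> s < b \<Longrightarrow> (h has_vector_derivative u) (at s within {a..<b})"
    and s: "a \<le> s" "s \<le> b"
  shows "h s = h a + (s - a) *\<^sub>R u"
proof (cases "a < b")
  case True
  define d where "d = (\<lambda>s. h s - (s - a) *\<^sub>R u)"
  have "(d has_vector_derivative 0) (at x within {a..<b})" if "x \<in> {a..<b}" for x
    unfolding d_def using deriv[of x] that by (auto intro!: derivative_eq_intros)
  then obtain c where c: "\<And>x. x \<in> {a..<b} \<Longrightarrow> d x = c"
    using has_vector_derivative_zero_constant[of "{a..<b}" d] by (metis convex_real_interval(7))
  have "continuous_on (closure {a..<b}) d"
    unfolding closure_atLeastLessThan[OF True] d_def by (intro continuous_intros cont)
  then have "d s = c"
    by (rule continuous_constant_on_closure) (use c s closure_atLeastLessThan[OF True] in auto)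
  moreover have "d a = c" using c True by simp
  ultimately show ?thesis by (simp add: d_def algebra_simps)
next
  case False
  then have "s = a" using s by simp
  then show ?thesis by simp
qed

lemma finite_nonzero_bounded_away:
  fixes S :: "real set"
  assumes "finite S"
  shows "\<exists>c>0. \<forall>x\<in>S. x \<noteq> 0 \<longrightarrow> c \<le> \<bar>x\<bar>"
proof (cases "S - {0} = {}")
  case False
  have fin: "finite (abs ` (S - {0}))" using assms by simp
  have "Min (abs ` (S - {0})) \<in> abs ` (S - {0})" using fin False by (intro Min_in) auto
  then have "0 < Min (abs ` (S - {0}))" by auto
  then show ?thesis using fin by (intro exI[of _ "Min (abs ` (S - {0}))"]) auto
qed (auto intro: exI[of _ 1])

context discrete_transport
begin

text \<open>
  The defining conditions fix the one-sided derivative on each half-open phase only; continuity carries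
  the affine formula to the transition time, where it identifies the next contact set.
\<close>

lemma dynamics_phases:
  assumes dyn: "cold_sinkhorn_dynamics \<mu> \<nu> C f0 g0 L t v w E f g" and adm: "admissible C f0 g0"
  shows "t 0 = 0" "f 0 = f0" "g 0 = g0"
    and "l \<le> L \<Longrightarrow> 0 \<le> t l" "l \<le> L \<Longrightarrow> admissible C (f (t l)) (g (t l))"
    and "l \<le> L \<Longrightarrow> E l = contact_set C (f (t l)) (g (t l))"
    and "l \<le> L \<Longrightarrow> v l = v_star \<mu> \<nu> (E l)" "l \<le> L \<Longrightarrow> w l = w_star \<mu> \<nu> (E l)"
    and "l < L \<Longrightarrow> crossings (t l) (f (t l)) (g (t l)) \<noteq> {}"
    and "l < L \<Longrightarrow> t (Suc l) = Inf (crossings (t l) (f (t l)) (g (t l)))"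
    and "l < L \<Longrightarrow> t l \<le> s \<Longrightarrow> s \<le> t (Suc l) \<Longrightarrow> f s = f (t l) + (s - t l) *\<^sub>R v l"
    and "l < L \<Longrightarrow> t l \<le> s \<Longrightarrow> s \<le> t (Suc l) \<Longrightarrow> g s = g (t l) + (s - t l) *\<^sub>R w l"
proof -
  define T where "T = (\<lambda>l. transition_time C (E l) (t l) (f (t l)) (g (t l)) (v l) (w l))"
  have cont: "continuous_on {0..} f" "continuous_on {0..} g"
    and init: "f 0 = f0" "g 0 = g0" "t 0 = 0" "E 0 = contact_set C f0 g0"
    and speeds: "\<And>l. l \<le> L \<Longrightarrow> v l = v_star \<mu> \<nu> (E l)" "\<And>l. l \<le> L \<Longrightarrow> w l = w_star \<mu> \<nu> (E l)"
    and T: "\<And>l. l < L \<Longrightarrow> T l = ereal (t (Suc l))"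
    and E_Suc: "\<And>l. l < L \<Longrightarrow> E (Suc l) = contact_set C (f (t l) + (t (Suc l) - t l) *\<^sub>R v l)
                                       (g (t l) + (t (Suc l) - t l) *\<^sub>R w l)"
    and deriv: "\<And>l s. l \<le> L \<Longrightarrow> t l \<le> s \<Longrightarrow> ereal s < T l \<Longrightarrow>
         (f has_vector_derivative v l) (at s within {s. t l \<le> s \<and> ereal s < T l}) \<and>
         (g has_vector_derivative w l) (at s within {s. t l \<le> s \<and> ereal s < T l})"
    using dyn unfolding cold_sinkhorn_dynamics_def Let_def T_def Ball_def mem_Collect_eq by blast+
  have linear: "f s = f (t l) + (s - t l) *\<^sub>R v l" "g s = g (t l) + (s - t l) *\<^sub>R w l"
    if l: "l < L" "0 \<le> t l" and s: "t l \<le> s" "s \<le> t (Suc l)" for l s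
  proof -
    have ph: "{s. t l \<le> s \<and> ereal s < T l} = {t l..<t (Suc l)}" using T[OF l(1)] by auto
    have d: "(f has_vector_derivative v l) (at s within {t l..<t (Suc l)})"
       "(g has_vector_derivative w l) (at s within {t l..<t (Suc l)})" if "t l \<le> s" "s < t (Suc l)" for s
      using deriv[of l s] l(1) that T[OF l(1)] unfolding ph by auto
    have c: "continuous_on {t l..t (Suc l)} f" "continuous_on {t l..t (Suc l)} g"
      using l(2) by (auto intro: continuous_on_subset[OF cont(1)] continuous_on_subset[OF cont(2)])
    show "f s = f (t l) + (s - t l) *\<^sub>R v l" by (rule linear_on_closed_interval[OF c(1) d(1) s])
    show "g s = g (t l) + (s - t l) *\<^sub>R w l" by (rule linear_on_closed_interval[OF c(2) d(2) s])
  qed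
  have cross: "crossings (t l) (f (t l)) (g (t l)) \<noteq> {} \<and> t (Suc l) = Inf (crossings (t l) (f (t l)) (g (t l)))"
    if l: "l < L" and El: "E l = contact_set C (f (t l)) (g (t l))" for l
  proof -
    have "crossing_times C (E l) (t l) (f (t l)) (g (t l)) (v l) (w l) = crossings (t l) (f (t l)) (g (t l))"
      using speeds[of l] l by (simp add: crossings_def El)
    then show ?thesis using T[OF l] unfolding T_def transition_time_eq by (auto split: if_splits)
  qed
  have main: "0 \<le> t l \<and> admissible C (f (t l)) (g (t l)) \<and> E l = contact_set C (f (t l)) (g (t l))" if "l \<le> L" for l
    using that
  proof (induction l)
    case 0
    show ?case using init adm by simp
  next
    case (Suc l)
    then have l: "l < L" and a: "admissible C (f (t l)) (g (t l))" and El: "E l = contact_set C (f (t l)) (g (t l))"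
      and tl: "0 \<le> t l" by auto
    note X = cross[OF l El]
    note pe = phase_end[OF a conjunct1[OF X], folded El conjunct2[OF X]]
    have lt: "t l < t (Suc l)" by (rule pe(1))
    have eqs: "v_star \<mu> \<nu> (E l) = v l" "w_star \<mu> \<nu> (E l) = w l" using speeds[of l] l by simp_all
    have fS: "f (t (Suc l)) = f (t l) + (t (Suc l) - t l) *\<^sub>R v l"
      and gS: "g (t (Suc l)) = g (t l) + (t (Suc l) - t l) *\<^sub>R w l"
      using linear[OF l tl, of "t (Suc l)"] lt by auto
    have "admissible C (f (t (Suc l))) (g (t (Suc l)))"
      using pe(3)[of "t (Suc l)"] lt unfolding fS gS eqs by simp
    then show ?case using lt tl E_Suc[OF l] unfolding fS gS by simp
  qed
  show "t 0 = 0" "f 0 = f0" "g 0 = g0" using init by simp_all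
  show "l \<le> L \<Longrightarrow> 0 \<le> t l" "l \<le> L \<Longrightarrow> admissible C (f (t l)) (g (t l))"
    "l \<le> L \<Longrightarrow> E l = contact_set C (f (t l)) (g (t l))" using main by blast+
  show "l \<le> L \<Longrightarrow> v l = v_star \<mu> \<nu> (E l)" "l \<le> L \<Longrightarrow> w l = w_star \<mu> \<nu> (E l)" by (fact speeds)+
  show "l < L \<Longrightarrow> crossings (t l) (f (t l)) (g (t l)) \<noteq> {}"
    "l < L \<Longrightarrow> t (Suc l) = Inf (crossings (t l) (f (t l)) (g (t l)))" using cross[of l] main[of l] by auto
  show "l < L \<Longrightarrow> t l \<le> s \<Longrightarrow> s \<le> t (Suc l) \<Longrightarrow> f s = f (t l) + (s - t l) *\<^sub>R v l"
    "l < L \<Longrightarrow> t l \<le> s \<Longrightarrow> s \<le> t (Suc l) \<Longrightarrow> g s = g (t l) + (s - t l) *\<^sub>R w l"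
    using linear[of l s] main[of l] by auto
qed

lemma dynamics_phase_end:
  assumes dyn: "cold_sinkhorn_dynamics \<mu> \<nu> C f0 g0 L t v w E f g" and adm: "admissible C f0 g0" and l: "l < L"
  shows "t l < t (Suc l)"
    and "\<And>s i j. t l \<le> s \<Longrightarrow> s \<le> t (Suc l) \<Longrightarrow> f (t l) $ i + g (t l) $ j + (s - t l) * (v l $ i + w l $ j) \<le> C $ i $ j"
    and "\<And>s. t l \<le> s \<Longrightarrow> s \<le> t (Suc l) \<Longrightarrow> admissible C (f s) (g s)"
    and "speed_value (E (Suc l)) < speed_value (E l)"
    and "\<exists>i j. f (t l) $ i + g (t l) $ j + (t (Suc l) - t l) * (v l $ i + w l $ j) = C $ i $ j \<and> v l $ i + w l $ j > 0"
proof -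
  note d = dynamics_phases[OF dyn adm]
  have a: "admissible C (f (t l)) (g (t l))" using d(5) l by simp
  have eqs: "contact_set C (f (t l)) (g (t l)) = E l" "v_star \<mu> \<nu> (E l) = v l" "w_star \<mu> \<nu> (E l) = w l"
    "Inf (crossings (t l) (f (t l)) (g (t l))) = t (Suc l)"
    using d(6)[of l] d(7)[of l] d(8)[of l] d(10)[of l] l by simp_all
  note pe = phase_end[OF a d(9)[OF l], unfolded eqs]
  show lt: "t l < t (Suc l)" by (rule pe(1))
  show "f (t l) $ i + g (t l) $ j + (s - t l) * (v l $ i + w l $ j) \<le> C $ i $ j" if "t l \<le> s" "s \<le> t (Suc l)" for s i j
    by (rule pe(2)[OF that])
  show "admissible C (f s) (g s)" if "t l \<le> s" "s \<le> t (Suc l)" for s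
    using pe(3)[OF that] unfolding d(11,12)[OF l that] .
  show "speed_value (E (Suc l)) < speed_value (E l)"
    using pe(4) d(6)[of "Suc l"] d(11)[OF l, of "t (Suc l)"] d(12)[OF l, of "t (Suc l)"] lt l by simp
  show "\<exists>i j. f (t l) $ i + g (t l) $ j + (t (Suc l) - t l) * (v l $ i + w l $ j) = C $ i $ j \<and> v l $ i + w l $ j > 0"
    by (rule pe(5))
qed

lemma dynamics_admissible:
  assumes dyn: "cold_sinkhorn_dynamics \<mu> \<nu> C f0 g0 L t v w E f g" and adm: "admissible C f0 g0"
    and "l \<le> L" "0 \<le> s" "s \<le> t l"
  shows "admissible C (f s) (g s)"
  using assms(3-)
proof (induction l)
  case 0
  then show ?case using dynamics_phases(1-3)[OF dyn adm] adm by simp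
next
  case (Suc l)
  then show ?case using dynamics_phase_end(3)[OF dyn adm, of l s] by (cases "s \<le> t l") auto
qed

lemma dynamics_length:
  assumes dyn: "cold_sinkhorn_dynamics \<mu> \<nu> C f0 g0 L t v w E f g" and adm: "admissible C f0 g0"
  shows "L \<le> 2 ^ (CARD('m) * CARD('n)) - 1"
proof -
  have "inj_on E {..L}"
    by (rule strict_decrease_injective[of L speed_value]) (rule dynamics_phase_end(4)[OF dyn adm])
  then have "card {..L} \<le> card (UNIV :: ('m \<times> 'n) set set)" by (rule card_inj_on_le) auto
  also have "\<dots> = 2 ^ (CARD('m) * CARD('n))" by (simp add: card_UNIV_set card_prod flip: UNIV_Times_UNIV)
  finally show ?thesis by simp
qed


section \<open>The error estimate\<close>

lemma speed_bounds:
  obtains V c1 where "V \<ge> 0" "c1 > 0" "\<And>E i. \<bar>v_star \<mu> \<nu> E $ i\<bar> \<le> V"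
    and "\<And>E i j. v_star \<mu> \<nu> E $ i + w_star \<mu> \<nu> E $ j \<noteq> 0 \<Longrightarrow> c1 \<le> \<bar>v_star \<mu> \<nu> E $ i + w_star \<mu> \<nu> E $ j\<bar>"
proof -
  let ?S = "range (\<lambda>(E, i). \<bar>v_star \<mu> \<nu> E $ i\<bar>)"
  let ?R = "range (\<lambda>(E, i, j). v_star \<mu> \<nu> E $ i + w_star \<mu> \<nu> E $ j)"
  have "finite ?S" by (rule finite_imageI) simp
  then have 1: "\<bar>v_star \<mu> \<nu> E $ i\<bar> \<le> Max ?S" for E i by (intro Max_ge) (auto intro: rev_image_eqI[of "(E, i)"])
  have "finite ?R" by (rule finite_imageI) simp
  then obtain c1 where c1: "c1 > 0" "\<forall>x\<in>?R. x \<noteq> 0 \<longrightarrow> c1 \<le> \<bar>x\<bar>"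
    using finite_nonzero_bounded_away by blast
  have "v_star \<mu> \<nu> E $ i + w_star \<mu> \<nu> E $ j \<in> ?R" for E i j by (auto intro: rev_image_eqI[of "(E, i, j)"])
  then have 2: "v_star \<mu> \<nu> E $ i + w_star \<mu> \<nu> E $ j \<noteq> 0 \<Longrightarrow> c1 \<le> \<bar>v_star \<mu> \<nu> E $ i + w_star \<mu> \<nu> E $ j\<bar>" for E i j
    using c1(2) by blast
  have "0 \<le> Max ?S" using order_trans[OF abs_ge_zero 1] .
  then show thesis using that[OF _ c1(1) 1 2] by blast
qed

lemma entries_bounded_below:
  obtains c where "c > 0" "c \<le> 1" "\<And>i. c \<le> \<mu> $ i" "\<And>j. c \<le> \<nu> $ j"
proof -
  let ?c = "Min (range (\<lambda>i. \<mu> $ i) \<union> range (\<lambda>j. \<nu> $ j))"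
  have le: "?c \<le> \<mu> $ i" "?c \<le> \<nu> $ j" for i j by (auto intro!: Min_le)
  have "?c \<in> range (\<lambda>i. \<mu> $ i) \<union> range (\<lambda>j. \<nu> $ j)" by (rule Min_in) auto
  then have pos: "?c > 0" using mu_pos nu_pos by auto
  have "\<mu> $ i \<le> 1" for i
    using member_le_sum[of i UNIV "\<lambda>i. \<mu> $ i"] mu_pos mu_sum by (simp add: less_imp_le)
  then have "?c \<le> 1" using le(1) order_trans by blast
  then show thesis using that pos le by blast
qed

text \<open>
  Induction over the phases. In a new phase the orbit is compared with the orbit of the exact position
  \<open>f(t\<^sub>l)\<close>; by nonexpansiveness the distance of these two orbits does not exceed the error at time \<open>t\<^sub>l\<close>.
\<close>

lemma sinkhorn_tracks_dynamics:
  shows "\<exists>K>0. \<forall>(\<tau> :: real) \<phi> a b L t v w E f g l s. 0 < \<tau> \<and> \<tau> \<le> exp (- 1) \<and>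
     cold_sinkhorn_dynamics \<mu> \<nu> C a b L t v w E f g \<and> admissible C a b \<and> l \<le> L \<and> 0 \<le> s \<and> s \<le> t l \<longrightarrow>
     infnorm ((sinkhorn_step \<tau> \<mu> \<nu> C ^^ nat \<lfloor>s / \<tau>\<rfloor>) \<phi> - f s) \<le> infnorm (\<phi> - a) + real l * (K * \<tau> * ln (1 / \<tau>))"
proof -
  obtain c where c: "c > 0" "c \<le> 1" "\<And>i. c \<le> \<mu> $ i" "\<And>j. c \<le> \<nu> $ j" by (rule entries_bounded_below) blast
  obtain V c1 where V: "V \<ge> 0" and c1: "c1 > 0" and vV: "\<And>E i. \<bar>v_star \<mu> \<nu> E $ i\<bar> \<le> V"
    and vw: "\<And>E i j. v_star \<mu> \<nu> E $ i + w_star \<mu> \<nu> E $ j \<noteq> 0 \<Longrightarrow> c1 \<le> \<bar>v_star \<mu> \<nu> E $ i + w_star \<mu> \<nu> E $ j\<bar>"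
    by (rule speed_bounds) blast
  define B where "B = Max (range (\<lambda>(i, j). \<bar>C $ i $ j\<bar>))"
  have B: "\<bar>C $ i $ j\<bar> \<le> B" for i j unfolding B_def by (rule Max_ge) (auto intro: rev_image_eqI[of "(i, j)"])
  have B0: "0 \<le> B" using order_trans[OF abs_ge_zero B] .
  \<comment> \<open>A bound for the length of every phase but the last: some pair closes a slack of at most \<open>4 * B\<close>
    with a speed of at least \<open>c1\<close>.\<close>
  define T1 where "T1 = 4 * B / c1"
  have T1: "T1 \<ge> 0" using B0 c1 by (simp add: T1_def)
  obtain K0 where K0: "K0 > 0" and track: "\<And>(\<tau> :: real) E Q v w f g (D :: real) (k :: nat). 0 < \<tau> \<and> \<tau> \<le> exp (- 1) \<and> certificate \<mu> \<nu> E Q v w \<and>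
      (\<forall>i. \<bar>v $ i\<bar> \<le> V) \<and> (\<forall>i j. v $ i + w $ j \<noteq> 0 \<longrightarrow> c1 \<le> \<bar>v $ i + w $ j\<bar>) \<and>
      no_isolated_vertex E \<and> (\<forall>i j. f $ i + g $ j \<le> C $ i $ j) \<and> (\<forall>i j. (i, j) \<in> E \<longrightarrow> f $ i + g $ j = C $ i $ j) \<and>
      (\<forall>i j. f $ i + g $ j + D * (v $ i + w $ j) \<le> C $ i $ j) \<and> D \<le> T1 \<and> k * \<tau> \<le> D + \<tau>
      \<Longrightarrow> infnorm ((sinkhorn_step \<tau> \<mu> \<nu> C ^^ k) f - (f + (k * \<tau>) *\<^sub>R v)) \<le> K0 * \<tau> * ln (1 / \<tau>)"
    using phase_tracking[OF c(1,3,4) mu_sum nu_sum c1 V T1, of C] by blast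
  define K where "K = K0 + V"
  have K: "K > 0" using K0 V by (simp add: K_def)
  have "infnorm ((sinkhorn_step \<tau> \<mu> \<nu> C ^^ nat \<lfloor>s / \<tau>\<rfloor>) \<phi> - f s) \<le> infnorm (\<phi> - f0) + real l * (K * \<tau> * ln (1 / \<tau>))"
    if \<tau>: "0 < \<tau>" "\<tau> \<le> exp (- 1)" and dyn: "cold_sinkhorn_dynamics \<mu> \<nu> C f0 g0 L t v w E f g"
      and adm: "admissible C f0 g0" and "l \<le> L" "0 \<le> s" "s \<le> t l"
    for \<tau> :: real and \<phi> f0 g0 L t v w E f g l s
    using that(5-)
  proof (induction l arbitrary: s)
    case 0
    then show ?case using dynamics_phases(1-3)[OF dyn adm] by simp
  next
    case (Suc l)
    let ?S = "sinkhorn_step \<tau> \<mu> \<nu> C"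
    note d = dynamics_phases[OF dyn adm] and e = dynamics_phase_end[OF dyn adm]
    have ln1: "1 \<le> ln (1 / \<tau>)"
      using \<tau> ln_le_cancel_iff[of \<tau> "exp (- 1)"] by (simp add: ln_div)
    have Kpos: "0 \<le> K * \<tau> * ln (1 / \<tau>)" using K \<tau> ln1 by (intro mult_nonneg_nonneg) linarith+
    have l: "l < L" using Suc.prems by simp
    show ?case
    proof (cases "s \<le> t l")
      case True
      then have "infnorm ((?S ^^ nat \<lfloor>s / \<tau>\<rfloor>) \<phi> - f s) \<le> infnorm (\<phi> - f0) + real l * (K * \<tau> * ln (1 / \<tau>))"
        using Suc.IH[of s] Suc.prems l by simp
      then show ?thesis using Kpos by (simp add: algebra_simps)
    next
      case False
      then have s: "t l \<le> s" "s \<le> t (Suc l)" using Suc.prems by auto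
      have tl: "0 \<le> t l" using d(4) l by simp
      define r where "r = nat \<lfloor>t l / \<tau>\<rfloor>"
      define k where "k = nat \<lfloor>s / \<tau>\<rfloor> - r"
      have le: "t l / \<tau> \<le> s / \<tau>" using s \<tau> by (simp add: divide_right_mono)
      have "r \<le> nat \<lfloor>s / \<tau>\<rfloor>" unfolding r_def using le by (intro nat_mono floor_mono)
      then have rk: "nat \<lfloor>s / \<tau>\<rfloor> = k + r" by (simp add: k_def)
      have fl: "real r \<le> t l / \<tau>" "t l / \<tau> < real r + 1" "real (k + r) \<le> s / \<tau>" "s / \<tau> < real (k + r) + 1"
      proof -
        have nf: "real (nat \<lfloor>u\<rfloor>) \<le> u \<and> u < real (nat \<lfloor>u\<rfloor>) + 1" if "0 \<le> u" for u :: real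
          using that by linarith
        have "0 \<le> t l / \<tau>" "0 \<le> s / \<tau>" using tl \<tau> Suc.prems(2) by auto
        then show "real r \<le> t l / \<tau>" "t l / \<tau> < real r + 1" "real (k + r) \<le> s / \<tau>" "s / \<tau> < real (k + r) + 1"
          using nf[of "t l / \<tau>"] nf[of "s / \<tau>"] unfolding r_def[symmetric] rk by blast+
      qed
      have k1: "\<bar>k * \<tau> - (s - t l)\<bar> \<le> \<tau>"
      proof -
        have "real k - 1 < s / \<tau> - t l / \<tau>" "s / \<tau> - t l / \<tau> < k + 1" using fl by auto
        then have "(real k - 1) * \<tau> < s - t l" "s - t l < (k + 1) * \<tau>"
          using \<tau>(1) by (simp_all add: field_simps)
        then show ?thesis by (simp add: algebra_simps abs_le_iff)
      qed
      have E: "E l = contact_set C (f (t l)) (g (t l))" and v: "v l = v_star \<mu> \<nu> (E l)" and w: "w l = w_star \<mu> \<nu> (E l)"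
        using d(6-8)[of l] l by auto
      have a: "admissible C (f (t l)) (g (t l))" using d(5) l by simp
      obtain Q where Q: "certificate \<mu> \<nu> (E l) Q (v l) (w l)"
        using admissible_certificate[OF a] unfolding E[symmetric] v[symmetric] w[symmetric] by blast
      obtain i j where ij: "f (t l) $ i + g (t l) $ j + (t (Suc l) - t l) * (v l $ i + w l $ j) = C $ i $ j" "v l $ i + w l $ j > 0"
        using e(5)[OF l] by blast
      have "c1 \<le> v l $ i + w l $ j" using vw[of "E l" i j] ij(2) unfolding v w by auto
      then have "(t (Suc l) - t l) * c1 \<le> (t (Suc l) - t l) * (v l $ i + w l $ j)"
        using e(1)[OF l] by (intro mult_left_mono) auto
      also have "\<dots> \<le> 4 * B" using admissible_gap[OF a B, of i j] ij(1) by linarith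
      finally have "t (Suc l) - t l \<le> T1" using c1 by (simp add: T1_def field_simps)
      then have D: "s - t l \<le> T1" using s by simp
      have "infnorm ((?S ^^ k) (f (t l)) - (f (t l) + (k * \<tau>) *\<^sub>R v l)) \<le> K0 * \<tau> * ln (1 / \<tau>)"
      proof (rule track[of _ "E l" Q _ "w l" _ "g (t l)" "s - t l"], intro conjI allI impI)
        show "0 < \<tau>" "\<tau> \<le> exp (- 1)" "certificate \<mu> \<nu> (E l) Q (v l) (w l)" "s - t l \<le> T1" by fact+
        show "\<bar>v l $ i\<bar> \<le> V" for i unfolding v by (rule vV)
        show "c1 \<le> \<bar>v l $ i + w l $ j\<bar>" if "v l $ i + w l $ j \<noteq> 0" for i j using vw that unfolding v w .
        show "no_isolated_vertex (E l)" using a by (simp add: E admissible_def)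
        show "f (t l) $ i + g (t l) $ j \<le> C $ i $ j" for i j using a by (simp add: admissible_def)
        show "f (t l) $ i + g (t l) $ j = C $ i $ j" if "(i, j) \<in> E l" for i j using that by (simp add: E contact_set_def)
        show "f (t l) $ i + g (t l) $ j + (s - t l) * (v l $ i + w l $ j) \<le> C $ i $ j" for i j by (rule e(2)[OF l s])
        show "real k * \<tau> \<le> s - t l + \<tau>" using k1 by linarith
      qed
      moreover have "infnorm ((?S ^^ k) ((?S ^^ r) \<phi>) - (?S ^^ k) (f (t l))) \<le> infnorm (\<phi> - f0) + real l * (K * \<tau> * ln (1 / \<tau>))"
        using funpow_nonexpansive[of ?S k "(?S ^^ r) \<phi>" "f (t l)", OF sinkhorn_step_nonexpansive[OF \<tau>(1) mu_pos nu_pos]]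
          Suc.IH[of "t l"] l tl unfolding r_def by fastforce
      moreover have "infnorm ((f (t l) + (k * \<tau>) *\<^sub>R v l) - f s) \<le> V * \<tau> * ln (1 / \<tau>)"
      proof -
        have "(f (t l) + (k * \<tau>) *\<^sub>R v l) - f s = (k * \<tau> - (s - t l)) *\<^sub>R v l"
          unfolding d(11)[OF l s] by (simp add: algebra_simps)
        then have "infnorm ((f (t l) + (k * \<tau>) *\<^sub>R v l) - f s) = \<bar>k * \<tau> - (s - t l)\<bar> * infnorm (v l)"
          by (simp add: infnorm_mul)
        also have "\<dots> \<le> \<tau> * V"
          using k1 V \<tau> vV unfolding v by (intro mult_mono) (auto simp: infnorm_le_iff infnorm_pos_le)
        also have "\<dots> \<le> \<tau> * V * ln (1 / \<tau>)" using ln1 \<tau> V mult_left_mono[of 1 "ln (1 / \<tau>)" "\<tau> * V"] by simp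
        finally show ?thesis by (simp add: mult.commute)
      qed
      moreover have "infnorm ((?S ^^ (k + r)) \<phi> - f s) \<le> infnorm ((?S ^^ k) ((?S ^^ r) \<phi>) - (?S ^^ k) (f (t l)))
         + (infnorm ((?S ^^ k) (f (t l)) - (f (t l) + (k * \<tau>) *\<^sub>R v l)) + infnorm ((f (t l) + (k * \<tau>) *\<^sub>R v l) - f s))"
        using infnorm_dist_triangle[of "(?S ^^ (k + r)) \<phi>" "f s" "(?S ^^ k) (f (t l))"]
          infnorm_dist_triangle[of "(?S ^^ k) (f (t l))" "f s" "f (t l) + (k * \<tau>) *\<^sub>R v l"]
        by (simp add: funpow_add)
      ultimately show ?thesis unfolding rk K_def by (simp add: algebra_simps)
    qed
  qed
  then show ?thesis using K by (intro exI[of _ K] conjI allI impI) auto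
qed

end

theorem theorem4p1:
  fixes \<mu> :: "real^'m" and \<nu> :: "real^'n" and C :: "real^'n^'m"
  assumes "\<mu> \<in> prob_simplex" and "\<And>i. \<mu> $ i > 0"
    and "\<nu> \<in> prob_simplex" and "\<And>j. \<nu> $ j > 0"
  shows "\<exists>\<tau>0>0. \<exists>B>0. \<forall>\<tau>. 0 < \<tau> \<and> \<tau> \<le> \<tau>0 \<longrightarrow> (\<forall>(f0 :: real^'m) (g0 :: real^'n).
    let fbar = f_hard C g0;
        gbar = g_hard C fbar;
        F = (\<lambda>k. fst (sinkhorn \<tau> \<mu> \<nu> C f0 g0 k));
        G = (\<lambda>k. snd (sinkhorn \<tau> \<mu> \<nu> C f0 g0 k))
    in (fbar, gbar) \<in> pareto_frontier (dual_polytope C) \<and>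
       (\<exists>L t v w E f g. cold_sinkhorn_dynamics \<mu> \<nu> C fbar gbar L t v w E f g) \<and>
       (\<forall>L t v w E f g. cold_sinkhorn_dynamics \<mu> \<nu> C fbar gbar L t v w E f g \<longrightarrow>
          L \<le> 2 ^ (CARD('m) * CARD('n)) - 1 \<and>
          (SUP s\<in>{0..t L}. ereal (infnorm (F (nat \<lfloor>2 * s / \<tau>\<rfloor> + 2) - f s)
                                 + infnorm (G (nat \<lfloor>2 * s / \<tau>\<rfloor> + 2) - g s)))
            \<le> ereal (B * \<tau> * ln (1 / \<tau>) ^ (2 * L + 1))))"
proof -
  interpret discrete_transport \<mu> \<nu> C
    using assms by unfold_locales (auto simp: prob_simplex_def)
  obtain c where c: "c > 0" "c \<le> 1" "\<And>i. c \<le> \<mu> $ i" "\<And>j. c \<le> \<nu> $ j" by (rule entries_bounded_below) blast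
  obtain K where K: "K > 0" and track: "\<And>(\<tau> :: real) \<phi> a b L t v w E f g l s. 0 < \<tau> \<and> \<tau> \<le> exp (- 1) \<and>
     cold_sinkhorn_dynamics \<mu> \<nu> C a b L t v w E f g \<and> admissible C a b \<and> l \<le> L \<and> 0 \<le> s \<and> s \<le> t l \<Longrightarrow>
     infnorm ((sinkhorn_step \<tau> \<mu> \<nu> C ^^ nat \<lfloor>s / \<tau>\<rfloor>) \<phi> - f s) \<le> infnorm (\<phi> - a) + real l * (K * \<tau> * ln (1 / \<tau>))"
    using sinkhorn_tracks_dynamics by blast
  define a where "a = ln (1 / c)"
  have a: "a \<ge> 0" using c by (simp add: a_def)
  define B where "B = 7 * a + 4 * (2 ^ (CARD('m) * CARD('n)) * K)"
  have B: "B > 0" using a K by (simp add: B_def add_nonneg_pos)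
  have bound: "infnorm (fst (sinkhorn \<tau> \<mu> \<nu> C f0 g0 (nat \<lfloor>2 * s / \<tau>\<rfloor> + 2)) - f s)
      + infnorm (snd (sinkhorn \<tau> \<mu> \<nu> C f0 g0 (nat \<lfloor>2 * s / \<tau>\<rfloor> + 2)) - g s) \<le> B * \<tau> * ln (1 / \<tau>) ^ (2 * L + 1)"
    if \<tau>: "0 < \<tau>" "\<tau> \<le> exp (- 1)"
      and dyn: "cold_sinkhorn_dynamics \<mu> \<nu> C (f_hard C g0) (g_hard C (f_hard C g0)) L t v w E f g"
      and s: "0 \<le> s" "s \<le> t L"
    for \<tau> f0 g0 L t v w E f g s
  proof -
    let ?S = "sinkhorn_step \<tau> \<mu> \<nu> C"
    define \<phi> where "\<phi> = f_soft \<tau> \<nu> C g0"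
    define r where "r = nat \<lfloor>s / \<tau>\<rfloor>"
    define l where "l = ln (1 / \<tau>)"
    have l1: "1 \<le> l" using \<tau> ln_le_cancel_iff[of \<tau> "exp (- 1)"] by (simp add: l_def ln_div)
    note adm = f_hard_g_hard_admissible[of C g0]
    have init: "infnorm (\<phi> - f_hard C g0) \<le> \<tau> * a"
      unfolding \<phi>_def a_def
      by (rule f_soft_near_contact[OF \<tau>(1) c(1,4) nu_sum f_hard_contact])
    have L: "real L \<le> 2 ^ (CARD('m) * CARD('n))"
    proof -
      have "L \<le> 2 ^ (CARD('m) * CARD('n))" using dynamics_length[OF dyn adm] by simp
      then have "real L \<le> real (2 ^ (CARD('m) * CARD('n)))" by (simp only: of_nat_le_iff)
      then show ?thesis by simp
    qed
    define X where "X = \<tau> * a + 2 ^ (CARD('m) * CARD('n)) * (K * \<tau> * l)"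
    have f_err: "infnorm ((?S ^^ r) \<phi> - f s) \<le> X"
    proof -
      have "infnorm ((?S ^^ r) \<phi> - f s) \<le> infnorm (\<phi> - f_hard C g0) + real L * (K * \<tau> * l)"
        unfolding r_def l_def by (rule track[where b = "g_hard C (f_hard C g0)" and L = L and t = t and v = v and w = w and E = E and g = g])
          (use \<tau> dyn adm s in simp)
      also have "\<dots> \<le> X" unfolding X_def using init L K \<tau> l1 by (intro add_mono mult_right_mono) auto
      finally show ?thesis .
    qed
    have adm_s: "admissible C (f s) (g s)" by (rule dynamics_admissible[OF dyn adm order_refl s])
    have feas: "f s $ i + g s $ j \<le> C $ i $ j" for i j using adm_s by (simp add: admissible_def)
    note near = sinkhorn_step_near_contact[OF \<tau>(1) c(1,3,4) mu_sum nu_sum feas admissible_contact[OF adm_s], folded a_def]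
    have g_err: "infnorm (g_soft \<tau> \<mu> C ((?S ^^ r) \<phi>) - g s) \<le> X + \<tau> * a"
      using infnorm_dist_triangle[of "g_soft \<tau> \<mu> C ((?S ^^ r) \<phi>)" "g s" "g_soft \<tau> \<mu> C (f s)"]
        g_soft_nonexpansive[OF \<tau>(1) mu_pos, of C "(?S ^^ r) \<phi>" "f s"] f_err near(1) by linarith
    have f_err': "infnorm ((?S ^^ Suc r) \<phi> - f s) \<le> X + \<tau> * (2 * a)"
      using infnorm_dist_triangle[of "?S ((?S ^^ r) \<phi>)" "f s" "?S (f s)"]
        sinkhorn_step_nonexpansive[OF \<tau>(1) mu_pos nu_pos, of C "(?S ^^ r) \<phi>" "f s"] f_err near(2) by simp
    have "\<lfloor>2 * s / \<tau>\<rfloor> = 2 * \<lfloor>s / \<tau>\<rfloor> \<or> \<lfloor>2 * s / \<tau>\<rfloor> = 2 * \<lfloor>s / \<tau>\<rfloor> + 1"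
    proof -
      have "2 * s / \<tau> = 2 * (s / \<tau>)" by simp
      then show ?thesis by linarith
    qed
    moreover have "0 \<le> \<lfloor>s / \<tau>\<rfloor>" using s \<tau> by simp
    ultimately have "nat \<lfloor>2 * s / \<tau>\<rfloor> + 2 = 2 * r + 2 \<or> nat \<lfloor>2 * s / \<tau>\<rfloor> + 2 = 2 * r + 3"
      unfolding r_def by linarith
    then have "infnorm (fst (sinkhorn \<tau> \<mu> \<nu> C f0 g0 (nat \<lfloor>2 * s / \<tau>\<rfloor> + 2)) - f s)
      + infnorm (snd (sinkhorn \<tau> \<mu> \<nu> C f0 g0 (nat \<lfloor>2 * s / \<tau>\<rfloor> + 2)) - g s) \<le> (X + \<tau> * (2 * a)) + (X + \<tau> * a)"
    proof
      assume k: "nat \<lfloor>2 * s / \<tau>\<rfloor> + 2 = 2 * r + 2"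
      have "0 \<le> \<tau> * (2 * a)" using \<tau> a by simp
      then show ?thesis using f_err g_err unfolding k sinkhorn_even fst_conv snd_conv \<phi>_def[symmetric] by linarith
    next
      assume k: "nat \<lfloor>2 * s / \<tau>\<rfloor> + 2 = 2 * r + 3"
      show ?thesis using f_err' g_err unfolding k sinkhorn_odd fst_conv snd_conv \<phi>_def[symmetric] by linarith
    qed
    also have "\<dots> \<le> B * \<tau> * l"
    proof -
      have "\<tau> * a \<le> \<tau> * a * l" using l1 \<tau> a mult_left_mono[of 1 l "\<tau> * a"] by simp
      moreover have "0 \<le> 2 ^ (CARD('m) * CARD('n)) * (K * \<tau> * l)" using K \<tau> l1 by simp
      moreover have "0 \<le> \<tau> * a * l" using \<tau> a l1 by simp
      moreover have "B * \<tau> * l = 7 * (\<tau> * a * l) + 4 * (2 ^ (CARD('m) * CARD('n)) * (K * \<tau> * l))"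
        by (simp add: B_def algebra_simps)
      ultimately show ?thesis unfolding X_def by linarith
    qed
    also have "\<dots> \<le> B * \<tau> * l ^ (2 * L + 1)"
      using B \<tau> l1 self_le_power[of l "2 * L + 1"] by (intro mult_left_mono) auto
    finally show ?thesis by (simp only: l_def)
  qed
  show ?thesis
  proof (rule exI[of _ "exp (- 1)"], rule conjI[OF exp_gt_zero], rule exI[of _ B], intro conjI allI impI)
    show "0 < B" by (rule B)
  next
    fix \<tau> :: real and f0 :: "real^'m" and g0 :: "real^'n"
    assume \<tau>: "0 < \<tau> \<and> \<tau> \<le> exp (- 1)"
    note adm = f_hard_g_hard_admissible[of C g0]
    show "let fbar = f_hard C g0;
        gbar = g_hard C fbar;
        F = (\<lambda>k. fst (sinkhorn \<tau> \<mu> \<nu> C f0 g0 k));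
        G = (\<lambda>k. snd (sinkhorn \<tau> \<mu> \<nu> C f0 g0 k))
    in (fbar, gbar) \<in> pareto_frontier (dual_polytope C) \<and>
       (\<exists>L t v w E f g. cold_sinkhorn_dynamics \<mu> \<nu> C fbar gbar L t v w E f g) \<and>
       (\<forall>L t v w E f g. cold_sinkhorn_dynamics \<mu> \<nu> C fbar gbar L t v w E f g \<longrightarrow>
          L \<le> 2 ^ (CARD('m) * CARD('n)) - 1 \<and>
          (SUP s\<in>{0..t L}. ereal (infnorm (F (nat \<lfloor>2 * s / \<tau>\<rfloor> + 2) - f s)
                                 + infnorm (G (nat \<lfloor>2 * s / \<tau>\<rfloor> + 2) - g s)))
            \<le> ereal (B * \<tau> * ln (1 / \<tau>) ^ (2 * L + 1)))"
      unfolding Let_def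
    proof (intro conjI allI impI)
      show "(f_hard C g0, g_hard C (f_hard C g0)) \<in> pareto_frontier (dual_polytope C)"
        by (rule admissible_pareto[OF adm])
      show "\<exists>L t v w E f g. cold_sinkhorn_dynamics \<mu> \<nu> C (f_hard C g0) (g_hard C (f_hard C g0)) L t v w E f g"
        by (rule cold_sinkhorn_dynamics_exists[OF adm])
    next
      fix L t v w E f g
      assume dyn: "cold_sinkhorn_dynamics \<mu> \<nu> C (f_hard C g0) (g_hard C (f_hard C g0)) L t v w E f g"
      show "L \<le> 2 ^ (CARD('m) * CARD('n)) - 1" by (rule dynamics_length[OF dyn adm])
      show "(SUP s\<in>{0..t L}. ereal (infnorm (fst (sinkhorn \<tau> \<mu> \<nu> C f0 g0 (nat \<lfloor>2 * s / \<tau>\<rfloor> + 2)) - f s)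
                                 + infnorm (snd (sinkhorn \<tau> \<mu> \<nu> C f0 g0 (nat \<lfloor>2 * s / \<tau>\<rfloor> + 2)) - g s)))
            \<le> ereal (B * \<tau> * ln (1 / \<tau>) ^ (2 * L + 1))"
        by (rule SUP_least) (use bound[OF _ _ dyn] \<tau> in auto)
    qed
  qed
qed

end
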